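(* Fix positive integers $n$ and $k$. The set $\{\hat{s}_\nu : \nu\vdash n,\ \mathrm{rank}(\nu)=k,\ \ell(\nu)=k\}$ is a basis of the $\mathbb{Q}$-vector space $\mathrm{span}_{\mathbb{Q}}\{\hat{s}_\lambda : \lambda\vdash n,\ \mathrm{rank}(\lambda)=k\}$.
   Context: For a partition $\lambda$, $\ell(\lambda)$ is its number of nonzero parts and $\mathrm{rank}(\lambda)$ (Frobenius rank) is the largest $i$ with $\lambda_i\ge i$. $p_\nu=p_{\nu_1}p_{\nu_2}\cdots$ are power sum symmetric functions, $z_\nu=\prod_i i^{m_i(\nu)}m_i(\nu)!$ where $m_i(\nu)$ is the number of parts of $\nu$ equal to $i$, and $\chi^\lambda(\nu)$ is the value of the irreducible character of $S_n$ indexed by $\lambda\vdash n$ on permutations of cycle type $\nu$. The bottom Schur function is $\hat{s}_\lambda=\sum_{\nu\vdash n,\ \ell(\nu)=\mathrm{rank}(\lambda)}\chi^\lambda(\nu)\,p_\nu/z_\nu$, i.e. the lowest-degree part of $s_\lambda=\sum_\nu\chi^\lambda(\nu)p_\nu/z_\nu$ when each $p_i$ is given degree $1$. *)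

theory Defs
  imports
    Complex_Main
    "HOL-Library.Function_Algebras"
    "HOL-Library.Multiset"
    "HOL-Library.Poly_Mapping"
    "HOL-Combinatorics.Permutations"
    "HOL-Combinatorics.Orbits"
begin

section \<open>Functions with rational values as a vector space\<close>

definition qscale :: "rat \<Rightarrow> ('a \<Rightarrow> rat) \<Rightarrow> 'a \<Rightarrow> rat" where
  "qscale c f = (\<lambda>x. c * f x)"

global_interpretation qvec: vector_space "qscale :: rat \<Rightarrow> ('a \<Rightarrow> rat) \<Rightarrow> 'a \<Rightarrow> rat"
  by unfold_locales (auto simp: qscale_def fun_eq_iff algebra_simps)

text \<open>The trace of a linear map \<open>T\<close> on a finite-dimensional \<open>T\<close>-invariant subspace \<open>V\<close>;
  it does not depend on the chosen basis.\<close>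

definition trace_on :: "('a \<Rightarrow> rat) set \<Rightarrow> (('a \<Rightarrow> rat) \<Rightarrow> ('a \<Rightarrow> rat)) \<Rightarrow> rat" where
  "trace_on V T =
    (let B = (SOME B. qvec.independent B \<and> qvec.span B = V)
     in \<Sum>b\<in>B. qvec.representation B (T b) b)"


section \<open>Partitions\<close>

definition is_partition :: "nat \<Rightarrow> nat list \<Rightarrow> bool" where
  "is_partition n \<mu> \<longleftrightarrow> sorted_wrt (\<ge>) \<mu> \<and> 0 \<notin> set \<mu> \<and> sum_list \<mu> = n"

text \<open>The parts of a partition are indexed from 1 in the definition of the Frobenius rank and
  from 0 in a list; the rank of the empty partition is 0.\<close>

definition rank :: "nat list \<Rightarrow> nat" where
  "rank \<mu> = Max (insert 0 {i. 1 \<le> i \<and> i \<le> length \<mu> \<and> i \<le> \<mu> ! (i - 1)})"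

definition zee :: "nat list \<Rightarrow> nat" where
  "zee \<nu> = (\<Prod>i\<in>set \<nu>. i ^ count_list \<nu> i * fact (count_list \<nu> i))"


section \<open>Irreducible characters of the symmetric group\<close>

text \<open>The symmetric group \<open>S\<^sub>n\<close> is realised as the permutations of \<open>{..<n}\<close>, and the group
  algebra over the rationals as the functions on permutations which vanish outside \<open>S\<^sub>n\<close>.
  As \<open>\<rat>\<close> is a splitting field for \<open>S\<^sub>n\<close>, the characters can be computed over \<open>\<rat>\<close>.\<close>

definition group_algebra :: "nat \<Rightarrow> ((nat \<Rightarrow> nat) \<Rightarrow> rat) set" where
  "group_algebra n = {x. \<forall>\<sigma>. \<not> \<sigma> permutes {..<n} \<longrightarrow> x \<sigma> = 0}"

definition ga_mult ::
  "nat \<Rightarrow> ((nat \<Rightarrow> nat) \<Rightarrow> rat) \<Rightarrow> ((nat \<Rightarrow> nat) \<Rightarrow> rat) \<Rightarrow> (nat \<Rightarrow> nat) \<Rightarrow> rat" where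
  "ga_mult n x y = (\<lambda>\<sigma>. \<Sum>\<pi> | \<pi> permutes {..<n}. x \<pi> * y (inv \<pi> \<circ> \<sigma>))"

definition ga_elem :: "(nat \<Rightarrow> nat) \<Rightarrow> (nat \<Rightarrow> nat) \<Rightarrow> rat" where
  "ga_elem \<pi> = (\<lambda>\<sigma>. if \<sigma> = \<pi> then 1 else 0)"

text \<open>The cell (row, column) occupied by the number \<open>m < sum_list \<mu>\<close> in the Young tableau of
  shape \<open>\<mu>\<close> that is filled with \<open>0, 1, 2, \<dots>\<close> row by row.\<close>

fun cell :: "nat list \<Rightarrow> nat \<Rightarrow> nat \<times> nat" where
  "cell [] m = (0, m)"
| "cell (a # \<mu>) m = (if m < a then (0, m) else map_prod Suc id (cell \<mu> (m - a)))"

definition row_group :: "nat list \<Rightarrow> (nat \<Rightarrow> nat) set" where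
  "row_group \<mu> = {\<sigma>. \<sigma> permutes {..<sum_list \<mu>} \<and>
     (\<forall>m<sum_list \<mu>. fst (cell \<mu> (\<sigma> m)) = fst (cell \<mu> m))}"

definition col_group :: "nat list \<Rightarrow> (nat \<Rightarrow> nat) set" where
  "col_group \<mu> = {\<sigma>. \<sigma> permutes {..<sum_list \<mu>} \<and>
     (\<forall>m<sum_list \<mu>. snd (cell \<mu> (\<sigma> m)) = snd (cell \<mu> m))}"

definition young_symmetrizer :: "nat list \<Rightarrow> (nat \<Rightarrow> nat) \<Rightarrow> rat" where
  "young_symmetrizer \<mu> = ga_mult (sum_list \<mu>)
     (\<Sum>p\<in>row_group \<mu>. ga_elem p)
     (\<Sum>q\<in>col_group \<mu>. qscale (of_int (sign q)) (ga_elem q))"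

text \<open>The irreducible module indexed by \<open>\<mu>\<close> (Specht module) is the left ideal generated by the
  Young symmetrizer. In this labelling \<open>(n)\<close> gives the trivial and \<open>(1, \<dots>, 1)\<close> the sign
  representation.\<close>

definition specht_module :: "nat list \<Rightarrow> ((nat \<Rightarrow> nat) \<Rightarrow> rat) set" where
  "specht_module \<mu> =
     (\<lambda>x. ga_mult (sum_list \<mu>) x (young_symmetrizer \<mu>)) ` group_algebra (sum_list \<mu>)"

definition specht_character :: "nat list \<Rightarrow> (nat \<Rightarrow> nat) \<Rightarrow> rat" where
  "specht_character \<mu> \<sigma> = trace_on (specht_module \<mu>) (ga_mult (sum_list \<mu>) (ga_elem \<sigma>))"

text \<open>Fixed points count as cycles of length 1: \<open>orbit \<sigma> m\<close> always contains \<open>m\<close> here.\<close>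

definition cycle_type :: "nat \<Rightarrow> (nat \<Rightarrow> nat) \<Rightarrow> nat multiset" where
  "cycle_type n \<sigma> = image_mset card (mset_set (orbit \<sigma> ` {..<n}))"

text \<open>\<open>\<chi>\<^sup>\<mu>(\<nu>)\<close>; since characters are class functions, the choice of \<open>\<sigma>\<close> is immaterial.\<close>

definition chi :: "nat list \<Rightarrow> nat list \<Rightarrow> rat" where
  "chi \<mu> \<nu> = specht_character \<mu>
     (SOME \<sigma>. \<sigma> permutes {..<sum_list \<mu>} \<and> cycle_type (sum_list \<mu>) \<sigma> = mset \<nu>)"


section \<open>Symmetric functions\<close>

text \<open>Formal power series over \<open>\<rat>\<close> in the variables \<open>x\<^sub>0, x\<^sub>1, x\<^sub>2, \<dots>\<close>, given by their
  coefficients; a monomial is represented by its finitely supported exponent vector.\<close>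

type_synonym mseries = "(nat \<Rightarrow>\<^sub>0 nat) \<Rightarrow> rat"

definition mseries_one :: mseries where
  "mseries_one = (\<lambda>m. if m = 0 then 1 else 0)"

text \<open>Cauchy product; the sum is finite since every monomial has finitely many divisors.\<close>

definition mseries_mult :: "mseries \<Rightarrow> mseries \<Rightarrow> mseries" where
  "mseries_mult f g = (\<lambda>m. \<Sum>(a, b) | a + b = m. f a * g b)"

text \<open>\<open>p\<^sub>i = \<Sum>\<^sub>j x\<^sub>j\<^sup>i\<close> for \<open>i \<ge> 1\<close>\<close>

definition power_sum :: "nat \<Rightarrow> mseries" where
  "power_sum i = (\<lambda>m. if \<exists>j. m = Poly_Mapping.single j i then 1 else 0)"

definition power_sum_part :: "nat list \<Rightarrow> mseries" where
  "power_sum_part \<nu> = foldr (\<lambda>i. mseries_mult (power_sum i)) \<nu> mseries_one"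

definition bottom_schur :: "nat list \<Rightarrow> mseries" where
  "bottom_schur \<mu> =
     (\<Sum>\<nu> | is_partition (sum_list \<mu>) \<nu> \<and> length \<nu> = rank \<mu>.
        qscale (chi \<mu> \<nu> / of_nat (zee \<nu>)) (power_sum_part \<nu>))"

end

theory Submission
  imports Defs
begin

text \<open>Up to a nonzero scalar, the irreducible character \<open>\<chi>\<^sup>\<mu>\<close> is the class sum of the Young symmetrizer:
  this is the trace of an idempotent. The class sum is triangular for the dominance order with respect
  to the permutation characters, and class sums of different shapes are orthogonal. The Jacobi-Trudi
  sum \<open>\<Sum>\<pi>. sgn \<pi> h\<^bsub>\<mu> - id + \<pi>\<^esub>\<close> is triangular in the same way, by cancellation of everything except horizontal
  strips, so the two are proportional. On permutations with \<open>k = rank \<mu>\<close> cycles, only the terms with the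
  maximal number of factors \<open>h\<^sub>0\<close> contribute, and they form a determinant \<open>det (f\<^bsub>a\<^sub>i + c\<^sub>j\<^esub>)\<close> of size \<open>k\<close>, where
  \<open>f\<^sub>m\<close> is a multiple of \<open>p\<^sub>m\<close>, \<open>a\<^sub>i = \<mu>\<^sub>i - i\<close>, and \<open>c\<close> is strictly increasing; if \<open>\<mu>\<close> has exactly \<open>k\<close> parts, then
  \<open>c\<^sub>j = j\<close>. A Pieri-type identity moves boxes from \<open>c\<close> to \<open>a\<close> and so expresses each determinant by
  those with \<open>c\<^sub>j = j\<close>; these are independent because their diagonal term has the smallest sum of squared
  indices.\<close>

section \<open>Words and their fixed points\<close>

text \<open>Characters are given here as traces on left ideals of the rational group algebra, so the
  determinant formula has to be derived from Young symmetrizers. Semisimplicity is replaced by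
  positivity: the coefficient of \<open>star n x\<close> times \<open>x\<close> at \<open>id\<close>
  is a sum of rational squares, and this definiteness supplies the nonvanishing statements about
  symmetrizers. Class functions are compared only up to nonzero scalars, which change neither spans
  nor independence, so no dimension or Kostka number is ever computed. The factors h are represented
  by their characters \<open>fixw\<close>. Pairing with these detects class functions
  (\<open>fixw_complete\<close>), and it vanishes outside the dominance order for two different
  reasons: a column transposition kills words with a repeated letter in a column, and in the
  Jacobi-Trudi sum everything that does not come from a semistandard filling cancels. Determinants
  are kept as formal sums over multisets of indices; power sums are substituted only at the end, by
  a linear map that rescales independent series.\<close>

abbreviation Sym :: "nat \<Rightarrow> (nat \<Rightarrow> nat) set" where
  "Sym n \<equiv> {\<sigma>. \<sigma> permutes {..<n}}"

definition part :: "nat list \<Rightarrow> nat \<Rightarrow> nat" where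
  "part \<mu> i = (if i < length \<mu> then \<mu> ! i else 0)"

abbreviation ipart :: "nat list \<Rightarrow> nat \<Rightarrow> int" where
  "ipart \<mu> \<equiv> \<lambda>i. int (part \<mu> i)"

text \<open>Words of length \<open>n\<close> are extended by \<open>0\<close>, so that permutations act on them by composition. The
  content is integer valued since negative entries occur in the Jacobi-Trudi sum; there are no words
  with such a content.\<close>

definition words :: "nat \<Rightarrow> (nat \<Rightarrow> int) \<Rightarrow> (nat \<Rightarrow> nat) set" where
  "words n \<beta> = {u. (\<forall>m\<ge>n. u m = 0) \<and> (\<forall>i. int (card {m. m < n \<and> u m = i}) = \<beta> i)}"

text \<open>The permutation character on words of content \<beta>, that is, the class function
  attached to the product of the complete symmetric functions h with indices
  \<open>\<beta> i\<close>.\<close>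

definition fixw :: "nat \<Rightarrow> (nat \<Rightarrow> int) \<Rightarrow> (nat \<Rightarrow> nat) \<Rightarrow> rat" where
  "fixw n \<beta> \<sigma> = of_nat (card {u \<in> words n \<beta>. u \<circ> \<sigma> = u})"

abbreviation fix_pairing :: "nat \<Rightarrow> ((nat \<Rightarrow> nat) \<Rightarrow> rat) \<Rightarrow> (nat \<Rightarrow> int) \<Rightarrow> rat" where
  "fix_pairing n F \<beta> \<equiv> \<Sum>\<sigma>\<in>Sym n. F \<sigma> * fixw n \<beta> \<sigma>"

lemma finite_Sym [simp]: "finite (Sym n)"
  by (simp add: finite_permutations)

lemma Sym_comp: "g \<in> Sym n \<Longrightarrow> h \<in> Sym n \<Longrightarrow> g \<circ> h \<in> Sym n"
  by (simp add: permutes_compose)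

lemma Sym_inv: "g \<in> Sym n \<Longrightarrow> inv g \<in> Sym n"
  by (simp add: permutes_inv)

lemma Sym_id: "id \<in> Sym n"
  by simp

lemma Sym_inv_comp [simp]: "g \<in> Sym n \<Longrightarrow> inv g \<circ> g = id" "g \<in> Sym n \<Longrightarrow> g \<circ> inv g = id"
  by (simp_all add: permutes_inv_o)

lemma Sym_cancel:
  assumes "g \<in> Sym n"
  shows "g \<circ> (inv g \<circ> h) = h" "inv g \<circ> (g \<circ> h) = h" "(u \<circ> g) \<circ> inv g = u" "(u \<circ> inv g) \<circ> g = u"
  using assms by (auto simp: fun_eq_iff permutes_inverses)

lemma Sym_inv_inv: "g \<in> Sym n \<Longrightarrow> inv (inv g) = g"
  by (simp add: permutes_inv_inv)

lemma Sym_inv_of_comp: "g \<in> Sym n \<Longrightarrow> h \<in> Sym n \<Longrightarrow> inv (g \<circ> h) = inv h \<circ> inv g"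
  by (simp add: o_inv_distrib permutes_bij)

lemma Sym_comp_iff: "g \<in> Sym n \<Longrightarrow> g \<circ> h \<in> Sym n \<longleftrightarrow> h \<in> Sym n"
  by (metis Sym_cancel(2) Sym_comp Sym_inv)

lemma Sym_comp_iff2: "g \<in> Sym n \<Longrightarrow> h \<circ> g \<in> Sym n \<longleftrightarrow> h \<in> Sym n"
  by (metis Sym_cancel(3) Sym_comp Sym_inv)

lemma Sym_less: "g \<in> Sym n \<Longrightarrow> g m < n \<longleftrightarrow> m < n"
  using permutes_in_image[of g "{..<n}" m] by simp

lemma Sym_ge: "g \<in> Sym n \<Longrightarrow> n \<le> m \<Longrightarrow> g m = m"
  using permutes_not_in[of g "{..<n}" m] by simp

lemma sum_Sym_left: "g \<in> Sym n \<Longrightarrow> (\<Sum>h\<in>Sym n. f (g \<circ> h)) = (\<Sum>h\<in>Sym n. f h)"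
  using setum_permutations_compose_left[of g "{..<n}" f] by simp

lemma sum_Sym_right: "g \<in> Sym n \<Longrightarrow> (\<Sum>h\<in>Sym n. f (h \<circ> g)) = (\<Sum>h\<in>Sym n. f h)"
  using sum_permutations_compose_right[of g "{..<n}" f] by simp

lemma sum_Sym_inv: "(\<Sum>h\<in>Sym n. f (inv h)) = (\<Sum>h\<in>Sym n. f h)"
  using sum_permutations_inverse[of f "{..<n}"] by simp

lemma sum_Sym_conj: "g \<in> Sym n \<Longrightarrow> (\<Sum>h\<in>Sym n. f (g \<circ> h \<circ> inv g)) = (\<Sum>h\<in>Sym n. f h)"
  using sum_Sym_left[of g n "\<lambda>x. f (x \<circ> inv g)"] sum_Sym_right[OF Sym_inv, of g n f] by simp

lemma card_fiber_comp:
  assumes "g \<in> Sym n"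
  shows "card {m. m < n \<and> u (g m) = i} = card {m. m < n \<and> u m = i}"
proof -
  have "bij_betw g {m. m < n \<and> u (g m) = i} {m. m < n \<and> u m = i}"
  proof (rule bij_betw_byWitness[where f' = "inv g"])
    have i: "g (inv g m) = m" "inv g (g m) = m" for m
      using assms by (simp_all add: permutes_inverses)
    then show "\<forall>a\<in>{m. m < n \<and> u (g m) = i}. inv g (g a) = a"
      "\<forall>a'\<in>{m. m < n \<and> u m = i}. g (inv g a') = a'" by simp_all
    show "g ` {m. m < n \<and> u (g m) = i} \<subseteq> {m. m < n \<and> u m = i}"
      using Sym_less[OF assms] by auto
    show "inv g ` {m. m < n \<and> u m = i} \<subseteq> {m. m < n \<and> u (g m) = i}"
      using Sym_less[OF Sym_inv[OF assms]] i by auto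
  qed
  then show ?thesis by (rule bij_betw_same_card)
qed

lemma words_comp: "u \<in> words n \<beta> \<Longrightarrow> g \<in> Sym n \<Longrightarrow> u \<circ> g \<in> words n \<beta>"
  unfolding words_def using card_fiber_comp[of g n u] by (auto simp: Sym_ge)

text \<open>The letters have arbitrary type because words whose letters are pairs are treated later
  in the same way.\<close>

lemma fibers_eq_imp_comp:
  assumes "\<And>i. card {m. m < n \<and> u m = i} = card {m. m < n \<and> v m = i}"
    and "\<And>m. n \<le> m \<Longrightarrow> u m = v m"
  shows "\<exists>g\<in>Sym n. v = u \<circ> g"
proof -
  have "image_mset v (mset_set {..<n}) = image_mset u (mset_set {..<n})"
  proof (rule multiset_eqI)
    fix i
    have "{m \<in> {..<n}. f m = i} = {m. m < n \<and> f m = i}" for f :: "nat \<Rightarrow> 'a" by auto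
    then show "count (image_mset v (mset_set {..<n})) i = count (image_mset u (mset_set {..<n})) i"
      using assms(1)[of i] by (simp add: count_image_mset_eq_card_vimage)
  qed
  then obtain p where p: "p permutes {..<n}" "\<forall>x\<in>{..<n}. v x = u (p x)"
    by (rule image_mset_eq_implies_permutes[rotated]) auto
  have "v x = u (p x)" for x
  proof (cases "x < n")
    case False
    then show ?thesis using assms(2)[of x] Sym_ge[of p n x] p by simp
  qed (use p in auto)
  then show ?thesis using p(1) by (intro bexI[of _ p]) auto
qed

lemma words_orbit:
  assumes "u \<in> words n \<beta>"
  shows "words n \<beta> = (\<lambda>g. u \<circ> g) ` Sym n"
proof (intro equalityI subsetI)
  fix v assume v: "v \<in> words n \<beta>"
  have "card {m. m < n \<and> u m = i} = card {m. m < n \<and> v m = i}" for i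
  proof -
    have "int (card {m. m < n \<and> u m = i}) = \<beta> i" "int (card {m. m < n \<and> v m = i}) = \<beta> i"
      using assms v by (simp_all add: words_def)
    then show ?thesis by linarith
  qed
  moreover have "u m = v m" if "n \<le> m" for m using assms v that by (simp add: words_def)
  ultimately show "v \<in> (\<lambda>g. u \<circ> g) ` Sym n" using fibers_eq_imp_comp[of n u v] by auto
qed (use words_comp[OF assms] in auto)

lemma finite_words [simp]: "finite (words n \<beta>)"
proof (cases "words n \<beta> = {}")
  case False
  then obtain u where "u \<in> words n \<beta>" by auto
  then have "words n \<beta> = (\<lambda>g. u \<circ> g) ` Sym n" by (rule words_orbit)
  then show ?thesis by (metis finite_Sym finite_imageI)
qed simp

lemma fixw_nonneg: "0 \<le> fixw n \<beta> \<sigma>"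
  by (simp add: fixw_def)

lemma comp_Sym_eq_iff:
  assumes "h \<in> Sym n"
  shows "u \<circ> h = v \<longleftrightarrow> u = v \<circ> inv h"
  by (auto simp: Sym_cancel(3,4)[OF assms])

lemma fixw_conj:
  assumes "h \<in> Sym n"
  shows "fixw n \<beta> (h \<circ> \<sigma> \<circ> inv h) = fixw n \<beta> \<sigma>"
proof -
  have i: "inv h \<in> Sym n" using Sym_inv[OF assms] .
  have "bij_betw (\<lambda>u. u \<circ> h) {u \<in> words n \<beta>. u \<circ> (h \<circ> \<sigma> \<circ> inv h) = u} {u \<in> words n \<beta>. u \<circ> \<sigma> = u}"
  proof (rule bij_betw_byWitness[where f' = "\<lambda>u. u \<circ> inv h"])
    show "(\<lambda>u. u \<circ> h) ` {u \<in> words n \<beta>. u \<circ> (h \<circ> \<sigma> \<circ> inv h) = u} \<subseteq> {u \<in> words n \<beta>. u \<circ> \<sigma> = u}"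
    proof (clarify, intro conjI)
      fix u assume u: "u \<in> words n \<beta>" "u \<circ> (h \<circ> \<sigma> \<circ> inv h) = u"
      show "u \<circ> h \<in> words n \<beta>" using words_comp[OF u(1) assms] .
      have "u \<circ> h \<circ> \<sigma> = (u \<circ> (h \<circ> \<sigma> \<circ> inv h)) \<circ> h"
        using Sym_cancel(4)[OF assms, of "u \<circ> h \<circ> \<sigma>"] by (simp add: o_assoc)
      then show "u \<circ> h \<circ> \<sigma> = u \<circ> h" by (simp only: u(2))
    qed
    show "(\<lambda>u. u \<circ> inv h) ` {u \<in> words n \<beta>. u \<circ> \<sigma> = u} \<subseteq> {u \<in> words n \<beta>. u \<circ> (h \<circ> \<sigma> \<circ> inv h) = u}"
    proof (clarify, intro conjI)
      fix u assume u: "u \<in> words n \<beta>" "u \<circ> \<sigma> = u"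
      show "u \<circ> inv h \<in> words n \<beta>" using words_comp[OF u(1) i] .
      have "u \<circ> inv h \<circ> (h \<circ> \<sigma> \<circ> inv h) = (u \<circ> inv h \<circ> h) \<circ> \<sigma> \<circ> inv h" by (simp add: o_assoc)
      also have "\<dots> = u \<circ> \<sigma> \<circ> inv h" by (simp only: Sym_cancel(4)[OF assms])
      finally show "u \<circ> inv h \<circ> (h \<circ> \<sigma> \<circ> inv h) = u \<circ> inv h" by (simp only: u(2))
    qed
  qed (use Sym_cancel[OF assms] in auto)
  then show ?thesis unfolding fixw_def by (simp add: bij_betw_same_card)
qed

lemma fixw_inv:
  assumes "\<sigma> \<in> Sym n"
  shows "fixw n \<beta> (inv \<sigma>) = fixw n \<beta> \<sigma>"
proof -
  have "u \<circ> inv \<sigma> = u \<longleftrightarrow> u \<circ> \<sigma> = u" for u :: "nat \<Rightarrow> nat"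
    using comp_Sym_eq_iff[OF assms, of u u] by metis
  then show ?thesis by (simp add: fixw_def)
qed

text \<open>Burnside counting for a single orbit: for \<open>v = v0 \<circ> g\<close> the fixing
  condition on \<sigma> reads \<open>v0 \<circ> (g \<circ> \<sigma>) = v\<close>, and after
  reindexing by g each \<sigma> is counted for exactly one v, namely
  \<open>v0 \<circ> \<sigma>\<close>.\<close>

lemma sum_fixed_points_orbit:
  fixes v0 :: "nat \<Rightarrow> 'c"
  shows "(\<Sum>\<sigma>\<in>Sym n. card {v \<in> (\<lambda>g. v0 \<circ> g) ` Sym n. v \<circ> \<sigma> = v}) = fact n"
proof -
  let ?O = "(\<lambda>g. v0 \<circ> g) ` Sym n"
  have fO: "finite ?O" by simp
  have "(\<Sum>\<sigma>\<in>Sym n. card {v \<in> ?O. v \<circ> \<sigma> = v}) = (\<Sum>\<sigma>\<in>Sym n. \<Sum>v\<in>?O. if v \<circ> \<sigma> = v then 1 else 0)"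
    using fO by (simp add: sum.If_cases Int_def)
  also have "\<dots> = (\<Sum>v\<in>?O. \<Sum>\<sigma>\<in>Sym n. if v \<circ> \<sigma> = v then 1 else 0)"
    by (rule sum.swap)
  also have "\<dots> = (\<Sum>v\<in>?O. \<Sum>\<sigma>\<in>Sym n. if v0 \<circ> \<sigma> = v then 1 else 0)"
  proof (rule sum.cong[OF refl])
    fix v assume "v \<in> ?O"
    then obtain g where g: "g \<in> Sym n" "v = v0 \<circ> g" by auto
    have "(\<Sum>\<sigma>\<in>Sym n. if v \<circ> \<sigma> = v then 1 else 0) = (\<Sum>\<sigma>\<in>Sym n. (\<lambda>h. if v0 \<circ> h = v then 1 else 0::nat) (g \<circ> \<sigma>))"
      by (simp add: g(2) o_assoc)
    also have "\<dots> = (\<Sum>\<sigma>\<in>Sym n. if v0 \<circ> \<sigma> = v then 1 else 0)"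
      by (rule sum_Sym_left[OF g(1)])
    finally show "(\<Sum>\<sigma>\<in>Sym n. if v \<circ> \<sigma> = v then 1 else 0) = (\<Sum>\<sigma>\<in>Sym n. if v0 \<circ> \<sigma> = v then 1 else (0::nat))" .
  qed
  also have "\<dots> = (\<Sum>\<sigma>\<in>Sym n. \<Sum>v\<in>?O. if v0 \<circ> \<sigma> = v then 1 else 0)"
    by (rule sum.swap)
  also have "\<dots> = (\<Sum>\<sigma>\<in>Sym n. 1)"
    using fO by (intro sum.cong refl) (simp add: sum.delta)
  also have "\<dots> = fact n"
    by (simp add: card_permutations[OF refl])
  finally show ?thesis .
qed

section \<open>Young tableaux and column-distinct words\<close>

lemma part_Nil [simp]: "part [] i = 0"
  by (simp add: part_def)

lemma part_Cons_0 [simp]: "part (a # \<mu>) 0 = a"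
  by (simp add: part_def)

lemma part_Cons_Suc [simp]: "part (a # \<mu>) (Suc i) = part \<mu> i"
  by (simp add: part_def)

lemma cell_bij: "bij_betw (cell \<mu>) {..<sum_list \<mu>} {(i, j). j < part \<mu> i}"
proof (induction \<mu>)
  case Nil
  then show ?case by (auto simp: bij_betw_def)
next
  case (Cons a \<mu>)
  have inj: "inj_on (cell \<mu>) {..<sum_list \<mu>}" and img: "cell \<mu> ` {..<sum_list \<mu>} = {(i, j). j < part \<mu> i}"
    using Cons by (auto simp: bij_betw_def)
  have 1: "inj_on (cell (a # \<mu>)) {..<sum_list (a # \<mu>)}"
  proof (rule inj_onI)
    fix x y assume xy: "x \<in> {..<sum_list (a # \<mu>)}" "y \<in> {..<sum_list (a # \<mu>)}"
      "cell (a # \<mu>) x = cell (a # \<mu>) y"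
    show "x = y"
    proof (cases "x < a \<or> y < a")
      case True
      then show ?thesis using xy(3) by (auto split: if_splits simp: map_prod_def split_beta)
    next
      case False
      then have "cell \<mu> (x - a) = cell \<mu> (y - a)"
        using xy(3) by (auto simp: map_prod_def split_beta prod_eq_iff)
      moreover have "x - a \<in> {..<sum_list \<mu>}" "y - a \<in> {..<sum_list \<mu>}" using xy False by auto
      ultimately have "x - a = y - a" using inj by (auto dest: inj_onD)
      then show ?thesis using False by arith
    qed
  qed
  have 2: "cell (a # \<mu>) ` {..<sum_list (a # \<mu>)} = {(i, j). j < part (a # \<mu>) i}"
  proof (intro equalityI subsetI)
    fix p assume "p \<in> cell (a # \<mu>) ` {..<sum_list (a # \<mu>)}"
    then obtain m where m: "m < a + sum_list \<mu>" "p = cell (a # \<mu>) m" by (auto simp del: cell.simps)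
    show "p \<in> {(i, j). j < part (a # \<mu>) i}"
    proof (cases "m < a")
      case False
      then have "m - a \<in> {..<sum_list \<mu>}" using m(1) by auto
      then have "cell \<mu> (m - a) \<in> cell \<mu> ` {..<sum_list \<mu>}" by (rule imageI)
      then have "cell \<mu> (m - a) \<in> {(i, j). j < part \<mu> i}" by (simp only: img)
      then obtain i j where "cell \<mu> (m - a) = (i, j)" "j < part \<mu> i" by blast
      then show ?thesis using False m by simp
    qed (use m in auto)
  next
    fix p assume "p \<in> {(i, j). j < part (a # \<mu>) i}"
    then obtain i j where p: "p = (i, j)" "j < part (a # \<mu>) i" by auto
    show "p \<in> cell (a # \<mu>) ` {..<sum_list (a # \<mu>)}"
    proof (cases i)
      case 0
      then have "p = cell (a # \<mu>) j" "j < sum_list (a # \<mu>)" using p by auto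
      then show ?thesis by blast
    next
      case (Suc i')
      then have "(i', j) \<in> cell \<mu> ` {..<sum_list \<mu>}" using p img by auto
      then obtain m where m: "m < sum_list \<mu>" "cell \<mu> m = (i', j)" by auto
      then have "p = cell (a # \<mu>) (a + m)" "a + m < sum_list (a # \<mu>)" using p Suc by auto
      then show ?thesis by blast
    qed
  qed
  show ?case unfolding bij_betw_def using 1 2 by blast
qed

lemma part_antimono:
  assumes "is_partition n \<mu>" "i \<le> j"
  shows "part \<mu> j \<le> part \<mu> i"
  using assms sorted_wrt_nth_less[of "(\<ge>)" \<mu> i j]
  by (cases "i = j") (auto simp: part_def is_partition_def)

lemma part_pos_iff:
  assumes "is_partition n \<mu>"
  shows "0 < part \<mu> i \<longleftrightarrow> i < length \<mu>"
  using assms by (auto simp: part_def is_partition_def) (metis gr0I nth_mem)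

lemma part_inject:
  assumes "is_partition n \<mu>" "is_partition n' \<nu>" "part \<mu> = part \<nu>"
  shows "\<mu> = \<nu>"
proof (rule nth_equalityI)
  have "i < length \<mu> \<longleftrightarrow> i < length \<nu>" for i
    using part_pos_iff[OF assms(1)] part_pos_iff[OF assms(2)] assms(3) by simp
  then show l: "length \<mu> = length \<nu>" by (metis linorder_neqE_nat less_irrefl)
  fix i assume "i < length \<mu>"
  then show "\<mu> ! i = \<nu> ! i" using fun_cong[OF assms(3), of i] l by (simp add: part_def)
qed

definition rowi :: "nat list \<Rightarrow> nat \<Rightarrow> nat" where "rowi \<mu> m = fst (cell \<mu> m)"
definition coli :: "nat list \<Rightarrow> nat \<Rightarrow> nat" where "coli \<mu> m = snd (cell \<mu> m)"

definition row_word :: "nat list \<Rightarrow> nat \<Rightarrow> nat" where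
  "row_word \<mu> m = (if m < sum_list \<mu> then rowi \<mu> m else 0)"

text \<open>The word is read as a filling of the diagram of \<mu>, with letter \<open>w m\<close> in
  the cell numbered \<open>m\<close>. Fillings that violate the condition are annihilated by the
  signed column sum.\<close>

definition column_distinct :: "nat list \<Rightarrow> (nat \<Rightarrow> nat) \<Rightarrow> bool" where
  "column_distinct \<mu> w \<longleftrightarrow>
     (\<forall>i<sum_list \<mu>. \<forall>j<sum_list \<mu>. i \<noteq> j \<longrightarrow> coli \<mu> i = coli \<mu> j \<longrightarrow> w i \<noteq> w j)"

definition dominated :: "(nat \<Rightarrow> int) \<Rightarrow> nat list \<Rightarrow> bool" where
  "dominated \<beta> \<mu> \<longleftrightarrow> (\<forall>t. (\<Sum>i<t. \<beta> i) \<le> (\<Sum>i<t. int (part \<mu> i)))"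

abbreviation dom_le :: "nat list \<Rightarrow> nat list \<Rightarrow> bool" where
  "dom_le \<nu> \<mu> \<equiv> dominated (ipart \<nu>) \<mu>"

lemma dom_le_antisym:
  assumes "is_partition n \<mu>" "is_partition n \<nu>" "dom_le \<mu> \<nu>" "dom_le \<nu> \<mu>"
  shows "\<mu> = \<nu>"
proof -
  have eq: "(\<Sum>i<t. int (part \<mu> i)) = (\<Sum>i<t. int (part \<nu> i))" for t
    using assms(3,4) unfolding dominated_def by (meson antisym)
  have "part \<mu> i = part \<nu> i" for i using eq[of i] eq[of "Suc i"] by simp
  then show ?thesis using part_inject[OF assms(1,2)] by auto
qed

lemma cell_less_part:
  "m < sum_list \<mu> \<Longrightarrow> coli \<mu> m < part \<mu> (rowi \<mu> m)"
  using cell_bij[of \<mu>] unfolding bij_betw_def rowi_def coli_def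
  by (metis (mono_tags, lifting) case_prod_beta imageI lessThan_iff mem_Collect_eq)

lemma cell_eqD:
  "\<lbrakk>m < sum_list \<mu>; m' < sum_list \<mu>; rowi \<mu> m = rowi \<mu> m'; coli \<mu> m = coli \<mu> m'\<rbrakk> \<Longrightarrow> m = m'"
  using cell_bij[of \<mu>] unfolding bij_betw_def rowi_def coli_def inj_on_def
  by (simp add: prod_eq_iff)

lemma cell_ex:
  assumes "j < part \<mu> i"
  shows "\<exists>m<sum_list \<mu>. rowi \<mu> m = i \<and> coli \<mu> m = j"
proof -
  have "(i, j) \<in> cell \<mu> ` {..<sum_list \<mu>}"
    using cell_bij[of \<mu>] assms by (simp add: bij_betw_def)
  then obtain m where "m < sum_list \<mu>" "cell \<mu> m = (i, j)" by auto
  then show ?thesis by (intro exI[of _ m]) (simp add: rowi_def coli_def)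
qed

lemma card_row:
  "card {m. m < sum_list \<mu> \<and> rowi \<mu> m = i} = part \<mu> i"
proof -
  have "bij_betw (coli \<mu>) {m. m < sum_list \<mu> \<and> rowi \<mu> m = i} {..<part \<mu> i}"
    unfolding bij_betw_def
  proof
    show "inj_on (coli \<mu>) {m. m < sum_list \<mu> \<and> rowi \<mu> m = i}"
      by (rule inj_onI) (auto intro: cell_eqD)
    show "coli \<mu> ` {m. m < sum_list \<mu> \<and> rowi \<mu> m = i} = {..<part \<mu> i}"
      using cell_less_part cell_ex[of _ \<mu> i] by (fastforce simp: image_iff)
  qed
  then show ?thesis by (simp add: bij_betw_same_card)
qed

lemma row_word_in_words:
  "row_word \<mu> \<in> words (sum_list \<mu>) (ipart \<mu>)"
proof -
  have "{m. m < sum_list \<mu> \<and> row_word \<mu> m = i} = {m. m < sum_list \<mu> \<and> rowi \<mu> m = i}" for i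
    by (auto simp: row_word_def)
  then show ?thesis using card_row[of \<mu>] by (simp add: words_def row_word_def)
qed

lemma sum_fibers_less:
  fixes n :: nat
  shows "(\<Sum>i<t. card {m. m < n \<and> w m = i}) = card {m. m < n \<and> w m < (t::nat)}"
proof -
  have "card {m. m < n \<and> w m < t} = card (\<Union>i<t. {m. m < n \<and> w m = i})"
    by (rule arg_cong[of _ _ card]) auto
  also have "\<dots> = (\<Sum>i<t. card {m. m < n \<and> w m = i})"
    by (rule card_UN_disjoint) auto
  finally show ?thesis by simp
qed

text \<open>Compare column by column: a column with distinct letters contains at most t letters
  below t, and at most as many as it has cells, while the first t rows meet it in exactly the
  smaller of these two numbers.\<close>

lemma column_distinct_dominated:
  assumes p: "is_partition n \<mu>" and w: "w \<in> words n \<beta>" and d: "column_distinct \<mu> w"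
  shows "dominated \<beta> \<mu>"
  unfolding dominated_def
proof
  fix t
  have n: "n = sum_list \<mu>" using p by (simp add: is_partition_def)
  define C where "C c = {m. m < n \<and> coli \<mu> m = c}" for c
  have fC: "finite (C c)" for c by (simp add: C_def)
  have split: "card {m. m < n \<and> P m} = (\<Sum>c\<in>coli \<mu> ` {..<n}. card {m \<in> C c. P m})" for P
  proof -
    have "card {m. m < n \<and> P m} = card (\<Union>c\<in>coli \<mu> ` {..<n}. {m \<in> C c. P m})"
      by (rule arg_cong[of _ _ card]) (auto simp: C_def)
    also have "\<dots> = (\<Sum>c\<in>coli \<mu> ` {..<n}. card {m \<in> C c. P m})"
      by (rule card_UN_disjoint) (auto simp: C_def)
    finally show ?thesis .
  qed
  have col: "card {m \<in> C c. w m < t} \<le> card {m \<in> C c. rowi \<mu> m < t}" for c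
  proof (cases "\<forall>m\<in>C c. rowi \<mu> m < t")
    case True
    then have "{m \<in> C c. rowi \<mu> m < t} = C c" by auto
    then show ?thesis using fC by (auto intro: card_mono)
  next
    case False
    then obtain m where m: "m \<in> C c" "t \<le> rowi \<mu> m" by auto
    have "{..<t} \<subseteq> rowi \<mu> ` {m \<in> C c. rowi \<mu> m < t}"
    proof
      fix i assume i: "i \<in> {..<t}"
      have "c < part \<mu> (rowi \<mu> m)" using m(1) cell_less_part[of m \<mu>] by (auto simp: C_def n)
      also have "\<dots> \<le> part \<mu> i" using i m(2) by (intro part_antimono[OF p]) auto
      finally obtain m' where "m' < n" "rowi \<mu> m' = i" "coli \<mu> m' = c" using cell_ex n by blast
      then show "i \<in> rowi \<mu> ` {m \<in> C c. rowi \<mu> m < t}" using i by (force simp: C_def)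
    qed
    then have "t \<le> card (rowi \<mu> ` {m \<in> C c. rowi \<mu> m < t})"
      using card_mono[of _ "{..<t}"] fC by fastforce
    also have "\<dots> \<le> card {m \<in> C c. rowi \<mu> m < t}" by (rule card_image_le) (simp add: fC)
    finally have *: "t \<le> card {m \<in> C c. rowi \<mu> m < t}" .
    have "inj_on w {m \<in> C c. w m < t}"
      using d unfolding column_distinct_def inj_on_def C_def n[symmetric] by blast
    then have "card {m \<in> C c. w m < t} \<le> card {..<t}"
      by (rule card_inj_on_le) auto
    then show ?thesis using * by simp
  qed
  have "(\<Sum>i<t. \<beta> i) = int (\<Sum>i<t. card {m. m < n \<and> w m = i})"
    using w by (simp add: words_def)
  also have "\<dots> = int (card {m. m < n \<and> w m < t})" by (simp add: sum_fibers_less)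
  also have "\<dots> \<le> int (card {m. m < n \<and> rowi \<mu> m < t})"
    unfolding split by (intro of_nat_mono sum_mono col)
  also have "\<dots> = int (\<Sum>i<t. part \<mu> i)"
    by (simp add: sum_fibers_less[symmetric] card_row[of \<mu>, folded n] del: of_nat_sum)
  finally show "(\<Sum>i<t. \<beta> i) \<le> (\<Sum>i<t. int (part \<mu> i))" by simp
qed

text \<open>A column-distinct word of content \<open>\<mu>\<close> has, for every \<open>i\<close>, its letters \<open>i\<close> in exactly the
  first \<open>\<mu>\<^sub>i\<close> columns, so each column is a rearrangement of \<open>0, 1, 2, \<dots>\<close>.\<close>

lemma column_distinct_superstandard:
  assumes p: "is_partition n \<mu>" and w: "w \<in> words n (ipart \<mu>)"
    and d: "column_distinct \<mu> w"
  shows "\<exists>q\<in>col_group \<mu>. w = row_word \<mu> \<circ> q"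
proof -
  have n: "n = sum_list \<mu>" using p by (simp add: is_partition_def)
  have cw: "card {m. m < n \<and> w m = i} = part \<mu> i" for i using w by (simp add: words_def)
  have inj: "inj_on (coli \<mu>) {m. m < n \<and> w m = i}" for i
    using d unfolding column_distinct_def inj_on_def n[symmetric] by blast
  have cols: "coli \<mu> ` {m. m < n \<and> w m = i} = {..<part \<mu> i}" for i
  proof (induction i rule: less_induct)
    case (less i)
    have "coli \<mu> ` {m. m < n \<and> w m = i} \<subseteq> {..<part \<mu> i}"
    proof (rule ccontr)
      assume "\<not> ?thesis"
      then obtain m0 where m0: "m0 < n" "w m0 = i" "part \<mu> i \<le> coli \<mu> m0" by force
      \<comment> \<open>R lists the rows that meet column c. By induction each of their indices
        already occurs as a letter in this column, so the letter i would be one more than the column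
        has cells.\<close>
      define c where "c = coli \<mu> m0"
      define R where "R = {i. c < part \<mu> i}"
      define C where "C = {m. m < n \<and> coli \<mu> m = c}"
      have Ri: "R \<subseteq> {..<i}"
      proof
        fix j assume j: "j \<in> R"
        show "j \<in> {..<i}"
        proof (rule ccontr)
          assume "j \<notin> {..<i}"
          then have "part \<mu> j \<le> part \<mu> i" by (intro part_antimono[OF p]) auto
          then show False using j m0 by (simp add: R_def c_def)
        qed
      qed
      then have fR: "finite R" by (rule finite_subset) simp
      have "R \<subseteq> w ` C"
      proof
        fix j assume j: "j \<in> R"
        then have "c \<in> coli \<mu> ` {m. m < n \<and> w m = j}" using less[of j] Ri by (auto simp: R_def)
        then show "j \<in> w ` C" by (force simp: C_def)
      qed
      moreover have "i \<in> w ` C" using m0 by (auto simp: C_def c_def)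
      ultimately have "card (insert i R) \<le> card (w ` C)"
        by (intro card_mono) (auto simp: C_def)
      also have "\<dots> \<le> card C" by (rule card_image_le) (simp add: C_def)
      also have "\<dots> = card (rowi \<mu> ` C)"
        by (rule card_image[symmetric], rule inj_onI) (auto simp: C_def n intro: cell_eqD)
      also have "\<dots> \<le> card R"
        by (rule card_mono[OF fR]) (auto simp: C_def R_def n cell_less_part)
      finally show False using Ri fR by (auto simp: card_insert_if split: if_splits)
    qed
    then show ?case
      by (rule card_subset_eq[OF finite_lessThan]) (simp add: card_image[OF inj] cw)
  qed
  have "\<exists>m'. m' < n \<and> rowi \<mu> m' = w m \<and> coli \<mu> m' = coli \<mu> m" if "m < n" for m
  proof -
    have "coli \<mu> m < part \<mu> (w m)" using cols[of "w m"] that by auto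
    then show ?thesis using cell_ex n by blast
  qed
  then obtain f where f: "\<And>m. m < n \<Longrightarrow> f m < n \<and> rowi \<mu> (f m) = w m \<and> coli \<mu> (f m) = coli \<mu> m"
    by metis
  \<comment> \<open>\<open>q\<close> moves each cell within its column to the row named by its
    letter, and is the identity outside the diagram.\<close>
  define q where "q m = (if m < n then f m else m)" for m
  have "q permutes {..<n}"
  proof (rule inj_imp_permutes)
    show "inj_on q {..<n}"
    proof (rule inj_onI)
      fix x y assume xy: "x \<in> {..<n}" "y \<in> {..<n}" "q x = q y"
      then have "w x = w y" "coli \<mu> x = coli \<mu> y" using f[of x] f[of y] by (auto simp: q_def)
      then show "x = y" using xy d by (auto simp: column_distinct_def n)
    qed
  qed (use f in \<open>auto simp: q_def\<close>)
  then have "q \<in> col_group \<mu>" using f by (auto simp: col_group_def n[symmetric] q_def coli_def)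
  moreover have "w = row_word \<mu> \<circ> q"
  proof
    fix m
    show "w m = (row_word \<mu> \<circ> q) m"
      using f[of m] w by (cases "m < n") (auto simp: row_word_def q_def n[symmetric] words_def)
  qed
  ultimately show ?thesis by blast
qed

lemma not_column_distinct:
  assumes "\<not> column_distinct \<mu> w"
  shows "\<exists>s\<in>col_group \<mu>. sign s = -1 \<and> w \<circ> s = w \<and> s \<circ> s = id"
proof -
  obtain i j where ij: "i < sum_list \<mu>" "j < sum_list \<mu>" "i \<noteq> j" "coli \<mu> i = coli \<mu> j" "w i = w j"
    using assms by (auto simp: column_distinct_def)
  have "transpose i j \<in> col_group \<mu>"
    using ij by (auto simp: col_group_def permutes_swap_id transpose_def coli_def)
  moreover have "w \<circ> transpose i j = w" using ij by (auto simp: fun_eq_iff transpose_def)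
  ultimately show ?thesis using ij by (intro bexI[of _ "transpose i j"]) (auto simp: sign_swap_id)
qed

lemma row_group_eq: "row_group \<mu> = {\<sigma> \<in> Sym (sum_list \<mu>). row_word \<mu> \<circ> \<sigma> = row_word \<mu>}"
proof -
  have "(\<forall>m<sum_list \<mu>. fst (cell \<mu> (\<sigma> m)) = fst (cell \<mu> m)) \<longleftrightarrow> row_word \<mu> \<circ> \<sigma> = row_word \<mu>"
    if "\<sigma> \<in> Sym (sum_list \<mu>)" for \<sigma>
    using Sym_less[OF that] by (auto simp: fun_eq_iff row_word_def rowi_def)
  then show ?thesis by (auto simp: row_group_def)
qed

lemma row_group_Int_col_group: "row_group \<mu> \<inter> col_group \<mu> = {id}"
proof -
  have "p = id" if "p \<in> row_group \<mu>" "p \<in> col_group \<mu>" for p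
  proof
    fix m
    have "p \<in> Sym (sum_list \<mu>)" using that by (simp add: row_group_def)
    then show "p m = id m"
      using that Sym_less[of p "sum_list \<mu>" m] Sym_ge[of p "sum_list \<mu>" m]
      by (cases "m < sum_list \<mu>")
         (auto simp: row_group_def col_group_def rowi_def coli_def intro: cell_eqD)
  qed
  then show ?thesis by (auto simp: row_group_def col_group_def)
qed

section \<open>The group algebra\<close>

lemma sum_fun_apply: "(\<Sum>a\<in>A. f a) x = (\<Sum>a\<in>A. f a x)"
  by (induction A rule: infinite_finite_induct) auto

lemma qscale_apply: "qscale c x \<sigma> = c * x \<sigma>"
  by (simp add: qscale_def)

lemma ga_mult_assoc: "ga_mult n (ga_mult n x y) z = ga_mult n x (ga_mult n y z)"
proof
  fix \<sigma>
  have "ga_mult n (ga_mult n x y) z \<sigma> =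
    (\<Sum>\<pi>\<in>Sym n. \<Sum>\<rho>\<in>Sym n. x \<rho> * (y (inv \<rho> \<circ> \<pi>) * z (inv \<pi> \<circ> \<sigma>)))"
    by (simp add: ga_mult_def sum_distrib_right mult.assoc)
  also have "\<dots> = (\<Sum>\<rho>\<in>Sym n. \<Sum>\<pi>\<in>Sym n. x \<rho> * (y (inv \<rho> \<circ> \<pi>) * z (inv \<pi> \<circ> \<sigma>)))"
    by (rule sum.swap)
  also have "\<dots> = (\<Sum>\<rho>\<in>Sym n. \<Sum>\<tau>\<in>Sym n. x \<rho> * (y \<tau> * z (inv \<tau> \<circ> (inv \<rho> \<circ> \<sigma>))))"
  proof (rule sum.cong[OF refl])
    fix \<rho> assume r: "\<rho> \<in> Sym n"
    have "(\<Sum>\<pi>\<in>Sym n. x \<rho> * (y (inv \<rho> \<circ> \<pi>) * z (inv \<pi> \<circ> \<sigma>))) =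
      (\<Sum>\<tau>\<in>Sym n. x \<rho> * (y (inv \<rho> \<circ> (\<rho> \<circ> \<tau>)) * z (inv (\<rho> \<circ> \<tau>) \<circ> \<sigma>)))"
      by (rule sum_Sym_left[OF r, symmetric])
    also have "\<dots> = (\<Sum>\<tau>\<in>Sym n. x \<rho> * (y \<tau> * z (inv \<tau> \<circ> (inv \<rho> \<circ> \<sigma>))))"
      by (intro sum.cong refl) (simp add: Sym_cancel(2)[OF r] Sym_inv_of_comp[OF r] comp_assoc del: mem_Collect_eq)
    finally show "(\<Sum>\<pi>\<in>Sym n. x \<rho> * (y (inv \<rho> \<circ> \<pi>) * z (inv \<pi> \<circ> \<sigma>))) =
      (\<Sum>\<tau>\<in>Sym n. x \<rho> * (y \<tau> * z (inv \<tau> \<circ> (inv \<rho> \<circ> \<sigma>))))" .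
  qed
  also have "\<dots> = ga_mult n x (ga_mult n y z) \<sigma>"
    by (simp add: ga_mult_def sum_distrib_left)
  finally show "ga_mult n (ga_mult n x y) z \<sigma> = ga_mult n x (ga_mult n y z) \<sigma>" .
qed

lemma ga_mult_qscale_left [simp]: "ga_mult n (qscale c x) y = qscale c (ga_mult n x y)"
  by (simp add: ga_mult_def qscale_def sum_distrib_left mult.assoc)

lemma ga_mult_qscale_right [simp]: "ga_mult n x (qscale c y) = qscale c (ga_mult n x y)"
  by (simp add: ga_mult_def qscale_def sum_distrib_left algebra_simps)

lemma ga_mult_add_left: "ga_mult n (x + x') y = ga_mult n x y + ga_mult n x' y"
  by (simp add: ga_mult_def fun_eq_iff sum.distrib algebra_simps)

lemma ga_mult_add_right: "ga_mult n x (y + y') = ga_mult n x y + ga_mult n x y'"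
  by (simp add: ga_mult_def fun_eq_iff sum.distrib algebra_simps)

lemma ga_mult_zero [simp]: "ga_mult n 0 y = 0" "ga_mult n x 0 = 0"
  by (simp_all add: ga_mult_def fun_eq_iff)

lemma ga_mult_sum_right: "ga_mult n x (\<Sum>i\<in>I. f i) = (\<Sum>i\<in>I. ga_mult n x (f i))"
  by (induction I rule: infinite_finite_induct) (simp_all only: sum.infinite sum.empty sum.insert ga_mult_zero not_False_eq_True ga_mult_add_right)

lemma group_algebraI: "(\<And>\<sigma>. \<sigma> \<notin> Sym n \<Longrightarrow> x \<sigma> = 0) \<Longrightarrow> x \<in> group_algebra n"
  by (simp add: group_algebra_def)

lemma group_algebraD: "x \<in> group_algebra n \<Longrightarrow> \<sigma> \<notin> Sym n \<Longrightarrow> x \<sigma> = 0"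
  by (simp add: group_algebra_def)

lemma group_algebra_eqI:
  "x \<in> group_algebra n \<Longrightarrow> y \<in> group_algebra n \<Longrightarrow> (\<And>\<sigma>. \<sigma> \<in> Sym n \<Longrightarrow> x \<sigma> = y \<sigma>) \<Longrightarrow> x = y"
  by (auto simp: group_algebra_def fun_eq_iff) metis

lemma ga_mult_in [intro]: "y \<in> group_algebra n \<Longrightarrow> ga_mult n x y \<in> group_algebra n"
proof (rule group_algebraI)
  fix \<sigma> assume y: "y \<in> group_algebra n" and s: "\<sigma> \<notin> Sym n"
  have "y (inv \<pi> \<circ> \<sigma>) = 0" if "\<pi> \<in> Sym n" for \<pi>
    using group_algebraD[OF y] Sym_comp_iff[OF Sym_inv[OF that]] s by blast
  then show "ga_mult n x y \<sigma> = 0" by (simp add: ga_mult_def)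
qed

lemma qscale_in [intro]: "x \<in> group_algebra n \<Longrightarrow> qscale c x \<in> group_algebra n"
  by (simp add: group_algebra_def qscale_def)

lemma ga_elem_in [intro]: "g \<in> Sym n \<Longrightarrow> ga_elem g \<in> group_algebra n"
  by (auto simp: group_algebra_def ga_elem_def)

lemma ga_mult_elem_left: "g \<in> Sym n \<Longrightarrow> ga_mult n (ga_elem g) x \<sigma> = x (inv g \<circ> \<sigma>)"
  by (simp add: ga_mult_def ga_elem_def if_distrib[of "\<lambda>c. c * _"] sum.delta cong: if_cong)

lemma ga_mult_elem_right:
  assumes g: "g \<in> Sym n" and x: "x \<in> group_algebra n"
  shows "ga_mult n x (ga_elem g) \<sigma> = x (\<sigma> \<circ> inv g)"
proof (cases "\<sigma> \<in> Sym n")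
  case True
  have "inv \<pi> \<circ> \<sigma> = g \<longleftrightarrow> \<pi> = \<sigma> \<circ> inv g" if "\<pi> \<in> Sym n" for \<pi>
    using Sym_cancel(1)[OF that, of \<sigma>] Sym_cancel(2)[OF that] Sym_cancel(3,4)[OF g] by metis
  then have "ga_mult n x (ga_elem g) \<sigma> = (\<Sum>\<pi>\<in>Sym n. if \<pi> = \<sigma> \<circ> inv g then x \<pi> else 0)"
    unfolding ga_mult_def ga_elem_def by (intro sum.cong) auto
  also have "\<dots> = x (\<sigma> \<circ> inv g)"
    using Sym_comp[OF True Sym_inv[OF g]] by (subst sum.delta) auto
  finally show ?thesis .
next
  case False
  then have "\<sigma> \<circ> inv g \<notin> Sym n" using Sym_comp_iff2[OF Sym_inv[OF g]] by blast
  then show ?thesis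
    using False group_algebraD[OF x] group_algebraD[OF ga_mult_in[OF ga_elem_in[OF g]]] by metis
qed

lemma ga_elem_mult: "g \<in> Sym n \<Longrightarrow> h \<in> Sym n \<Longrightarrow> ga_mult n (ga_elem g) (ga_elem h) = ga_elem (g \<circ> h)"
proof
  fix \<sigma> assume g: "g \<in> Sym n" and h: "h \<in> Sym n"
  have "inv g \<circ> \<sigma> = h \<longleftrightarrow> \<sigma> = g \<circ> h" using Sym_cancel(1,2)[OF g] by metis
  then show "ga_mult n (ga_elem g) (ga_elem h) \<sigma> = ga_elem (g \<circ> h) \<sigma>"
    by (simp add: ga_mult_elem_left[OF g]) (simp add: ga_elem_def)
qed

text \<open>The anti-involution that inverts permutations. The coefficient of
  \<open>star n x\<close> times \<open>y\<close> at \<open>id\<close> is a definite form because the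
  rationals are an ordered field.\<close>

definition star :: "nat \<Rightarrow> ((nat \<Rightarrow> nat) \<Rightarrow> rat) \<Rightarrow> (nat \<Rightarrow> nat) \<Rightarrow> rat" where
  "star n x = (\<lambda>\<sigma>. if \<sigma> \<in> Sym n then x (inv \<sigma>) else 0)"

lemma star_in [intro, simp]: "star n x \<in> group_algebra n"
  by (rule group_algebraI) (simp add: star_def)

lemma star_mult:
  assumes "y \<in> group_algebra n"
  shows "star n (ga_mult n x y) = ga_mult n (star n y) (star n x)"
proof (rule group_algebra_eqI[of _ n])
  fix \<sigma> assume s: "\<sigma> \<in> Sym n"
  have "ga_mult n (star n y) (star n x) \<sigma> = (\<Sum>\<pi>\<in>Sym n. y (inv \<pi>) * x (inv (inv \<pi> \<circ> \<sigma>)))"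
    unfolding ga_mult_def using s Sym_comp[OF Sym_inv s] by (intro sum.cong) (auto simp: star_def)
  also have "\<dots> = (\<Sum>\<pi>\<in>Sym n. y (inv (\<sigma> \<circ> \<pi>)) * x (inv (inv (\<sigma> \<circ> \<pi>) \<circ> \<sigma>)))"
    by (rule sum_Sym_left[OF s, symmetric])
  also have "\<dots> = (\<Sum>\<pi>\<in>Sym n. x \<pi> * y (inv \<pi> \<circ> inv \<sigma>))"
  proof (rule sum.cong[OF refl])
    fix \<pi> assume p: "\<pi> \<in> Sym n"
    have 1: "inv (\<sigma> \<circ> \<pi>) = inv \<pi> \<circ> inv \<sigma>" by (rule Sym_inv_of_comp[OF s p])
    have 2: "inv (inv (\<sigma> \<circ> \<pi>) \<circ> \<sigma>) = \<pi>"
      unfolding 1 using Sym_cancel(4)[OF s, of "inv \<pi>"] Sym_inv_inv[OF p] by simp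
    show "y (inv (\<sigma> \<circ> \<pi>)) * x (inv (inv (\<sigma> \<circ> \<pi>) \<circ> \<sigma>)) = x \<pi> * y (inv \<pi> \<circ> inv \<sigma>)"
      unfolding 2 unfolding 1 by simp
  qed
  also have "\<dots> = star n (ga_mult n x y) \<sigma>" using s by (simp add: star_def ga_mult_def)
  finally show "star n (ga_mult n x y) \<sigma> = ga_mult n (star n y) (star n x) \<sigma>" ..
qed (auto simp: star_in ga_mult_in)

lemma ga_mult_at_id: "ga_mult n x y id = (\<Sum>\<pi>\<in>Sym n. x \<pi> * y (inv \<pi>))"
  by (simp add: ga_mult_def)

text \<open>The coefficient at the identity is a trace form, so factors may be rotated cyclically
  under it.\<close>

lemma ga_mult_at_id_commute: "ga_mult n x y id = ga_mult n y x id"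
proof -
  have "ga_mult n x y id = (\<Sum>\<pi>\<in>Sym n. x (inv \<pi>) * y (inv (inv \<pi>)))"
    unfolding ga_mult_at_id by (rule sum_Sym_inv[symmetric])
  also have "\<dots> = ga_mult n y x id"
    unfolding ga_mult_at_id by (intro sum.cong refl) (simp add: Sym_inv_inv del: mem_Collect_eq)
  finally show ?thesis .
qed

lemma star_mult_self_at_id: "ga_mult n (star n x) x id = (\<Sum>\<pi>\<in>Sym n. (x \<pi>)\<^sup>2)"
proof -
  have "ga_mult n (star n x) x id = (\<Sum>\<pi>\<in>Sym n. (x (inv \<pi>))\<^sup>2)"
    unfolding ga_mult_at_id by (intro sum.cong) (auto simp: star_def power2_eq_square)
  then show ?thesis using sum_Sym_inv[of "\<lambda>\<pi>. (x \<pi>)\<^sup>2" n] by simp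
qed

lemma star_mult_self_eq_0:
  assumes "x \<in> group_algebra n" "ga_mult n (star n x) x id = 0"
  shows "x = 0"
proof (rule group_algebra_eqI[OF assms(1)])
  fix \<sigma> assume "\<sigma> \<in> Sym n"
  then show "x \<sigma> = 0 \<sigma>"
    using assms(2) unfolding star_mult_self_at_id by (simp add: sum_nonneg_eq_0_iff)
qed (simp add: group_algebra_def)

lemma star_mult_self_nonneg: "0 \<le> ga_mult n (star n x) x id"
  unfolding star_mult_self_at_id by (simp add: sum_nonneg)

definition class_function :: "nat \<Rightarrow> ((nat \<Rightarrow> nat) \<Rightarrow> rat) \<Rightarrow> bool" where
  "class_function n F \<longleftrightarrow> F \<in> group_algebra n \<and>
     (\<forall>h\<in>Sym n. \<forall>\<sigma>\<in>Sym n. F (h \<circ> \<sigma> \<circ> inv h) = F \<sigma>)"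

lemma class_function_commute:
  assumes F: "class_function n F" and y: "y \<in> group_algebra n"
  shows "ga_mult n y F = ga_mult n F y"
proof (rule group_algebra_eqI[of _ n])
  fix \<sigma> assume s: "\<sigma> \<in> Sym n"
  have "ga_mult n F y \<sigma> = (\<Sum>\<pi>\<in>Sym n. F (inv \<pi>) * y (inv (inv \<pi>) \<circ> \<sigma>))"
    unfolding ga_mult_def by (rule sum_Sym_inv[symmetric])
  also have "\<dots> = (\<Sum>\<pi>\<in>Sym n. F (inv \<pi>) * y (\<pi> \<circ> \<sigma>))"
    by (intro sum.cong refl) (simp add: Sym_inv_inv del: mem_Collect_eq)
  also have "\<dots> = (\<Sum>\<pi>\<in>Sym n. F (inv (\<pi> \<circ> inv \<sigma>)) * y (\<pi> \<circ> inv \<sigma> \<circ> \<sigma>))"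
    by (rule sum_Sym_right[OF Sym_inv[OF s], symmetric])
  also have "\<dots> = (\<Sum>\<pi>\<in>Sym n. y \<pi> * F (inv \<pi> \<circ> \<sigma>))"
  proof (rule sum.cong[OF refl])
    fix \<pi> assume p: "\<pi> \<in> Sym n"
    have 1: "inv (\<pi> \<circ> inv \<sigma>) = \<sigma> \<circ> (inv \<pi> \<circ> \<sigma>) \<circ> inv \<sigma>"
      using Sym_inv_of_comp[OF p Sym_inv[OF s]] Sym_inv_inv[OF s]
        Sym_cancel(3)[OF s, of "\<sigma> \<circ> inv \<pi>"] by (simp add: o_assoc)
    have 2: "F (\<sigma> \<circ> (inv \<pi> \<circ> \<sigma>) \<circ> inv \<sigma>) = F (inv \<pi> \<circ> \<sigma>)"
      using F s Sym_comp[OF Sym_inv[OF p] s] unfolding class_function_def by blast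
    show "F (inv (\<pi> \<circ> inv \<sigma>)) * y (\<pi> \<circ> inv \<sigma> \<circ> \<sigma>) = y \<pi> * F (inv \<pi> \<circ> \<sigma>)"
      unfolding 1 2 Sym_cancel(4)[OF s] by simp
  qed
  also have "\<dots> = ga_mult n y F \<sigma>" by (simp add: ga_mult_def)
  finally show "ga_mult n y F \<sigma> = ga_mult n F y \<sigma>" ..
qed (use F y in \<open>auto simp: class_function_def\<close>)

section \<open>Young symmetrizers as products of two signed subgroup sums\<close>

locale signed_subgroup =
  fixes n :: nat and H :: "(nat \<Rightarrow> nat) set" and f :: "(nat \<Rightarrow> nat) \<Rightarrow> rat"
  assumes sub: "H \<subseteq> Sym n" and id_in: "id \<in> H"
    and comp_in: "\<And>p q. p \<in> H \<Longrightarrow> q \<in> H \<Longrightarrow> p \<circ> q \<in> H"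
    and inv_in: "\<And>p. p \<in> H \<Longrightarrow> inv p \<in> H"
    and f_comp: "\<And>p q. p \<in> H \<Longrightarrow> q \<in> H \<Longrightarrow> f (p \<circ> q) = f p * f q"
    and f_sq: "\<And>p. p \<in> H \<Longrightarrow> f p * f p = 1"
begin

text \<open>The sum over a subgroup twisted by a character with values 1 and -1; it is idempotent up
  to the factor \<open>card H\<close>. Row groups, column groups and stabilizers of words are all
  instances.\<close>

definition e :: "(nat \<Rightarrow> nat) \<Rightarrow> rat" where
  "e = (\<lambda>\<sigma>. if \<sigma> \<in> H then f \<sigma> else 0)"

lemma e_in [simp, intro]: "e \<in> group_algebra n"
  using sub by (auto simp: e_def group_algebra_def)

lemma f_id: "f id = 1"
  using f_comp[OF id_in id_in] f_sq[OF id_in] by simp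

lemma f_inv: "p \<in> H \<Longrightarrow> f (inv p) = f p"
proof -
  assume p: "p \<in> H"
  have "p \<circ> inv p = id" using p sub by auto
  then have "f p * f (inv p) = 1" using f_comp[OF p inv_in[OF p]] f_id by simp
  then show "f (inv p) = f p" using f_sq[OF p] by (metis mult.assoc mult.right_neutral mult.commute)
qed

lemma in_comp_iff: "p \<in> H \<Longrightarrow> p \<circ> q \<in> H \<longleftrightarrow> q \<in> H"
  using comp_in[of "inv p" "p \<circ> q"] comp_in[of p q] inv_in[of p] Sym_cancel(2)[of p n q] sub by auto

lemma in_comp_iff2: "p \<in> H \<Longrightarrow> q \<circ> p \<in> H \<longleftrightarrow> q \<in> H"
  using comp_in[of "q \<circ> p" "inv p"] comp_in[of q p] inv_in[of p] Sym_cancel(3)[of p n q] sub by auto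

lemma elem_e: "p \<in> H \<Longrightarrow> ga_mult n (ga_elem p) e = qscale (f p) e"
proof
  fix \<sigma> assume p: "p \<in> H"
  then have "p \<in> Sym n" using sub by auto
  then show "ga_mult n (ga_elem p) e \<sigma> = qscale (f p) e \<sigma>"
    using in_comp_iff[OF inv_in[OF p], of \<sigma>] f_comp[OF inv_in[OF p], of \<sigma>] f_inv[OF p]
    by (simp add: ga_mult_elem_left qscale_def e_def del: mem_Collect_eq)
qed

lemma e_elem: "p \<in> H \<Longrightarrow> ga_mult n e (ga_elem p) = qscale (f p) e"
proof
  fix \<sigma> assume p: "p \<in> H"
  then have "p \<in> Sym n" using sub by auto
  then show "ga_mult n e (ga_elem p) \<sigma> = qscale (f p) e \<sigma>"
    using in_comp_iff2[OF inv_in[OF p], of \<sigma>] f_comp[OF _ inv_in[OF p], of \<sigma>] f_inv[OF p]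
    by (subst ga_mult_elem_right[OF _ e_in]) (simp_all add: qscale_def e_def del: mem_Collect_eq)
qed

lemma e_e: "ga_mult n e e = qscale (of_nat (card H)) e"
proof
  fix \<sigma>
  have fH: "finite H" using sub finite_Sym finite_subset by blast
  have "ga_mult n e e \<sigma> = (\<Sum>\<pi>\<in>H. e \<pi> * e (inv \<pi> \<circ> \<sigma>))"
    unfolding ga_mult_def using sub by (intro sum.mono_neutral_right) (auto simp: e_def)
  also have "\<dots> = (\<Sum>\<pi>\<in>H. e \<sigma>)"
  proof (rule sum.cong[OF refl])
    fix \<pi> assume p: "\<pi> \<in> H"
    then show "e \<pi> * e (inv \<pi> \<circ> \<sigma>) = e \<sigma>"
      using in_comp_iff[OF inv_in[OF p], of \<sigma>] f_comp[OF inv_in[OF p], of \<sigma>] f_inv[OF p] f_sq[OF p]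
      by (simp add: e_def mult.assoc[symmetric])
  qed
  finally show "ga_mult n e e \<sigma> = qscale (of_nat (card H)) e \<sigma>" by (simp add: qscale_def)
qed

lemma e_e_mult: "ga_mult n e (ga_mult n e x) = qscale (of_nat (card H)) (ga_mult n e x)"
  unfolding ga_mult_assoc[symmetric] by (simp add: e_e)

lemma star_e: "star n e = e"
proof (rule group_algebra_eqI[of _ n])
  fix \<sigma> assume s: "\<sigma> \<in> Sym n"
  then have "inv \<sigma> \<in> H \<longleftrightarrow> \<sigma> \<in> H" using inv_in[of \<sigma>] inv_in[of "inv \<sigma>"] Sym_inv_inv[OF s] by auto
  then show "star n e \<sigma> = e \<sigma>" using s by (simp add: star_def e_def f_inv del: mem_Collect_eq)
qed auto

lemma card_pos: "0 < card H"
  using id_in sub finite_Sym finite_subset card_gt_0_iff by blast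

end

text \<open>The assumption \<open>neumann\<close> isolates the combinatorial input from tableaux: a
  permutation that is not a row element times a column element conjugates some column element of
  sign -1 into the row group.\<close>

locale young_pair =
  A: signed_subgroup n R "\<lambda>_. 1" + B: signed_subgroup n C g for n R C g +
  assumes Int: "R \<inter> C = {id}"
    and neumann: "\<And>h. h \<in> Sym n \<Longrightarrow> (\<exists>p\<in>R. \<exists>q\<in>C. h = p \<circ> q) \<or>
      (\<exists>s\<in>C. g s = -1 \<and> h \<circ> s \<circ> inv h \<in> R)"
begin

abbreviation "a \<equiv> A.e"
abbreviation "b \<equiv> B.e"

definition c :: "(nat \<Rightarrow> nat) \<Rightarrow> rat" where "c = ga_mult n a b"

lemma c_in [simp, intro]: "c \<in> group_algebra n"
  by (simp add: c_def ga_mult_in)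

text \<open>The subgroups meet trivially, so \<open>id\<close> is a row element times a column
  element in only one way.\<close>

lemma mult_at_id: "ga_mult n a b id = 1"
proof -
  have "a \<pi> * b (inv \<pi>) = (if \<pi> = id then 1 else 0)" if "\<pi> \<in> Sym n" for \<pi>
  proof -
    have "\<pi> \<in> R \<Longrightarrow> inv \<pi> \<in> C \<Longrightarrow> \<pi> = id"
      using Int B.inv_in[of "inv \<pi>"] Sym_inv_inv[OF that] by auto
    then show ?thesis using A.id_in B.id_in B.f_id by (auto simp: A.e_def B.e_def)
  qed
  then have "ga_mult n a b id = (\<Sum>\<pi>\<in>Sym n. if \<pi> = id then 1 else 0)"
    unfolding ga_mult_at_id by (intro sum.cong) auto
  also have "\<dots> = 1" by (subst sum.delta) auto
  finally show ?thesis .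
qed

text \<open>Von Neumann's lemma. The two symmetries determine the values on products of R and C from
  the value at \<open>id\<close>. At any other h, a column element of sign -1 on the right acts as a
  row element on the left, so the value equals its own negative.\<close>

lemma neumann_scalar:
  assumes x: "x \<in> group_algebra n"
    and l: "\<And>p. p \<in> R \<Longrightarrow> ga_mult n (ga_elem p) x = x"
    and r: "\<And>q. q \<in> C \<Longrightarrow> ga_mult n x (ga_elem q) = qscale (g q) x"
  shows "x = qscale (x id) c"
proof -
  \<comment> \<open>Stated for a variable y, since it is applied both to x and to c.\<close>
  have *: "(h = p \<circ> q \<longrightarrow> y h = g q * y id) \<and>
      (s \<in> C \<and> g s = -1 \<and> h \<circ> s \<circ> inv h \<in> R \<longrightarrow> y h = 0)"
    if y: "y \<in> group_algebra n"
    and l: "\<And>p. p \<in> R \<Longrightarrow> ga_mult n (ga_elem p) y = y"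
    and r: "\<And>q. q \<in> C \<Longrightarrow> ga_mult n y (ga_elem q) = qscale (g q) y"
    and h: "h \<in> Sym n" and p: "p \<in> R" and q: "q \<in> C" for y h p q s
  proof -
    have l': "y (p \<circ> \<sigma>) = y \<sigma>" if "p \<in> R" for p \<sigma>
    proof -
      have ps: "p \<in> Sym n" using that A.sub by auto
      show ?thesis
        using fun_cong[OF l[OF that], of "p \<circ> \<sigma>"] ga_mult_elem_left[OF ps, of y "p \<circ> \<sigma>"]
        by (simp add: Sym_cancel(2)[OF ps])
    qed
    have r': "y (\<sigma> \<circ> q) = g q * y \<sigma>" if "q \<in> C" for q \<sigma>
    proof -
      have qs: "q \<in> Sym n" using that B.sub by auto
      have "y \<sigma> = g q * y (\<sigma> \<circ> q)"
        using fun_cong[OF r[OF that], of "\<sigma> \<circ> q"] ga_mult_elem_right[OF qs y, of "\<sigma> \<circ> q"]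
        Sym_cancel(3)[OF qs, of \<sigma>] by (simp add: qscale_def)
      then show ?thesis using B.f_sq[OF that] by (simp add: mult.assoc[symmetric])
    qed
    have "y h = g q * y id" if "h = p \<circ> q"
      using l'[OF p, of q] r'[OF q, of id] that by simp
    moreover have "y h = 0" if "s \<in> C" "g s = -1" "h \<circ> s \<circ> inv h \<in> R"
    proof -
      have "y h = y (h \<circ> s \<circ> inv h \<circ> h)" using l'[OF that(3)] by simp
      also have "h \<circ> s \<circ> inv h \<circ> h = h \<circ> s" using Sym_cancel(4)[OF h, of "h \<circ> s"] .
      also have "y (h \<circ> s) = - y h" using r'[OF that(1), of h] that(2) by simp
      finally show ?thesis by simp
    qed
    ultimately show ?thesis by blast
  qed
  have cl: "ga_mult n (ga_elem p) c = c" if "p \<in> R" for p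
    using A.elem_e[OF that] by (simp add: c_def ga_mult_assoc[symmetric])
  have cr: "ga_mult n c (ga_elem q) = qscale (g q) c" if "q \<in> C" for q
    using B.e_elem[OF that] by (simp add: c_def ga_mult_assoc)
  show ?thesis
  proof (rule group_algebra_eqI[OF x qscale_in[OF c_in]])
    fix h assume h: "h \<in> Sym n"
    consider p q where "p \<in> R" "q \<in> C" "h = p \<circ> q"
      | s where "s \<in> C" "g s = -1" "h \<circ> s \<circ> inv h \<in> R" using neumann[OF h] by blast
    then show "x h = qscale (x id) c h"
    proof cases
      case 1
      then have "x h = g q * x id" "c h = g q * c id"
        using *[OF x l r h] *[OF c_in cl cr h] by blast+
      then show ?thesis using mult_at_id by (simp add: qscale_def c_def)
    next
      case 2
      then have "x h = 0" "c h = 0"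
        using *[OF x l r h A.id_in B.id_in] *[OF c_in cl cr h A.id_in B.id_in] by blast+
      then show ?thesis by (simp add: qscale_def)
    qed
  qed
qed

text \<open>For a Young symmetrizer this is n! divided by the dimension of the Specht module; the
  proof uses that it is nonzero.\<close>

definition m :: rat where "m = ga_mult n c c id"

lemma c_c: "ga_mult n c c = qscale m c"
  unfolding m_def
proof (rule neumann_scalar)
  fix p assume "p \<in> R"
  then show "ga_mult n (ga_elem p) (ga_mult n c c) = ga_mult n c c"
    using A.elem_e[of p] by (simp add: c_def ga_mult_assoc[symmetric])
next
  fix q assume "q \<in> C"
  then show "ga_mult n (ga_mult n c c) (ga_elem q) = qscale (g q) (ga_mult n c c)"
    using B.e_elem[of q] by (simp add: c_def ga_mult_assoc)
qed auto

text \<open>Up to the factor \<open>card R\<close>, b a b is the star of a b times a b, because a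
  and b are self-adjoint. Definiteness applies, since a b has coefficient 1 at
  \<open>id\<close>.\<close>

lemma bab_nonzero: "ga_mult n b (ga_mult n a b) \<noteq> 0"
proof
  assume 0: "ga_mult n b (ga_mult n a b) = 0"
  have "ga_mult n (star n (ga_mult n a b)) (ga_mult n a b) = 0"
    by (simp add: star_mult A.star_e B.star_e ga_mult_assoc A.e_e_mult 0)
  then have "ga_mult n a b = 0"
    by (intro star_mult_self_eq_0[of _ n]) auto
  then show False using mult_at_id by simp
qed

text \<open>Otherwise a b a b vanishes. Then so does the square of the self-adjoint element b a b,
  and definiteness makes b a b itself vanish.\<close>

lemma m_nonzero: "m \<noteq> 0"
proof
  assume "m = 0"
  then have 0: "ga_mult n a (ga_mult n b (ga_mult n a b)) = 0"
    using c_c by (simp add: c_def ga_mult_assoc)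
  let ?y = "ga_mult n b (ga_mult n a b)"
  have "star n ?y = ?y"
    by (simp add: star_mult A.star_e B.star_e ga_mult_assoc ga_mult_in)
  then have "ga_mult n (star n ?y) ?y = 0"
    by (simp add: ga_mult_assoc B.e_e_mult 0)
  then have "?y = 0" by (intro star_mult_self_eq_0[of _ n]) auto
  then show False using bab_nonzero by simp
qed

lemma aba_nonzero: "ga_mult n a (ga_mult n b a) \<noteq> 0"
proof
  assume 0: "ga_mult n a (ga_mult n b a) = 0"
  have "ga_mult n (star n (ga_mult n b a)) (ga_mult n b a) = 0"
    by (simp add: star_mult A.star_e B.star_e ga_mult_assoc B.e_e_mult 0)
  then have "ga_mult n b a = 0"
    by (intro star_mult_self_eq_0[of _ n]) auto
  then show False using mult_at_id ga_mult_at_id_commute[of n a b] by simp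
qed

text \<open>Up to positive factors this is the coefficient of star x times x for x = a b e: one
  factor e is rotated cyclically, and e e is a positive multiple of e. The intended subgroups are
  stabilizers of words.\<close>

lemma babe_nonneg:
  assumes "signed_subgroup n E u"
  shows "0 \<le> ga_mult n (ga_mult n b (ga_mult n a b)) (signed_subgroup.e E u) id"
proof -
  interpret E: signed_subgroup n E u by fact
  let ?x = "ga_mult n a (ga_mult n b E.e)" and ?y = "ga_mult n b (ga_mult n a b)"
  have "ga_mult n (star n ?x) ?x = qscale (of_nat (card R)) (ga_mult n E.e (ga_mult n ?y E.e))"
    by (simp add: star_mult A.star_e B.star_e E.star_e ga_mult_assoc A.e_e_mult ga_mult_in)
  then have 1: "ga_mult n (star n ?x) ?x id = of_nat (card R) * ga_mult n E.e (ga_mult n ?y E.e) id"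
    by (simp only: qscale_apply)
  have 2: "ga_mult n E.e (ga_mult n ?y E.e) id = ga_mult n ?y (ga_mult n E.e E.e) id"
    by (subst ga_mult_at_id_commute) (simp only: ga_mult_assoc)
  have 3: "ga_mult n ?y (ga_mult n E.e E.e) id = of_nat (card E) * ga_mult n ?y E.e id"
    by (simp only: E.e_e ga_mult_qscale_right qscale_apply)
  have "0 \<le> of_nat (card R) * (of_nat (card E) * ga_mult n ?y E.e id)"
    using star_mult_self_nonneg[of n ?x] unfolding 1 2 3 .
  then show ?thesis using A.card_pos E.card_pos by (simp add: zero_le_mult_iff)
qed

text \<open>For the row group the preceding inequality is strict because a b a does not
  vanish.\<close>

lemma baba_pos: "0 < ga_mult n (ga_mult n b (ga_mult n a b)) a id"
proof -
  let ?x = "ga_mult n a (ga_mult n b a)" and ?y = "ga_mult n b (ga_mult n a b)"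
  have "ga_mult n ?y a id \<noteq> 0"
  proof
    assume 0: "ga_mult n ?y a id = 0"
    have "ga_mult n (star n ?x) ?x = qscale (of_nat (card R)) (ga_mult n a (ga_mult n ?y a))"
      by (simp add: star_mult A.star_e B.star_e ga_mult_assoc A.e_e_mult ga_mult_in)
    then have 1: "ga_mult n (star n ?x) ?x id = of_nat (card R) * ga_mult n a (ga_mult n ?y a) id"
      by (simp only: qscale_apply)
    have 2: "ga_mult n a (ga_mult n ?y a) id = ga_mult n ?y (ga_mult n a a) id"
      by (subst ga_mult_at_id_commute) (simp only: ga_mult_assoc)
    have 3: "ga_mult n ?y (ga_mult n a a) id = 0"
      by (simp only: A.e_e ga_mult_qscale_right qscale_apply 0 mult_zero_right)
    have "ga_mult n (star n ?x) ?x id = 0" unfolding 1 2 3 by simp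
    then have "?x = 0" by (intro star_mult_self_eq_0[of _ n] ga_mult_in A.e_in)
    then show False using aba_nonzero by simp
  qed
  then show ?thesis using babe_nonneg[OF A.signed_subgroup_axioms] by simp
qed

end

text \<open>For a projection P onto V, the trace of T on V is the trace of T P in the coordinates
  from S. Expanding \<open>P (d s)\<close> in the basis B and \<open>T b\<close> in coordinates
  turns one sum into the other.\<close>

lemma trace_on_eq:
  fixes V :: "('a \<Rightarrow> rat) set"
  assumes V: "qvec.subspace V" and S: "finite S" and VS: "\<And>v x. v \<in> V \<Longrightarrow> x \<notin> S \<Longrightarrow> v x = 0"
    and P: "module_hom qscale qscale P" and PV: "\<And>x. P x \<in> V" and Pid: "\<And>v. v \<in> V \<Longrightarrow> P v = v"
    and T: "module_hom qscale qscale T" and TV: "\<And>v. v \<in> V \<Longrightarrow> T v \<in> V"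
  shows "trace_on V T = (\<Sum>s\<in>S. T (P (\<lambda>x. if x = s then 1 else 0)) s)"
proof -
  define d :: "'a \<Rightarrow> 'a \<Rightarrow> rat" where "d s = (\<lambda>x. if x = s then 1 else 0)" for s
  define B where "B = (SOME B. qvec.independent B \<and> qvec.span B = V)"
  have "\<exists>B. qvec.independent B \<and> qvec.span B = V"
    using qvec.basis_exists[of V] qvec.span_subspace V by metis
  then have B: "qvec.independent B" "qvec.span B = V"
    unfolding B_def by (metis (mono_tags, lifting) someI_ex)+
  have exp: "v = (\<Sum>s\<in>S. qscale (v s) (d s))" if "v \<in> V" for v
  proof
    fix x
    have "(\<Sum>s\<in>S. qscale (v s) (d s)) x = (\<Sum>s\<in>S. if x = s then v s else 0)"
      by (simp add: sum_fun_apply qscale_def d_def cong: sum.cong) (rule sum.cong, auto)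
    also have "\<dots> = v x" using S VS[OF that, of x] by (simp add: sum.delta')
    finally show "v x = (\<Sum>s\<in>S. qscale (v s) (d s)) x" ..
  qed
  have "V \<subseteq> qvec.span (d ` S)"
  proof
    fix v assume "v \<in> V"
    have "(\<Sum>s\<in>S. qscale (v s) (d s)) \<in> qvec.span (d ` S)"
      by (intro qvec.span_sum qvec.span_scale qvec.span_base) auto
    then show "v \<in> qvec.span (d ` S)" using exp[OF \<open>v \<in> V\<close>] by simp
  qed
  then have fB: "finite B"
    using qvec.independent_span_bound[of "d ` S" B] B S qvec.span_superset by blast
  have "(\<Sum>s\<in>S. T (P (d s)) s) = (\<Sum>s\<in>S. \<Sum>b\<in>B. qvec.representation B (P (d s)) b * T b s)"
  proof (rule sum.cong[OF refl])
    fix s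
    have "P (d s) = (\<Sum>b\<in>B. qscale (qvec.representation B (P (d s)) b) b)"
      using qvec.sum_representation_eq[OF B(1) _ fB order_refl, of "P (d s)"] PV[of "d s"] B(2) by simp
    then have "T (P (d s)) = T (\<Sum>b\<in>B. qscale (qvec.representation B (P (d s)) b) b)" by simp
    also have "\<dots> = (\<Sum>b\<in>B. qscale (qvec.representation B (P (d s)) b) (T b))"
      by (simp add: module_hom.sum[OF T] module_hom.scale[OF T])
    finally show "T (P (d s)) s = (\<Sum>b\<in>B. qvec.representation B (P (d s)) b * T b s)"
      by (simp add: sum_fun_apply qscale_def)
  qed
  also have "\<dots> = (\<Sum>b\<in>B. \<Sum>s\<in>S. T b s * qvec.representation B (P (d s)) b)"
    by (subst sum.swap) (simp add: mult.commute)
  also have "\<dots> = (\<Sum>b\<in>B. qvec.representation B (T b) b)"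
  proof (rule sum.cong[OF refl])
    fix b assume "b \<in> B"
    then have bV: "T b \<in> V" using B(2) qvec.span_superset TV by blast
    have "T b = P (T b)" using Pid[OF bV] by simp
    also have "\<dots> = P (\<Sum>s\<in>S. qscale (T b s) (d s))" using exp[OF bV] by simp
    also have "\<dots> = (\<Sum>s\<in>S. qscale (T b s) (P (d s)))"
      by (simp add: module_hom.sum[OF P] module_hom.scale[OF P])
    finally have "qvec.representation B (T b) b =
        qvec.representation B (\<Sum>s\<in>S. qscale (T b s) (P (d s))) b" by simp
    also have "\<dots> = (\<Sum>s\<in>S. qvec.representation B (qscale (T b s) (P (d s))) b)"
      by (subst qvec.representation_sum[OF B(1)]) (use PV B(2) qvec.span_scale in auto)
    also have "\<dots> = (\<Sum>s\<in>S. T b s * qvec.representation B (P (d s)) b)"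
      using PV B by (intro sum.cong refl) (simp add: qvec.representation_scale)
    finally show "(\<Sum>s\<in>S. T b s * qvec.representation B (P (d s)) b) = qvec.representation B (T b) b" ..
  qed
  also have "\<dots> = trace_on V T" by (simp add: trace_on_def B_def Let_def)
  finally show ?thesis by (simp add: d_def)
qed

section \<open>Class sums of Young symmetrizers\<close>

definition stab :: "nat \<Rightarrow> (nat \<Rightarrow> nat) \<Rightarrow> (nat \<Rightarrow> nat) set" where
  "stab n w = {\<sigma> \<in> Sym n. w \<circ> \<sigma> = w}"

lemma signed_subgroup_stab: "signed_subgroup n (stab n w) (\<lambda>_. 1)"
proof unfold_locales
  show "stab n w \<subseteq> Sym n" "id \<in> stab n w" by (auto simp: stab_def)
  show "p \<circ> q \<in> stab n w" if "p \<in> stab n w" "q \<in> stab n w" for p q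
    using that Sym_comp[of p n q] unfolding stab_def by (auto simp: o_assoc)
  show "inv p \<in> stab n w" if "p \<in> stab n w" for p
  proof -
    have a: "p \<in> Sym n" "w \<circ> p = w" using that by (auto simp: stab_def)
    have "w = w \<circ> inv p" using a comp_Sym_eq_iff[OF a(1), of w w] by simp
    then show ?thesis using Sym_inv[OF a(1)] by (simp add: stab_def)
  qed
qed auto

lemma row_group_eq_stab: "row_group \<mu> = stab (sum_list \<mu>) (row_word \<mu>)"
  by (simp add: stab_def row_group_eq)

lemma signed_subgroup_col_group: "signed_subgroup (sum_list \<mu>) (col_group \<mu>) (\<lambda>q. of_int (sign q))"
proof
  let ?n = "sum_list \<mu>"
  show sC: "col_group \<mu> \<subseteq> Sym ?n" by (auto simp: col_group_def)
  show "id \<in> col_group \<mu>" using row_group_Int_col_group by blast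
  have perm: "permutation q" if "q \<in> col_group \<mu>" for q
    using that permutes_imp_permutation[of "{..<?n}" q] by (simp add: col_group_def)
  have col: "coli \<mu> (q m) = coli \<mu> m" if "q \<in> col_group \<mu>" "m < ?n" for q m
    using that by (simp add: col_group_def coli_def)
  have colI: "q \<in> col_group \<mu>" if "q \<in> Sym ?n" "\<And>m. m < ?n \<Longrightarrow> coli \<mu> (q m) = coli \<mu> m" for q
    using that by (simp add: col_group_def coli_def)
  show "a \<circ> b \<in> col_group \<mu>" if ab: "a \<in> col_group \<mu>" "b \<in> col_group \<mu>" for a b
  proof (rule colI)
    have "a \<in> Sym ?n" "b \<in> Sym ?n" using ab sC by auto
    then show "a \<circ> b \<in> Sym ?n" by (rule Sym_comp)
    show "coli \<mu> ((a \<circ> b) m) = coli \<mu> m" if "m < ?n" for m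
      using col[OF ab(2) that] col[OF ab(1), of "b m"] Sym_less[OF \<open>b \<in> Sym ?n\<close>, of m] that by simp
  qed
  show "inv a \<in> col_group \<mu>" if a: "a \<in> col_group \<mu>" for a
  proof (rule colI)
    have aS: "a \<in> Sym ?n" using a sC by auto
    then show i: "inv a \<in> Sym ?n" by (rule Sym_inv)
    show "coli \<mu> (inv a m) = coli \<mu> m" if "m < ?n" for m
      using col[OF a, of "inv a m"] Sym_less[OF i, of m] that aS by (simp add: permutes_inverses)
  qed
  show "of_int (sign (a \<circ> b)) = of_int (sign a) * (of_int (sign b) :: rat)"
    if "a \<in> col_group \<mu>" "b \<in> col_group \<mu>" for a b
    using sign_compose[OF perm[OF that(1)] perm[OF that(2)]] by simp
qed (simp flip: of_int_mult)

text \<open>The word \<open>row_word \<mu> \<circ> h\<close> decides between the two cases. If it is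
  column-distinct, a column permutation q produces it from \<open>row_word \<mu>\<close>, and
  \<open>h \<circ> inv q\<close> is a row permutation; otherwise a repeated letter in a column
  yields the transposition s.\<close>

lemma young_pair_partition:
  assumes p: "is_partition n \<mu>"
  shows "young_pair n (row_group \<mu>) (col_group \<mu>) (\<lambda>q. of_int (sign q))"
proof -
  have n: "n = sum_list \<mu>" using p by (simp add: is_partition_def)
  have rg: "row_group \<mu> = {\<sigma> \<in> Sym n. row_word \<mu> \<circ> \<sigma> = row_word \<mu>}"
    unfolding n by (rule row_group_eq)
  have sC: "col_group \<mu> \<subseteq> Sym n" by (auto simp: col_group_def n)
  show ?thesis
  proof (intro young_pair.intro young_pair_axioms.intro)
    show "signed_subgroup n (row_group \<mu>) (\<lambda>_. 1)"
      unfolding n row_group_eq_stab by (rule signed_subgroup_stab)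
    show "signed_subgroup n (col_group \<mu>) (\<lambda>q. of_int (sign q))"
      unfolding n by (rule signed_subgroup_col_group)
    show "row_group \<mu> \<inter> col_group \<mu> = {id}" by (rule row_group_Int_col_group)
    fix h assume h: "h \<in> Sym n"
    show "(\<exists>a\<in>row_group \<mu>. \<exists>q\<in>col_group \<mu>. h = a \<circ> q) \<or>
      (\<exists>s\<in>col_group \<mu>. of_int (sign s) = (-1::rat) \<and> h \<circ> s \<circ> inv h \<in> row_group \<mu>)"
    proof (cases "column_distinct \<mu> (row_word \<mu> \<circ> h)")
      case True
      have "row_word \<mu> \<circ> h \<in> words n (ipart \<mu>)"
        using words_comp[OF row_word_in_words] h n by simp
      then obtain q where q: "q \<in> col_group \<mu>" "row_word \<mu> \<circ> h = row_word \<mu> \<circ> q"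
        using column_distinct_superstandard[OF p _ True] by blast
      have qS: "q \<in> Sym n" using q(1) sC by auto
      have "row_word \<mu> \<circ> (h \<circ> inv q) = row_word \<mu> \<circ> q \<circ> inv q" by (simp only: o_assoc q(2))
      also have "\<dots> = row_word \<mu>" by (rule Sym_cancel(3)[OF qS])
      finally have "h \<circ> inv q \<in> row_group \<mu>"
        unfolding rg using Sym_comp[OF h Sym_inv[OF qS]] by blast
      moreover have "h = h \<circ> inv q \<circ> q" by (rule Sym_cancel(4)[OF qS, symmetric])
      ultimately show ?thesis using q(1) by blast
    next
      case False
      then obtain s where s: "s \<in> col_group \<mu>" "sign s = -1" "row_word \<mu> \<circ> h \<circ> s = row_word \<mu> \<circ> h"
        using not_column_distinct by blast
      have sS: "s \<in> Sym n" using s(1) sC by auto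
      have "row_word \<mu> \<circ> (h \<circ> s \<circ> inv h) = row_word \<mu> \<circ> h \<circ> inv h"
        by (simp only: o_assoc s(3))
      also have "\<dots> = row_word \<mu>" by (rule Sym_cancel(3)[OF h])
      finally have "h \<circ> s \<circ> inv h \<in> row_group \<mu>"
        unfolding rg using Sym_comp[OF Sym_comp[OF h sS] Sym_inv[OF h]] by blast
      then show ?thesis using s by force
    qed
  qed
qed

lemma young_symmetrizer_eq:
  assumes p: "is_partition n \<mu>"
  shows "young_symmetrizer \<mu> = young_pair.c n (row_group \<mu>) (col_group \<mu>) (\<lambda>q. of_int (sign q))"
proof -
  interpret Y: young_pair n "row_group \<mu>" "col_group \<mu>" "\<lambda>q. of_int (sign q)"
    by (rule young_pair_partition[OF p])
  have fin: "finite (row_group \<mu>)" "finite (col_group \<mu>)"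
    using Y.A.sub Y.B.sub finite_Sym finite_subset by blast+
  have "(\<Sum>p\<in>row_group \<mu>. ga_elem p) = Y.A.e"
  proof
    fix \<sigma>
    have "(\<Sum>p\<in>row_group \<mu>. ga_elem p) \<sigma> = (\<Sum>p\<in>row_group \<mu>. if \<sigma> = p then 1 else 0)"
      unfolding sum_fun_apply by (intro sum.cong refl) (simp add: ga_elem_def)
    then show "(\<Sum>p\<in>row_group \<mu>. ga_elem p) \<sigma> = Y.A.e \<sigma>"
      using fin(1) by (simp add: Y.A.e_def sum.delta')
  qed
  moreover have "(\<Sum>q\<in>col_group \<mu>. qscale (of_int (sign q)) (ga_elem q)) = Y.B.e"
  proof
    fix \<sigma>
    have "(\<Sum>q\<in>col_group \<mu>. qscale (of_int (sign q)) (ga_elem q)) \<sigma> =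
      (\<Sum>q\<in>col_group \<mu>. if \<sigma> = q then of_int (sign q) else 0)"
      unfolding sum_fun_apply by (intro sum.cong refl) (simp add: qscale_def ga_elem_def)
    then show "(\<Sum>q\<in>col_group \<mu>. qscale (of_int (sign q)) (ga_elem q)) \<sigma> = Y.B.e \<sigma>"
      using fin(2) by (simp add: Y.B.e_def sum.delta')
  qed
  ultimately show ?thesis
    using p by (simp add: young_symmetrizer_def Y.c_def is_partition_def)
qed

definition class_sum :: "nat \<Rightarrow> ((nat \<Rightarrow> nat) \<Rightarrow> rat) \<Rightarrow> (nat \<Rightarrow> nat) \<Rightarrow> rat" where
  "class_sum n x = (\<lambda>\<sigma>. if \<sigma> \<in> Sym n then \<Sum>h\<in>Sym n. x (h \<circ> \<sigma> \<circ> inv h) else 0)"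

lemma class_function_class_sum: "class_function n (class_sum n x)"
  unfolding class_function_def
proof (intro conjI ballI)
  show "class_sum n x \<in> group_algebra n" by (rule group_algebraI) (simp add: class_sum_def)
  fix h \<sigma> assume h: "h \<in> Sym n" and s: "\<sigma> \<in> Sym n"
  have "(\<Sum>g\<in>Sym n. x (g \<circ> (h \<circ> \<sigma> \<circ> inv h) \<circ> inv g)) = (\<Sum>g\<in>Sym n. x ((g \<circ> h) \<circ> \<sigma> \<circ> inv (g \<circ> h)))"
    using h by (intro sum.cong refl) (simp add: Sym_inv_of_comp[of _ n] o_assoc del: mem_Collect_eq)
  also have "\<dots> = (\<Sum>g\<in>Sym n. x (g \<circ> \<sigma> \<circ> inv g))" by (rule sum_Sym_right[OF h])
  finally show "class_sum n x (h \<circ> \<sigma> \<circ> inv h) = class_sum n x \<sigma>"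
    using s Sym_comp[OF Sym_comp[OF h s] Sym_inv[OF h]] by (simp add: class_sum_def)
qed

text \<open>The products \<pi> \<circ> \<rho> and \<rho> \<circ> \<pi> are conjugate by \<pi>, so
  class sums cannot tell x y from y x.\<close>

lemma class_sum_mult_commute:
  "class_sum n (ga_mult n x y) = class_sum n (ga_mult n y x)"
proof
  fix \<sigma>
  show "class_sum n (ga_mult n x y) \<sigma> = class_sum n (ga_mult n y x) \<sigma>"
  proof (cases "\<sigma> \<in> Sym n")
    case s: True
    have conj: "h \<circ> \<sigma> \<circ> inv h \<in> Sym n" if "h \<in> Sym n" for h
      using Sym_comp[OF Sym_comp[OF that s] Sym_inv[OF that]] .
    have yx: "ga_mult n y x \<tau> = (\<Sum>\<pi>\<in>Sym n. x \<pi> * y (\<tau> \<circ> inv \<pi>))" if t: "\<tau> \<in> Sym n" for \<tau>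
    proof -
      have "ga_mult n y x \<tau> = (\<Sum>\<rho>\<in>Sym n. y (\<tau> \<circ> \<rho>) * x (inv (\<tau> \<circ> \<rho>) \<circ> \<tau>))"
        unfolding ga_mult_def by (rule sum_Sym_left[OF t, symmetric])
      also have "\<dots> = (\<Sum>\<rho>\<in>Sym n. y (\<tau> \<circ> \<rho>) * x (inv \<rho>))"
        using t by (intro sum.cong refl)
          (simp add: Sym_inv_of_comp[of _ n] Sym_cancel(4) del: mem_Collect_eq)
      also have "\<dots> = (\<Sum>\<rho>\<in>Sym n. y (\<tau> \<circ> inv \<rho>) * x (inv (inv \<rho>)))"
        by (rule sum_Sym_inv[symmetric])
      also have "\<dots> = (\<Sum>\<pi>\<in>Sym n. x \<pi> * y (\<tau> \<circ> inv \<pi>))"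
        by (intro sum.cong refl) (simp add: Sym_inv_inv del: mem_Collect_eq)
      finally show ?thesis .
    qed
    have "class_sum n (ga_mult n x y) \<sigma> =
        (\<Sum>\<pi>\<in>Sym n. \<Sum>h\<in>Sym n. x \<pi> * y (inv \<pi> \<circ> (h \<circ> \<sigma> \<circ> inv h)))"
      using s by (simp add: class_sum_def ga_mult_def) (rule sum.swap)
    also have "\<dots> = (\<Sum>\<pi>\<in>Sym n. \<Sum>h\<in>Sym n. x \<pi> * y (h \<circ> \<sigma> \<circ> inv h \<circ> inv \<pi>))"
    proof (rule sum.cong[OF refl])
      fix \<pi> assume p: "\<pi> \<in> Sym n"
      have "(\<Sum>h\<in>Sym n. x \<pi> * y (inv \<pi> \<circ> (h \<circ> \<sigma> \<circ> inv h))) =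
          (\<Sum>h\<in>Sym n. x \<pi> * y (inv \<pi> \<circ> ((\<pi> \<circ> h) \<circ> \<sigma> \<circ> inv (\<pi> \<circ> h))))"
        by (rule sum_Sym_left[OF p, symmetric])
      also have "\<dots> = (\<Sum>h\<in>Sym n. x \<pi> * y (h \<circ> \<sigma> \<circ> inv h \<circ> inv \<pi>))"
      proof (rule sum.cong[OF refl])
        fix h assume h: "h \<in> Sym n"
        have "inv \<pi> \<circ> ((\<pi> \<circ> h) \<circ> \<sigma> \<circ> inv (\<pi> \<circ> h)) = inv \<pi> \<circ> (\<pi> \<circ> (h \<circ> \<sigma> \<circ> inv h \<circ> inv \<pi>))"
          by (simp only: Sym_inv_of_comp[OF p h] o_assoc)
        also have "\<dots> = h \<circ> \<sigma> \<circ> inv h \<circ> inv \<pi>" by (rule Sym_cancel(2)[OF p])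
        finally show "x \<pi> * y (inv \<pi> \<circ> ((\<pi> \<circ> h) \<circ> \<sigma> \<circ> inv (\<pi> \<circ> h))) = x \<pi> * y (h \<circ> \<sigma> \<circ> inv h \<circ> inv \<pi>)"
          by simp
      qed
      finally show "(\<Sum>h\<in>Sym n. x \<pi> * y (inv \<pi> \<circ> (h \<circ> \<sigma> \<circ> inv h))) =
          (\<Sum>h\<in>Sym n. x \<pi> * y (h \<circ> \<sigma> \<circ> inv h \<circ> inv \<pi>))" .
    qed
    also have "\<dots> = (\<Sum>h\<in>Sym n. \<Sum>\<pi>\<in>Sym n. x \<pi> * y (h \<circ> \<sigma> \<circ> inv h \<circ> inv \<pi>))"
      by (rule sum.swap)
    also have "\<dots> = class_sum n (ga_mult n y x) \<sigma>"
      using s conj by (simp add: class_sum_def yx del: mem_Collect_eq)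
    finally show ?thesis .
  qed (simp add: class_sum_def)
qed

lemma class_sum_star:
  assumes s: "\<sigma> \<in> Sym n"
  shows "class_sum n x (inv \<sigma>) = class_sum n (star n x) \<sigma>"
proof -
  have "x (h \<circ> inv \<sigma> \<circ> inv h) = star n x (h \<circ> \<sigma> \<circ> inv h)" if h: "h \<in> Sym n" for h
  proof -
    have "inv (h \<circ> \<sigma> \<circ> inv h) = h \<circ> inv \<sigma> \<circ> inv h"
      using Sym_inv_of_comp[OF Sym_comp[OF h s] Sym_inv[OF h]] Sym_inv_of_comp[OF h s] Sym_inv_inv[OF h]
      by (simp add: o_assoc)
    then show ?thesis using Sym_comp[OF Sym_comp[OF h s] Sym_inv[OF h]] by (simp add: star_def)
  qed
  then show ?thesis using s Sym_inv[OF s] by (simp add: class_sum_def)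
qed

lemma sum_class_sum_mult:
  assumes F: "\<And>h \<sigma>. h \<in> Sym n \<Longrightarrow> \<sigma> \<in> Sym n \<Longrightarrow> F (h \<circ> \<sigma> \<circ> inv h) = F \<sigma>"
  shows "(\<Sum>\<sigma>\<in>Sym n. class_sum n x \<sigma> * F \<sigma>) = fact n * (\<Sum>\<sigma>\<in>Sym n. x \<sigma> * F \<sigma>)"
proof -
  have "(\<Sum>\<sigma>\<in>Sym n. class_sum n x \<sigma> * F \<sigma>) =
      (\<Sum>h\<in>Sym n. \<Sum>\<sigma>\<in>Sym n. x (h \<circ> \<sigma> \<circ> inv h) * F \<sigma>)"
    by (simp add: class_sum_def sum_distrib_right) (rule sum.swap)
  also have "\<dots> = (\<Sum>h\<in>Sym n. \<Sum>\<sigma>\<in>Sym n. x (h \<circ> \<sigma> \<circ> inv h) * F (h \<circ> \<sigma> \<circ> inv h))"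
    by (intro sum.cong refl) (simp add: F del: mem_Collect_eq)
  also have "\<dots> = (\<Sum>h\<in>Sym n. \<Sum>\<sigma>\<in>Sym n. x \<sigma> * F \<sigma>)"
    by (intro sum.cong refl sum_Sym_conj[of _ _ "\<lambda>\<sigma>. x \<sigma> * F \<sigma>"])
  also have "\<dots> = fact n * (\<Sum>\<sigma>\<in>Sym n. x \<sigma> * F \<sigma>)"
    by (simp add: card_permutations[OF refl])
  finally show ?thesis .
qed

abbreviation stab_elem :: "nat \<Rightarrow> (nat \<Rightarrow> nat) \<Rightarrow> (nat \<Rightarrow> nat) \<Rightarrow> rat" where
  "stab_elem n w \<equiv> signed_subgroup.e (stab n w) (\<lambda>_. 1)"

lemma stab_elem_apply: "stab_elem n w \<sigma> = (if \<sigma> \<in> Sym n \<and> w \<circ> \<sigma> = w then 1 else 0)"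
  using signed_subgroup.e_def[OF signed_subgroup_stab[of n w]] by (auto simp: stab_def)

text \<open>The same class function as \<open>fixw\<close>, written as a sum of stabilizer elements
  so that column signs can be applied to it word by word.\<close>

definition fix_elem :: "nat \<Rightarrow> (nat \<Rightarrow> int) \<Rightarrow> (nat \<Rightarrow> nat) \<Rightarrow> rat" where
  "fix_elem n \<beta> = (\<Sum>w\<in>words n \<beta>. stab_elem n w)"

lemma fix_elem_apply: "\<sigma> \<in> Sym n \<Longrightarrow> fix_elem n \<beta> \<sigma> = fixw n \<beta> \<sigma>"
  by (simp add: fix_elem_def sum_fun_apply stab_elem_apply fixw_def sum.If_cases Int_def)

lemma class_function_fix_elem: "class_function n (fix_elem n \<beta>)"
  unfolding class_function_def
proof (intro conjI ballI)
  show "fix_elem n \<beta> \<in> group_algebra n"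
    by (rule group_algebraI) (simp add: fix_elem_def sum_fun_apply stab_elem_apply)
  fix h \<sigma> assume h: "h \<in> Sym n" and s: "\<sigma> \<in> Sym n"
  show "fix_elem n \<beta> (h \<circ> \<sigma> \<circ> inv h) = fix_elem n \<beta> \<sigma>"
    using fix_elem_apply[OF s] fix_elem_apply[OF Sym_comp[OF Sym_comp[OF h s] Sym_inv[OF h]]] fixw_conj[OF h]
    by simp
qed

lemma sum_mult_fixw: "(\<Sum>\<sigma>\<in>Sym n. x \<sigma> * fixw n \<beta> \<sigma>) = ga_mult n x (fix_elem n \<beta>) id"
  unfolding ga_mult_at_id
  by (intro sum.cong refl) (simp add: fix_elem_apply Sym_inv fixw_inv del: mem_Collect_eq)

lemma ga_mult_fix_elem: "ga_mult n x (fix_elem n \<beta>) id = (\<Sum>w\<in>words n \<beta>. ga_mult n x (stab_elem n w) id)"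
  unfolding fix_elem_def ga_mult_sum_right sum_fun_apply ..

text \<open>Proportional to the irreducible character (\<open>specht_character_eq\<close>); its
  value at \<open>id\<close> is n! instead of the dimension.\<close>

definition young_class :: "nat list \<Rightarrow> (nat \<Rightarrow> nat) \<Rightarrow> rat" where
  "young_class \<mu> = class_sum (sum_list \<mu>) (young_symmetrizer \<mu>)"

lemma young_class_conj:
  assumes "is_partition n \<mu>" "h \<in> Sym n" "\<sigma> \<in> Sym n"
  shows "young_class \<mu> (h \<circ> \<sigma> \<circ> inv h) = young_class \<mu> \<sigma>"
  using class_function_class_sum[of n "young_symmetrizer \<mu>"] assms
  unfolding young_class_def class_function_def is_partition_def by blast

text \<open>\<open>star\<close> turns a b into b a, and both have the same class sum.\<close>

lemma young_class_inv:
  assumes p: "is_partition n \<mu>" and s: "\<sigma> \<in> Sym n"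
  shows "young_class \<mu> (inv \<sigma>) = young_class \<mu> \<sigma>"
proof -
  interpret Y: young_pair n "row_group \<mu>" "col_group \<mu>" "\<lambda>q. of_int (sign q)"
    by (rule young_pair_partition[OF p])
  have n: "n = sum_list \<mu>" using p by (simp add: is_partition_def)
  show ?thesis
    unfolding young_class_def n[symmetric] young_symmetrizer_eq[OF p] class_sum_star[OF s] Y.c_def
      star_mult[OF Y.B.e_in] Y.A.star_e Y.B.star_e
    by (rule fun_cong[OF class_sum_mult_commute])
qed

lemma sum_young_class_mult:
  assumes p: "is_partition n \<mu>"
    and F: "\<And>h \<sigma>. h \<in> Sym n \<Longrightarrow> \<sigma> \<in> Sym n \<Longrightarrow> F (h \<circ> \<sigma> \<circ> inv h) = F \<sigma>"
  shows "(\<Sum>\<sigma>\<in>Sym n. young_class \<mu> \<sigma> * F \<sigma>) = fact n * (\<Sum>\<sigma>\<in>Sym n. young_symmetrizer \<mu> \<sigma> * F \<sigma>)"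
proof -
  have n: "n = sum_list \<mu>" using p by (simp add: is_partition_def)
  show ?thesis unfolding young_class_def n[symmetric] by (rule sum_class_sum_mult) (rule F)
qed

lemma sum_young_class_fixw:
  assumes p: "is_partition n \<mu>"
  shows "fix_pairing n (young_class \<mu>) \<beta> =
    fact n * ga_mult n (young_symmetrizer \<mu>) (fix_elem n \<beta>) id"
  unfolding sum_mult_fixw[symmetric] by (rule sum_young_class_mult[OF p]) (rule fixw_conj)

lemma young_class_id: "is_partition n \<mu> \<Longrightarrow> young_class \<mu> id = fact n"
proof -
  assume p: "is_partition n \<mu>"
  interpret Y: young_pair n "row_group \<mu>" "col_group \<mu>" "\<lambda>q. of_int (sign q)"
    by (rule young_pair_partition[OF p])
  have n: "n = sum_list \<mu>" using p by (simp add: is_partition_def)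
  have "young_class \<mu> id = (\<Sum>h\<in>Sym n. young_symmetrizer \<mu> (h \<circ> inv h))"
    by (simp add: young_class_def class_sum_def n[symmetric])
  also have "\<dots> = (\<Sum>h\<in>Sym n. 1)"
    using Y.mult_at_id by (intro sum.cong refl) (simp add: young_symmetrizer_eq[OF p] Y.c_def permutes_inv_o)
  also have "\<dots> = fact n" by (simp add: card_permutations[OF refl])
  finally show ?thesis .
qed

text \<open>A column transposition fixing the word \<open>w\<close> is absorbed on the left with sign \<open>-1\<close> and on the
  right with sign \<open>1\<close>.\<close>

lemma column_sign_stab_elem:
  assumes p: "is_partition n \<mu>" and w: "\<not> column_distinct \<mu> w"
  shows "ga_mult n (signed_subgroup.e (col_group \<mu>) (\<lambda>q. of_int (sign q))) (stab_elem n w) = 0"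
proof -
  interpret Y: young_pair n "row_group \<mu>" "col_group \<mu>" "\<lambda>q. of_int (sign q)"
    by (rule young_pair_partition[OF p])
  interpret E: signed_subgroup n "stab n w" "\<lambda>_. 1" by (rule signed_subgroup_stab)
  obtain s where s: "s \<in> col_group \<mu>" "sign s = -1" "w \<circ> s = w" using not_column_distinct[OF w] by blast
  have "s \<in> stab n w" using s Y.B.sub by (auto simp: stab_def)
  then have 1: "ga_mult n (ga_elem s) E.e = E.e" using E.elem_e by (simp add: qscale_def)
  have 2: "ga_mult n Y.b (ga_elem s) = qscale (-1) Y.b" using Y.B.e_elem[OF s(1)] s(2) by simp
  have "ga_mult n Y.b E.e = ga_mult n (ga_mult n Y.b (ga_elem s)) E.e"
    unfolding ga_mult_assoc 1 ..
  also have "\<dots> = qscale (-1) (ga_mult n Y.b E.e)" unfolding 2 by (rule ga_mult_qscale_left)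
  finally have "ga_mult n Y.b E.e \<sigma> = qscale (-1) (ga_mult n Y.b E.e) \<sigma>" for \<sigma> by (rule fun_cong)
  then show ?thesis by (simp add: fun_eq_iff qscale_def)
qed

lemma young_class_fixw_eq_0:
  assumes p: "is_partition n \<mu>" and d: "\<not> dominated \<beta> \<mu>"
  shows "fix_pairing n (young_class \<mu>) \<beta> = 0"
proof -
  interpret Y: young_pair n "row_group \<mu>" "col_group \<mu>" "\<lambda>q. of_int (sign q)"
    by (rule young_pair_partition[OF p])
  have "ga_mult n (young_symmetrizer \<mu>) (stab_elem n w) id = 0" if "w \<in> words n \<beta>" for w
  proof -
    have "\<not> column_distinct \<mu> w" using column_distinct_dominated[OF p that] d by blast
    then show ?thesis
      using column_sign_stab_elem[OF p] by (simp add: young_symmetrizer_eq[OF p] Y.c_def ga_mult_assoc)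
  qed
  then show ?thesis
    unfolding sum_young_class_fixw[OF p] ga_mult_fix_elem by simp
qed

text \<open>Let F be the central fixed-point element. As b b is a positive multiple of b, the
  coefficient of a b F at \<open>id\<close> becomes, up to a positive factor, that of b a b F. This
  is a sum over words of nonnegative terms, and \<open>row_word \<mu>\<close>, whose stabilizer is
  the row group, contributes a positive one.\<close>

lemma young_class_fixw_self:
  assumes p: "is_partition n \<mu>"
  shows "fix_pairing n (young_class \<mu>) (ipart \<mu>) \<noteq> 0"
proof -
  interpret Y: young_pair n "row_group \<mu>" "col_group \<mu>" "\<lambda>q. of_int (sign q)"
    by (rule young_pair_partition[OF p])
  have n: "n = sum_list \<mu>" using p by (simp add: is_partition_def)
  let ?b = "ipart \<mu>"
  let ?y = "ga_mult n Y.b (ga_mult n Y.a Y.b)"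
  let ?F = "fix_elem n ?b"
  have "ga_mult n Y.b (ga_mult n Y.b ?F) = ga_mult n Y.b (ga_mult n ?F Y.b)"
    using class_function_commute[OF class_function_fix_elem Y.B.e_in] by simp
  then have "qscale (of_nat (card (col_group \<mu>))) (ga_mult n Y.c ?F) = ga_mult n Y.a (ga_mult n Y.b (ga_mult n ?F Y.b))"
    by (simp add: Y.c_def ga_mult_assoc Y.B.e_e_mult flip: ga_mult_qscale_right)
  then have 1: "of_nat (card (col_group \<mu>)) * ga_mult n Y.c ?F id =
      ga_mult n Y.a (ga_mult n Y.b (ga_mult n ?F Y.b)) id"
    by (metis qscale_apply)
  have "ga_mult n Y.a (ga_mult n Y.b (ga_mult n ?F Y.b)) id = ga_mult n ?y ?F id"
    using ga_mult_at_id_commute[of n "ga_mult n (ga_mult n Y.a Y.b) ?F" Y.b] by (simp add: ga_mult_assoc)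
  also have "\<dots> = (\<Sum>w\<in>words n ?b. ga_mult n ?y (stab_elem n w) id)" by (rule ga_mult_fix_elem)
  also have "\<dots> > 0"
  proof (rule sum_pos2[of _ "row_word \<mu>"])
    show "row_word \<mu> \<in> words n ?b" unfolding n by (rule row_word_in_words)
    have "stab n (row_word \<mu>) = row_group \<mu>" by (simp add: row_group_eq_stab n)
    then show "0 < ga_mult n ?y (stab_elem n (row_word \<mu>)) id" using Y.baba_pos by simp
    show "0 \<le> ga_mult n ?y (stab_elem n w) id" for w
      by (rule Y.babe_nonneg[OF signed_subgroup_stab])
  qed simp
  finally have "ga_mult n Y.c ?F id \<noteq> 0" using 1 by auto
  then show ?thesis
    unfolding sum_young_class_fixw[OF p] young_symmetrizer_eq[OF p] by simp
qed

text \<open>Moving g past the row group of \<nu> conjugates it into the stabilizer of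
  \<open>row_word \<nu> \<circ> inv g\<close>. This word has content \<nu>, so it cannot be
  column-distinct for \<mu>.\<close>

lemma column_sign_elem_row:
  assumes p: "is_partition n \<mu>" and q: "is_partition n \<nu>" and g: "g \<in> Sym n"
    and d: "\<not> dom_le \<nu> \<mu>"
  shows "ga_mult n (signed_subgroup.e (col_group \<mu>) (\<lambda>q. of_int (sign q)))
    (ga_mult n (ga_elem g) (signed_subgroup.e (row_group \<nu>) (\<lambda>_. 1))) = 0"
proof -
  interpret Y: young_pair n "row_group \<nu>" "col_group \<nu>" "\<lambda>q. of_int (sign q)"
    by (rule young_pair_partition[OF q])
  have n: "n = sum_list \<nu>" using q by (simp add: is_partition_def)
  let ?w = "row_word \<nu> \<circ> inv g"
  have "?w \<in> words n (ipart \<nu>)"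
    using words_comp[OF row_word_in_words, of "inv g" \<nu>] Sym_inv[OF g] by (simp add: n)
  then have 0: "ga_mult n (signed_subgroup.e (col_group \<mu>) (\<lambda>q. of_int (sign q))) (stab_elem n ?w) = 0"
    using column_distinct_dominated[OF p] d column_sign_stab_elem[OF p] by blast
  have "ga_mult n (ga_elem g) Y.a = ga_mult n (stab_elem n ?w) (ga_elem g)"
  proof (rule group_algebra_eqI[of _ n])
    show "ga_mult n (ga_elem g) Y.a \<in> group_algebra n" by auto
    show "ga_mult n (stab_elem n ?w) (ga_elem g) \<in> group_algebra n" using ga_elem_in[OF g] by auto
    fix \<sigma> assume s: "\<sigma> \<in> Sym n"
    have e_in: "stab_elem n ?w \<in> group_algebra n" by (rule group_algebraI) (simp add: stab_elem_apply)
    have "row_word \<nu> \<circ> (inv g \<circ> \<sigma>) = row_word \<nu> \<longleftrightarrow> ?w \<circ> (\<sigma> \<circ> inv g) = ?w"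
      using comp_Sym_eq_iff[OF g, of "?w \<circ> \<sigma> \<circ> inv g" "?w \<circ> \<sigma>"]
        comp_Sym_eq_iff[OF g, of "?w \<circ> (\<sigma> \<circ> inv g)" "row_word \<nu>"]
        Sym_cancel(4)[OF g, of "?w \<circ> \<sigma>"]
      by (simp add: o_assoc)
    moreover have "inv g \<circ> \<sigma> \<in> Sym n" "\<sigma> \<circ> inv g \<in> Sym n"
      using Sym_comp[OF s Sym_inv[OF g]] Sym_comp[OF Sym_inv[OF g] s] by auto
    ultimately show "ga_mult n (ga_elem g) Y.a \<sigma> = ga_mult n (stab_elem n ?w) (ga_elem g) \<sigma>"
      unfolding ga_mult_elem_left[OF g] ga_mult_elem_right[OF g e_in] stab_elem_apply Y.A.e_def
      by (auto simp: row_group_eq n[symmetric])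
  qed
  then show ?thesis by (simp add: ga_mult_assoc[symmetric] 0)
qed

text \<open>By antisymmetry, dominance fails in one direction. The product of c_\<mu> with a
  conjugate of c_\<nu> contains b_\<mu> g a_\<nu> and, after cyclic rotation, b_\<nu>
  \<open>inv g\<close> a_\<mu>; one of the two is zero.\<close>

lemma young_class_orth:
  assumes p: "is_partition n \<mu>" and q: "is_partition n \<nu>" and ne: "\<mu> \<noteq> \<nu>"
  shows "(\<Sum>\<sigma>\<in>Sym n. young_class \<mu> \<sigma> * young_class \<nu> \<sigma>) = 0"
proof -
  interpret Y: young_pair n "row_group \<mu>" "col_group \<mu>" "\<lambda>q. of_int (sign q)"
    by (rule young_pair_partition[OF p])
  interpret Z: young_pair n "row_group \<nu>" "col_group \<nu>" "\<lambda>q. of_int (sign q)"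
    by (rule young_pair_partition[OF q])
  have n: "n = sum_list \<nu>" using q by (simp add: is_partition_def)
  have nd: "\<not> dom_le \<nu> \<mu> \<or> \<not> dom_le \<mu> \<nu>"
    using dom_le_antisym[OF p q] ne by blast
  have term0: "ga_mult n Y.c (ga_mult n (ga_elem g) (ga_mult n Z.c (ga_elem (inv g)))) id = 0" if g: "g \<in> Sym n" for g
  proof (cases "dom_le \<nu> \<mu>")
    case False
    have "ga_mult n Y.b (ga_mult n (ga_elem g) (ga_mult n Z.a x)) = 0" for x
      using column_sign_elem_row[OF p q g False] by (simp add: ga_mult_assoc[symmetric])
    then show ?thesis by (simp add: Y.c_def Z.c_def ga_mult_assoc)
  next
    case True
    then have d: "\<not> dom_le \<mu> \<nu>" using nd by blast
    have "ga_mult n Z.b (ga_mult n (ga_elem (inv g)) (ga_mult n Y.a x)) = 0" for x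
      using column_sign_elem_row[OF q p Sym_inv[OF g] d] by (simp add: ga_mult_assoc[symmetric])
    then have "ga_mult n (ga_mult n (ga_elem g) (ga_mult n Z.c (ga_elem (inv g)))) Y.c = 0"
      by (simp add: Y.c_def Z.c_def ga_mult_assoc)
    then show ?thesis using ga_mult_at_id_commute[of n Y.c] by simp
  qed
  have expand: "young_class \<nu> (inv \<sigma>) = (\<Sum>h\<in>Sym n. ga_mult n (ga_elem (inv h)) (ga_mult n Z.c (ga_elem h)) (inv \<sigma>))"
    if s: "\<sigma> \<in> Sym n" for \<sigma>
  proof -
    have "young_class \<nu> (inv \<sigma>) = (\<Sum>h\<in>Sym n. Z.c (h \<circ> inv \<sigma> \<circ> inv h))"
      using Sym_inv[OF s] by (simp add: young_class_def class_sum_def n[symmetric] young_symmetrizer_eq[OF q])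
    also have "\<dots> = (\<Sum>h\<in>Sym n. ga_mult n (ga_elem (inv h)) (ga_mult n Z.c (ga_elem h)) (inv \<sigma>))"
      by (intro sum.cong refl)
        (simp add: ga_mult_elem_left[OF Sym_inv] ga_mult_elem_right Sym_inv_inv del: mem_Collect_eq)
    finally show ?thesis .
  qed
  have "(\<Sum>\<sigma>\<in>Sym n. young_class \<mu> \<sigma> * young_class \<nu> \<sigma>) =
      fact n * (\<Sum>\<sigma>\<in>Sym n. Y.c \<sigma> * young_class \<nu> (inv \<sigma>))"
    using sum_young_class_mult[OF p young_class_conj[OF q]]
    by (simp add: young_symmetrizer_eq[OF p] young_class_inv[OF q])
  also have "(\<Sum>\<sigma>\<in>Sym n. Y.c \<sigma> * young_class \<nu> (inv \<sigma>)) =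
      (\<Sum>\<sigma>\<in>Sym n. \<Sum>h\<in>Sym n. Y.c \<sigma> * ga_mult n (ga_elem (inv h)) (ga_mult n Z.c (ga_elem h)) (inv \<sigma>))"
    by (intro sum.cong refl) (simp add: expand sum_distrib_left del: mem_Collect_eq)
  also have "\<dots> = (\<Sum>h\<in>Sym n. ga_mult n Y.c (ga_mult n (ga_elem (inv h)) (ga_mult n Z.c (ga_elem h))) id)"
    unfolding ga_mult_at_id by (rule sum.swap)
  also have "\<dots> = (\<Sum>h\<in>Sym n. 0)"
  proof (rule sum.cong[OF refl])
    fix h assume h: "h \<in> Sym n"
    show "ga_mult n Y.c (ga_mult n (ga_elem (inv h)) (ga_mult n Z.c (ga_elem h))) id = 0"
      using term0[OF Sym_inv[OF h]] Sym_inv_inv[OF h] by simp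
  qed
  finally show ?thesis by simp
qed

lemma specht_character_eq:
  assumes p: "is_partition n \<mu>"
  shows "\<exists>d. d \<noteq> 0 \<and> (\<forall>\<sigma>\<in>Sym n. specht_character \<mu> \<sigma> = d * young_class \<mu> \<sigma>)"
proof -
  interpret Y: young_pair n "row_group \<mu>" "col_group \<mu>" "\<lambda>q. of_int (sign q)"
    by (rule young_pair_partition[OF p])
  have n: "n = sum_list \<mu>" using p by (simp add: is_partition_def)
  have V: "specht_module \<mu> = (\<lambda>x. ga_mult n x Y.c) ` group_algebra n"
    by (simp add: specht_module_def n[symmetric] young_symmetrizer_eq[OF p])
  \<comment> \<open>\<open>ga_mult\<close> reads its first argument only on \<open>Sym n\<close>, so
    restriction to \<open>Sym n\<close> shows that even an arbitrary function times
    \<open>Y.c\<close> lies in the module, as the projection in \<open>trace_on_eq\<close>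
    requires.\<close>
  define r where "r x = (\<lambda>\<sigma>. if \<sigma> \<in> Sym n then x \<sigma> else 0)" for x :: "(nat \<Rightarrow> nat) \<Rightarrow> rat"
  have r: "r x \<in> group_algebra n" "ga_mult n x y = ga_mult n (r x) y" for x y
    by (auto simp: r_def group_algebra_def ga_mult_def fun_eq_iff intro!: sum.cong)
  have VI: "ga_mult n x Y.c \<in> specht_module \<mu>" for x
    unfolding V r(2)[of x] using r(1) by blast
  \<comment> \<open>Since \<open>Y.c\<close> squares to \<open>Y.m\<close> times itself, this is a
    projection onto the left ideal.\<close>
  define P where "P x = qscale (1 / Y.m) (ga_mult n x Y.c)" for x
  have "specht_character \<mu> \<sigma> = (1 / Y.m) * young_class \<mu> \<sigma>" if s: "\<sigma> \<in> Sym n" for \<sigma>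
  proof -
    define T where "T = ga_mult n (ga_elem \<sigma>)"
    have "specht_character \<mu> \<sigma> = trace_on (specht_module \<mu>) T"
      by (simp add: specht_character_def T_def n)
    also have "\<dots> = (\<Sum>s\<in>Sym n. T (P (\<lambda>x. if x = s then 1 else 0)) s)"
    proof (rule trace_on_eq)
      show "qvec.subspace (specht_module \<mu>)"
        unfolding qvec.subspace_def
      proof (intro conjI ballI allI)
        show "0 \<in> specht_module \<mu>" using VI[of 0] by simp
        fix x y c assume "x \<in> specht_module \<mu>"
        then obtain x' where x: "x = ga_mult n x' Y.c" by (auto simp: V)
        show "qscale c x \<in> specht_module \<mu>" using VI[of "qscale c x'"] x by simp
        assume "y \<in> specht_module \<mu>"
        then obtain y' where y: "y = ga_mult n y' Y.c" by (auto simp: V)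
        show "x + y \<in> specht_module \<mu>" using VI[of "x' + y'"] x y by (simp add: ga_mult_add_left)
      qed
      show "v x = 0" if "v \<in> specht_module \<mu>" "x \<notin> Sym n" for v x
        using that group_algebraD[OF ga_mult_in[OF Y.c_in]] by (auto simp: V)
      show "module_hom qscale qscale P"
        by unfold_locales (simp_all add: P_def ga_mult_add_left qvec.scale_right_distrib qvec.scale_left_commute)
      show "P x \<in> specht_module \<mu>" for x
        using VI[of "qscale (1 / Y.m) x"] by (simp add: P_def)
      show "P v = v" if "v \<in> specht_module \<mu>" for v
        using that Y.m_nonzero by (auto simp: V P_def ga_mult_assoc Y.c_c)
      show "module_hom qscale qscale T"
        by unfold_locales (simp_all add: T_def ga_mult_add_right)
      show "T v \<in> specht_module \<mu>" if "v \<in> specht_module \<mu>" for v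
        using that VI by (auto simp: V T_def ga_mult_assoc[symmetric])
    qed simp
    also have "\<dots> = (\<Sum>s\<in>Sym n. (1 / Y.m) * Y.c (inv s \<circ> inv \<sigma> \<circ> inv (inv s)))"
    proof (rule sum.cong[OF refl])
      fix t assume t: "t \<in> Sym n"
      have "T (P (\<lambda>x. if x = t then 1 else 0)) = T (P (ga_elem t))" by (simp add: ga_elem_def)
      also have "\<dots> = qscale (1 / Y.m) (ga_mult n (ga_elem (\<sigma> \<circ> t)) Y.c)"
        unfolding T_def P_def ga_mult_qscale_right ga_mult_assoc[symmetric] ga_elem_mult[OF s t] ..
      finally have "T (P (\<lambda>x. if x = t then 1 else 0)) t = (1 / Y.m) * Y.c (inv (\<sigma> \<circ> t) \<circ> t)"
        using ga_mult_elem_left[OF Sym_comp[OF s t]] by (simp add: qscale_apply)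
      then show "T (P (\<lambda>x. if x = t then 1 else 0)) t = (1 / Y.m) * Y.c (inv t \<circ> inv \<sigma> \<circ> inv (inv t))"
        by (simp only: Sym_inv_of_comp[OF s t] Sym_inv_inv[OF t])
    qed
    also have "\<dots> = (\<Sum>s\<in>Sym n. (1 / Y.m) * Y.c (s \<circ> inv \<sigma> \<circ> inv s))" by (rule sum_Sym_inv)
    also have "\<dots> = (1 / Y.m) * young_class \<mu> (inv \<sigma>)"
      using Sym_inv[OF s]
      by (simp add: young_class_def class_sum_def n[symmetric] young_symmetrizer_eq[OF p] sum_distrib_left)
    finally show ?thesis by (simp add: young_class_inv[OF p s])
  qed
  then show ?thesis using Y.m_nonzero by (intro exI[of _ "1 / Y.m"]) simp
qed

section \<open>The Jacobi-Trudi class function\<close>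

definition comps :: "nat \<Rightarrow> nat \<Rightarrow> (nat \<Rightarrow> nat) set" where
  "comps l a = {\<eta>. (\<forall>i\<ge>l. \<eta> i = 0) \<and> (\<Sum>i<l. \<eta> i) = a}"

text \<open>Row sums are prescribed as integers, so that a negative entry of \<beta> leaves no
  matrices. The matrices index the orbits on pairs of words with contents \<beta> and
  \<alpha>.\<close>

definition mats :: "nat \<Rightarrow> nat \<Rightarrow> (nat \<Rightarrow> int) \<Rightarrow> (nat \<Rightarrow> nat) \<Rightarrow> (nat \<Rightarrow> nat \<Rightarrow> nat) set" where
  "mats l r \<beta> \<alpha> = {K. (\<forall>i j. \<not> (i < l \<and> j < r) \<longrightarrow> K i j = 0) \<and>
     (\<forall>i<l. int (\<Sum>j<r. K i j) = \<beta> i) \<and> (\<forall>j<r. (\<Sum>i<l. K i j) = \<alpha> j)}"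

lemma finite_comps [simp]: "finite (comps l a)"
proof (rule finite_subset)
  show "comps l a \<subseteq> {\<eta>. \<forall>i. (i \<in> {..<l} \<longrightarrow> \<eta> i \<in> {..a}) \<and> (i \<notin> {..<l} \<longrightarrow> \<eta> i = 0)}"
  proof
    fix \<eta> assume e: "\<eta> \<in> comps l a"
    have "\<eta> i \<le> a" if "i < l" for i
      using e member_le_sum[of i "{..<l}" \<eta>] that by (simp add: comps_def)
    then show "\<eta> \<in> {\<eta>. \<forall>i. (i \<in> {..<l} \<longrightarrow> \<eta> i \<in> {..a}) \<and> (i \<notin> {..<l} \<longrightarrow> \<eta> i = 0)}"
      using e by (auto simp: comps_def)
  qed
qed (intro finite_set_of_finite_funs, auto)

lemma mats_0: "mats l 0 \<beta> \<alpha> = (if \<forall>i<l. \<beta> i = 0 then {\<lambda>_ _. 0} else {})"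
  by (auto simp: mats_def fun_eq_iff)

lemma mats_Suc:
  "mats l (Suc r) \<beta> \<alpha> = (\<Union>\<eta>\<in>comps l (\<alpha> r).
     (\<lambda>K i j. if j = r then \<eta> i else K i j) ` mats l r (\<lambda>i. \<beta> i - int (\<eta> i)) \<alpha>)"
  (is "?L = (\<Union>\<eta>\<in>_. ?f \<eta> ` ?M \<eta>)")
proof (intro equalityI subsetI)
  fix K assume K: "K \<in> ?L"
  define \<eta> where "\<eta> = (\<lambda>i. K i r)"
  define K' where "K' = (\<lambda>i j. if j = r then 0 else K i j)"
  have "\<eta> \<in> comps l (\<alpha> r)" using K by (auto simp: mats_def comps_def \<eta>_def)
  moreover have "K' \<in> ?M \<eta>"
  proof -
    have "(\<Sum>j<r. K' i j) = (\<Sum>j<r. K i j)" for i by (rule sum.cong) (auto simp: K'_def)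
    moreover have "(\<Sum>i<l. K' i j) = (\<Sum>i<l. K i j)" if "j < r" for j
      using that by (intro sum.cong) (auto simp: K'_def)
    moreover have "K' i j = 0" if "\<not> (i < l \<and> j < r)" for i j
      using K that by (cases "j = r") (auto simp: K'_def mats_def)
    ultimately show ?thesis using K by (auto simp: mats_def \<eta>_def simp del: of_nat_sum)
  qed
  moreover have "K = ?f \<eta> K'" by (auto simp: \<eta>_def K'_def fun_eq_iff)
  ultimately show "K \<in> (\<Union>\<eta>\<in>comps l (\<alpha> r). ?f \<eta> ` ?M \<eta>)" by blast
next
  fix K assume "K \<in> (\<Union>\<eta>\<in>comps l (\<alpha> r). ?f \<eta> ` ?M \<eta>)"
  then obtain \<eta> K' where e: "\<eta> \<in> comps l (\<alpha> r)" and K': "K' \<in> ?M \<eta>" and K: "K = ?f \<eta> K'" by blast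
  have "(\<Sum>j<r. K i j) = (\<Sum>j<r. K' i j)" for i by (rule sum.cong) (auto simp: K)
  moreover have "(\<Sum>i<l. K i j) = (\<Sum>i<l. K' i j)" if "j < r" for j
    using that by (intro sum.cong) (auto simp: K)
  moreover have "(\<Sum>i<l. K i r) = \<alpha> r" using e by (simp add: K comps_def)
  moreover have "K i j = 0" if "\<not> (i < l \<and> j < Suc r)" for i j
    using that e K' by (cases "j = r") (auto simp: K comps_def mats_def)
  ultimately show "K \<in> ?L" using K' by (auto simp: mats_def less_Suc_eq K)
qed

lemma finite_mats [simp]: "finite (mats l r \<beta> \<alpha>)"
  by (induction r arbitrary: \<beta>) (auto simp: mats_0 mats_Suc)

lemma card_mats_Suc:
  "card (mats l (Suc r) \<beta> \<alpha>) = (\<Sum>\<eta>\<in>comps l (\<alpha> r). card (mats l r (\<lambda>i. \<beta> i - int (\<eta> i)) \<alpha>))"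
proof -
  let ?f = "\<lambda>\<eta> K i j. if j = r then \<eta> i else K i j :: nat"
  let ?M = "\<lambda>\<eta>. mats l r (\<lambda>i. \<beta> i - int (\<eta> i)) \<alpha>"
  have inj: "inj_on (?f \<eta>) (?M \<eta>)" for \<eta>
  proof (rule inj_onI)
    fix K K' assume K: "K \<in> ?M \<eta>" "K' \<in> ?M \<eta>" and eq: "?f \<eta> K = ?f \<eta> K'"
    show "K = K'"
    proof (intro ext)
      fix i j
      show "K i j = K' i j"
        using K fun_cong[OF fun_cong[OF eq, of i], of j] by (cases "j = r") (auto simp: mats_def)
    qed
  qed
  have "card (mats l (Suc r) \<beta> \<alpha>) = (\<Sum>\<eta>\<in>comps l (\<alpha> r). card (?f \<eta> ` ?M \<eta>))"
    unfolding mats_Suc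
  proof (rule card_UN_disjoint)
    show "\<forall>\<eta>\<in>comps l (\<alpha> r). \<forall>\<eta>'\<in>comps l (\<alpha> r). \<eta> \<noteq> \<eta>' \<longrightarrow> ?f \<eta> ` ?M \<eta> \<inter> ?f \<eta>' ` ?M \<eta>' = {}"
    proof (intro ballI impI)
      fix \<eta> \<eta>' :: "nat \<Rightarrow> nat" assume ne: "\<eta> \<noteq> \<eta>'"
      have "\<eta> i = \<eta>' i" if "?f \<eta> K = ?f \<eta>' K'" for K K' i
        using fun_cong[OF fun_cong[OF that, of i], of r] by simp
      then show "?f \<eta> ` ?M \<eta> \<inter> ?f \<eta>' ` ?M \<eta>' = {}" using ne by blast
    qed
  qed auto
  then show ?thesis by (simp add: card_image[OF inj])
qed

lemma word_with_content:
  fixes K :: "'c \<Rightarrow> nat"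
  assumes fin: "finite A" and 0: "\<And>x. x \<notin> A \<Longrightarrow> K x = 0" and n: "(\<Sum>x\<in>A. K x) = n"
  shows "\<exists>v. (\<forall>m\<ge>n. v m = d) \<and> (\<forall>x. card {m. m < n \<and> v m = x} = K x)"
proof -
  define M where "M = (\<Sum>x\<in>A. replicate_mset (K x) x)"
  have count: "count M x = K x" for x
  proof -
    have "count M x = (\<Sum>y\<in>A. if x = y then K y else 0)"
      unfolding M_def count_sum by (intro sum.cong) auto
    then show ?thesis using fin 0[of x] by (simp add: sum.delta')
  qed
  obtain xs where xs: "mset xs = M" using ex_mset by blast
  have len: "length xs = n" using arg_cong[OF xs, of size] n by (simp add: M_def)
  have "card {m. m < n \<and> (if m < n then xs ! m else d) = x} = K x" for x
  proof -
    have "{m. m < n \<and> (if m < n then xs ! m else d) = x} = {m. m < length xs \<and> x = xs ! m}"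
      using len by auto
    also have "card \<dots> = count (mset xs) x"
      by (simp add: count_mset length_filter_conv_card count_list_eq_length_filter)
    finally show ?thesis using xs count by simp
  qed
  then show ?thesis by (intro exI[of _ "\<lambda>m. if m < n then xs ! m else d"]) simp
qed

text \<open>A pair of words is one word whose letters are pairs. K records how often each pair
  occurs, and for fixed K these words form a single orbit.\<close>

definition pair_words :: "nat \<Rightarrow> (nat \<Rightarrow> nat \<Rightarrow> nat) \<Rightarrow> (nat \<Rightarrow> nat \<times> nat) set" where
  "pair_words n K = {v. (\<forall>m\<ge>n. v m = (0, 0)) \<and> (\<forall>i j. card {m. m < n \<and> v m = (i, j)} = K i j)}"

lemma sum_fixed_pair_words:
  assumes 0: "\<And>i j. \<not> (i < l \<and> j < r) \<Longrightarrow> K i j = 0" and n: "(\<Sum>i<l. \<Sum>j<r. K i j) = n"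
  shows "(\<Sum>\<sigma>\<in>Sym n. card {v \<in> pair_words n K. v \<circ> \<sigma> = v}) = fact n"
proof -
  have "(\<Sum>x\<in>{..<l} \<times> {..<r}. case_prod K x) = n"
    using n by (simp add: sum.cartesian_product)
  then obtain v0 where v0: "\<forall>m\<ge>n. v0 m = (0, 0)" "\<forall>x. card {m. m < n \<and> v0 m = x} = case_prod K x"
    using word_with_content[of "{..<l} \<times> {..<r}" "case_prod K" n "(0, 0)"] 0 by auto
  have "pair_words n K = (\<lambda>g. v0 \<circ> g) ` Sym n"
  proof (intro equalityI subsetI)
    fix v assume v: "v \<in> pair_words n K"
    have "\<exists>g\<in>Sym n. v = v0 \<circ> g"
      by (rule fibers_eq_imp_comp) (use v v0 in \<open>auto simp: pair_words_def\<close>)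
    then show "v \<in> (\<lambda>g. v0 \<circ> g) ` Sym n" by auto
  next
    fix v assume "v \<in> (\<lambda>g. v0 \<circ> g) ` Sym n"
    then obtain g where g: "g \<in> Sym n" "v = v0 \<circ> g" by blast
    then show "v \<in> pair_words n K"
      using v0 card_fiber_comp[OF g(1), of v0] Sym_ge[OF g(1)] by (simp add: pair_words_def)
  qed
  then show ?thesis using sum_fixed_points_orbit[of v0 n] by simp
qed

lemma card_eq_sum_fibers:
  assumes "finite A" "finite B" "\<And>x. x \<in> A \<Longrightarrow> f x \<in> B"
  shows "card A = (\<Sum>y\<in>B. card {x \<in> A. f x = y})"
proof -
  have "A = (\<Union>y\<in>B. {x \<in> A. f x = y})" using assms by auto
  then have "card A = card (\<Union>y\<in>B. {x \<in> A. f x = y})" by simp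
  also have "\<dots> = (\<Sum>y\<in>B. card {x \<in> A. f x = y})"
    by (rule card_UN_disjoint) (use assms in auto)
  finally show ?thesis .
qed

text \<open>The inner product of two permutation characters counts orbits on pairs of words. An
  orbit is determined by its matrix of joint multiplicities, and by Burnside each orbit contributes
  n!.\<close>

lemma sum_fixw_fixw:
  assumes b0: "\<And>i. l \<le> i \<Longrightarrow> \<beta> i = 0" and a0: "\<And>j. r \<le> j \<Longrightarrow> \<alpha> j = 0" and n: "(\<Sum>j<r. \<alpha> j) = n"
  shows "(\<Sum>\<sigma>\<in>Sym n. fixw n \<beta> \<sigma> * fixw n (\<lambda>j. int (\<alpha> j)) \<sigma>) = fact n * of_nat (card (mats l r \<beta> \<alpha>))"
proof -
  let ?V = "\<lambda>K \<sigma>. {v \<in> pair_words n K. v \<circ> \<sigma> = v}"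
  let ?U = "\<lambda>\<beta> \<sigma>. {u \<in> words n \<beta>. u \<circ> \<sigma> = u}"
  let ?a = "\<lambda>j. int (\<alpha> j)"
  have content: "(\<lambda>i j. card {m. m < n \<and> u m = i \<and> w m = j}) \<in> mats l r \<beta> \<alpha>"
    (is "?K \<in> _") if u: "u \<in> words n \<beta>" and w: "w \<in> words n ?a" for u w
  proof -
    have cu: "int (card {m. m < n \<and> u m = i}) = \<beta> i" and cw: "card {m. m < n \<and> w m = j} = \<alpha> j" for i j
      using u w by (auto simp: words_def)
    have ul: "u m < l" if "m < n" for m
    proof (rule ccontr)
      assume "\<not> u m < l"
      then have "card {m'. m' < n \<and> u m' = u m} = 0" using cu[of "u m"] b0[of "u m"] by simp
      then show False using that by auto
    qed
    have wr: "w m < r" if "m < n" for m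
    proof (rule ccontr)
      assume "\<not> w m < r"
      then have "card {m'. m' < n \<and> w m' = w m} = 0" using cw[of "w m"] a0[of "w m"] by simp
      then show False using that by auto
    qed
    have "(\<Sum>j<r. ?K i j) = card {m. m < n \<and> u m = i}" for i
      using card_eq_sum_fibers[of "{m. m < n \<and> u m = i}" "{..<r}" w] wr by (simp add: conj_assoc)
    moreover have "(\<Sum>i<l. ?K i j) = card {m. m < n \<and> w m = j}" for j
    proof -
      have "{x. x < n \<and> u x = i \<and> w x = j} = {x. (x < n \<and> w x = j) \<and> u x = i}" for i by auto
      then show ?thesis
        using card_eq_sum_fibers[of "{m. m < n \<and> w m = j}" "{..<l}" u] ul by simp
    qed
    moreover have "?K i j = 0" if "\<not> (i < l \<and> j < r)" for i j
    proof -
      have "{m. m < n \<and> u m = i \<and> w m = j} = {}" using ul wr that by auto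
      then show ?thesis by (simp only: card.empty)
    qed
    ultimately show ?thesis using cu cw by (simp add: mats_def del: of_nat_sum)
  qed
  have unpair: "fst \<circ> v \<in> words n \<beta> \<and> snd \<circ> v \<in> words n ?a" if K: "K \<in> mats l r \<beta> \<alpha>" and v: "v \<in> pair_words n K" for K v
  proof -
    have cv: "card {m. m < n \<and> v m = (i, j)} = K i j" for i j using v by (simp add: pair_words_def)
    have vlr: "fst (v m) < l \<and> snd (v m) < r" if "m < n" for m
    proof (rule ccontr)
      assume "\<not> ?thesis"
      then have "card {m'. m' < n \<and> v m' = (fst (v m), snd (v m))} = 0"
        unfolding cv using K unfolding mats_def by blast
      then show False using that by auto
    qed
    have 1: "card {m. m < n \<and> fst (v m) = i} = (\<Sum>j<r. K i j)" for i
    proof -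
      have "{x. x < n \<and> v x = (i, j)} = {x. (x < n \<and> fst (v x) = i) \<and> snd (v x) = j}" for j by auto
      then show ?thesis
        using card_eq_sum_fibers[of "{m. m < n \<and> fst (v m) = i}" "{..<r}" "\<lambda>m. snd (v m)"] vlr cv[of i] by simp
    qed
    have 2: "card {m. m < n \<and> snd (v m) = j} = (\<Sum>i<l. K i j)" for j
    proof -
      have "{x. x < n \<and> v x = (i, j)} = {x. (x < n \<and> snd (v x) = j) \<and> fst (v x) = i}" for i by auto
      then show ?thesis
        using card_eq_sum_fibers[of "{m. m < n \<and> snd (v m) = j}" "{..<l}" "\<lambda>m. fst (v m)"] vlr cv[of _ j] by simp
    qed
    have "int (\<Sum>j<r. K i j) = \<beta> i" for i
      using K b0[of i] by (cases "i < l") (auto simp: mats_def)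
    moreover have "(\<Sum>i<l. K i j) = \<alpha> j" for j
      using K a0[of j] by (cases "j < r") (auto simp: mats_def)
    ultimately show ?thesis using 1 2 v by (simp add: words_def pair_words_def)
  qed
  have key: "card (?U \<beta> \<sigma>) * card (?U ?a \<sigma>) = (\<Sum>K\<in>mats l r \<beta> \<alpha>. card (?V K \<sigma>))" for \<sigma>
  proof -
    let ?p = "\<lambda>(u, w) m. (u m :: nat, w m :: nat)"
    have inj: "inj_on ?p (?U \<beta> \<sigma> \<times> ?U ?a \<sigma>)"
      by (rule inj_onI) (auto simp: fun_eq_iff)
    have img: "?p ` (?U \<beta> \<sigma> \<times> ?U ?a \<sigma>) = (\<Union>K\<in>mats l r \<beta> \<alpha>. ?V K \<sigma>)"
    proof (intro equalityI subsetI)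
      fix v assume "v \<in> ?p ` (?U \<beta> \<sigma> \<times> ?U ?a \<sigma>)"
      then obtain u w where uw: "u \<in> words n \<beta>" "u \<circ> \<sigma> = u" "w \<in> words n ?a" "w \<circ> \<sigma> = w"
        "v = (\<lambda>m. (u m, w m))" by auto
      have "v \<circ> \<sigma> = v" using fun_cong[OF uw(2)] fun_cong[OF uw(4)] by (auto simp: uw(5))
      moreover have "v \<in> pair_words n (\<lambda>i j. card {m. m < n \<and> u m = i \<and> w m = j})"
        using uw(1,3) by (auto simp: pair_words_def uw(5) words_def)
      ultimately show "v \<in> (\<Union>K\<in>mats l r \<beta> \<alpha>. ?V K \<sigma>)" using content[OF uw(1,3)] by blast
    next
      fix v assume "v \<in> (\<Union>K\<in>mats l r \<beta> \<alpha>. ?V K \<sigma>)"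
      then obtain K where K: "K \<in> mats l r \<beta> \<alpha>" "v \<in> pair_words n K" "v \<circ> \<sigma> = v" by blast
      have "v = ?p (fst \<circ> v, snd \<circ> v)" by (simp add: fun_eq_iff)
      moreover have "fst \<circ> v \<in> ?U \<beta> \<sigma>" "snd \<circ> v \<in> ?U ?a \<sigma>"
        using unpair[OF K(1,2)] K(3) by (auto simp: comp_assoc)
      ultimately show "v \<in> ?p ` (?U \<beta> \<sigma> \<times> ?U ?a \<sigma>)" by blast
    qed
    have fin: "finite (\<Union>K\<in>mats l r \<beta> \<alpha>. ?V K \<sigma>)" unfolding img[symmetric] by simp
    have "card (?U \<beta> \<sigma>) * card (?U ?a \<sigma>) = card (\<Union>K\<in>mats l r \<beta> \<alpha>. ?V K \<sigma>)"
      using card_image[OF inj] img by (simp add: card_cartesian_product)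
    also have "\<dots> = (\<Sum>K\<in>mats l r \<beta> \<alpha>. card (?V K \<sigma>))"
    proof (rule card_UN_disjoint)
      show "\<forall>K\<in>mats l r \<beta> \<alpha>. finite (?V K \<sigma>)" using finite_subset[OF _ fin] by blast
      have "K = K'" if "v \<in> pair_words n K" "v \<in> pair_words n K'" for K K' v
        using that by (auto simp: pair_words_def fun_eq_iff)
      then show "\<forall>K\<in>mats l r \<beta> \<alpha>. \<forall>K'\<in>mats l r \<beta> \<alpha>. K \<noteq> K' \<longrightarrow> ?V K \<sigma> \<inter> ?V K' \<sigma> = {}" by blast
    qed simp
    finally show ?thesis .
  qed
  have "(\<Sum>\<sigma>\<in>Sym n. card (?U \<beta> \<sigma>) * card (?U ?a \<sigma>)) = (\<Sum>K\<in>mats l r \<beta> \<alpha>. \<Sum>\<sigma>\<in>Sym n. card (?V K \<sigma>))"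
    unfolding key by (rule sum.swap)
  also have "\<dots> = (\<Sum>K\<in>mats l r \<beta> \<alpha>. fact n)"
  proof (rule sum.cong[OF refl])
    fix K assume K: "K \<in> mats l r \<beta> \<alpha>"
    have "(\<Sum>i<l. \<Sum>j<r. K i j) = (\<Sum>j<r. \<Sum>i<l. K i j)" by (rule sum.swap)
    also have "\<dots> = n" using K n by (simp add: mats_def)
    finally show "(\<Sum>\<sigma>\<in>Sym n. card (?V K \<sigma>)) = fact n"
      using K by (intro sum_fixed_pair_words[of l r K n]) (auto simp: mats_def)
  qed
  finally have "(\<Sum>\<sigma>\<in>Sym n. card (?U \<beta> \<sigma>) * card (?U ?a \<sigma>)) = card (mats l r \<beta> \<alpha>) * fact n" by simp
  from arg_cong[OF this, of "of_nat :: nat \<Rightarrow> rat"] show ?thesis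
    by (simp add: fixw_def mult.commute)
qed

text \<open>For \<open>x i\<close> = \<mu>_i - i this is the pairing of the Jacobi-Trudi sum with
  the content \<alpha>, divided by n!. The vector x is kept general because removing a column of the
  matrix changes it.\<close>

definition alt_mats :: "nat \<Rightarrow> (nat \<Rightarrow> nat) \<Rightarrow> nat \<Rightarrow> (nat \<Rightarrow> int) \<Rightarrow> int" where
  "alt_mats l \<alpha> r x = (\<Sum>\<pi>\<in>Sym l. sign \<pi> * int (card (mats l r (\<lambda>i. x i + int (\<pi> i)) \<alpha>)))"

lemma alt_mats_Suc: "alt_mats l \<alpha> (Suc r) x = (\<Sum>\<eta>\<in>comps l (\<alpha> r). alt_mats l \<alpha> r (\<lambda>i. x i - int (\<eta> i)))"
proof -
  have "alt_mats l \<alpha> (Suc r) x =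
    (\<Sum>\<pi>\<in>Sym l. \<Sum>\<eta>\<in>comps l (\<alpha> r). sign \<pi> * int (card (mats l r (\<lambda>i. x i + int (\<pi> i) - int (\<eta> i)) \<alpha>)))"
    by (simp add: alt_mats_def card_mats_Suc sum_distrib_left)
  also have "\<dots> = (\<Sum>\<eta>\<in>comps l (\<alpha> r). \<Sum>\<pi>\<in>Sym l. sign \<pi> * int (card (mats l r (\<lambda>i. x i + int (\<pi> i) - int (\<eta> i)) \<alpha>)))"
    by (rule sum.swap)
  also have "\<dots> = (\<Sum>\<eta>\<in>comps l (\<alpha> r). alt_mats l \<alpha> r (\<lambda>i. x i - int (\<eta> i)))"
    by (simp add: alt_mats_def algebra_simps)
  finally show ?thesis .
qed

lemma card_mats_permute:
  assumes t: "\<tau> \<in> Sym l"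
  shows "card (mats l r (\<lambda>i. \<beta> (\<tau> i)) \<alpha>) = card (mats l r \<beta> \<alpha>)"
proof -
  have le: "card (mats l r \<beta> \<alpha>) \<le> card (mats l r (\<lambda>i. \<beta> (\<tau> i)) \<alpha>)" if t: "\<tau> \<in> Sym l" for \<tau> \<beta>
  proof (rule card_inj_on_le[of "\<lambda>K i. K (\<tau> i)"])
    show "inj_on (\<lambda>K i. K (\<tau> i)) (mats l r \<beta> \<alpha>)"
    proof (rule inj_onI)
      fix K K' :: "nat \<Rightarrow> nat \<Rightarrow> nat" assume eq: "(\<lambda>i. K (\<tau> i)) = (\<lambda>i. K' (\<tau> i))"
      have "K i = K' i" for i
        using fun_cong[OF eq, of "inv \<tau> i"] t by (simp add: permutes_inverses)
      then show "K = K'" by (rule ext)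
    qed
    have tl: "\<tau> i < l \<longleftrightarrow> i < l" for i using Sym_less[OF t] .
    have "(\<Sum>i<l. K (\<tau> i) j) = (\<Sum>i<l. K i j)" for K :: "nat \<Rightarrow> nat \<Rightarrow> nat" and j
      by (rule sum.permute[symmetric, unfolded comp_def]) (use t in simp)
    then show "(\<lambda>K i. K (\<tau> i)) ` mats l r \<beta> \<alpha> \<subseteq> mats l r (\<lambda>i. \<beta> (\<tau> i)) \<alpha>"
      using tl by (auto simp: mats_def)
  qed simp
  have "card (mats l r (\<lambda>i. \<beta> (\<tau> i)) \<alpha>) \<le> card (mats l r (\<lambda>i. \<beta> (\<tau> (inv \<tau> i))) \<alpha>)"
    by (rule le[OF Sym_inv[OF t], of "\<lambda>i. \<beta> (\<tau> i)"])
  also have "(\<lambda>i. \<beta> (\<tau> (inv \<tau> i))) = \<beta>" using t by (simp add: permutes_inverses)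
  finally show ?thesis using le[OF t, of \<beta>] by simp
qed

text \<open>Exchanging two rows is a bijection of matrices, while composing with the transposition
  reverses the sign of \<pi>.\<close>

lemma alt_mats_swap:
  assumes "i < l" "j < l" "i \<noteq> j"
  shows "alt_mats l \<alpha> r (\<lambda>m. x (transpose i j m)) = - alt_mats l \<alpha> r x"
proof -
  let ?t = "transpose i j"
  have t: "?t \<in> Sym l" using assms by (simp add: permutes_swap_id)
  have "alt_mats l \<alpha> r (\<lambda>m. x (?t m)) =
    (\<Sum>\<pi>\<in>Sym l. sign (\<pi> \<circ> ?t) * int (card (mats l r (\<lambda>m. x (?t m) + int ((\<pi> \<circ> ?t) m)) \<alpha>)))"
    unfolding alt_mats_def by (rule sum_Sym_right[OF t, symmetric])
  also have "\<dots> = (\<Sum>\<pi>\<in>Sym l. - (sign \<pi> * int (card (mats l r (\<lambda>m. x m + int (\<pi> m)) \<alpha>))))"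
  proof (rule sum.cong[OF refl])
    fix \<pi> assume p: "\<pi> \<in> Sym l"
    have "permutation \<pi>" using p permutes_imp_permutation[of "{..<l}"] by auto
    then have "sign (\<pi> \<circ> ?t) = - sign \<pi>"
      using sign_compose[OF _ permutation_swap_id[of i j]] assms(3) by (simp add: sign_swap_id)
    moreover have "card (mats l r (\<lambda>m. x (?t m) + int ((\<pi> \<circ> ?t) m)) \<alpha>) = card (mats l r (\<lambda>m. x m + int (\<pi> m)) \<alpha>)"
      using card_mats_permute[OF t, of r "\<lambda>m. x m + int (\<pi> m)" \<alpha>] by simp
    ultimately show "sign (\<pi> \<circ> ?t) * int (card (mats l r (\<lambda>m. x (?t m) + int ((\<pi> \<circ> ?t) m)) \<alpha>)) =
        - (sign \<pi> * int (card (mats l r (\<lambda>m. x m + int (\<pi> m)) \<alpha>)))" by simp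
  qed
  finally show ?thesis by (simp add: alt_mats_def sum_negf)
qed

definition strict_desc :: "nat \<Rightarrow> (nat \<Rightarrow> int) \<Rightarrow> bool" where
  "strict_desc l x \<longleftrightarrow> (\<forall>i. Suc i < l \<longrightarrow> x (Suc i) < x i)"

text \<open>The choices of \<open>\<eta>\<close> that do not form a horizontal strip cancel in pairs, by exchanging the entries
  \<open>i\<close> and \<open>i + 1\<close> of \<open>x - \<eta>\<close> at the first violation \<open>i\<close>.\<close>

lemma alt_mats_horizontal_strip:
  assumes x: "strict_desc l x" and nz: "alt_mats l \<alpha> (Suc r) x \<noteq> 0"
  shows "\<exists>\<eta>\<in>comps l (\<alpha> r). (\<forall>i. Suc i < l \<longrightarrow> x (Suc i) < x i - int (\<eta> i)) \<and>
    alt_mats l \<alpha> r (\<lambda>i. x i - int (\<eta> i)) \<noteq> 0"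
proof (rule ccontr)
  assume contra: "\<not> ?thesis"
  define D where "D \<eta> = alt_mats l \<alpha> r (\<lambda>i. x i - int (\<eta> i))" for \<eta>
  define bad where "bad \<eta> i \<longleftrightarrow> Suc i < l \<and> x i - int (\<eta> i) \<le> x (Suc i)" for \<eta> :: "nat \<Rightarrow> nat" and i
  define B where "B = {\<eta> \<in> comps l (\<alpha> r). \<exists>i. bad \<eta> i}"
  define first where "first \<eta> = (LEAST i. bad \<eta> i)" for \<eta>
  \<comment> \<open>The two new values are chosen so that \<open>x - \<phi> \<eta>\<close> arises
    from \<open>x - \<eta>\<close> by exchanging the entries at the first violation. Both are
    nonnegative because of the violation. Badness at an index depends on \<eta> at that index only,
    so the first violation stays in place and \<phi> is an involution.\<close>
  define \<phi> where "\<phi> \<eta> = \<eta>(first \<eta> := nat (x (first \<eta>) - x (Suc (first \<eta>))) + \<eta> (Suc (first \<eta>)),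
     Suc (first \<eta>) := nat (x (Suc (first \<eta>)) - x (first \<eta>) + int (\<eta> (first \<eta>))))" for \<eta> :: "nat \<Rightarrow> nat"
  have finB: "finite B" by (simp add: B_def)
  have ph: "\<phi> \<eta> \<in> B" "first (\<phi> \<eta>) = first \<eta>" "\<phi> (\<phi> \<eta>) = \<eta>" "D (\<phi> \<eta>) = - D \<eta>" if e: "\<eta> \<in> B" for \<eta>
  proof -
    define i where "i = first \<eta>"
    have b: "bad \<eta> i" unfolding i_def first_def using e by (auto simp: B_def intro: LeastI)
    have mn: "\<not> bad \<eta> j" if "j < i" for j using that not_less_Least unfolding i_def first_def by blast
    have il: "Suc i < l" "x i - int (\<eta> i) \<le> x (Suc i)" using b by (auto simp: bad_def)
    have xi: "x (Suc i) < x i" using x il by (simp add: strict_desc_def)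
    have v: "int (\<phi> \<eta> i) = x i - x (Suc i) + int (\<eta> (Suc i))"
      "int (\<phi> \<eta> (Suc i)) = x (Suc i) - x i + int (\<eta> i)"
      "\<And>j. j \<noteq> i \<Longrightarrow> j \<noteq> Suc i \<Longrightarrow> \<phi> \<eta> j = \<eta> j"
      using il xi by (auto simp: \<phi>_def i_def[symmetric])
    have split: "(\<Sum>j<l. int (f j)) = int (f i) + int (f (Suc i)) + (\<Sum>j\<in>{..<l} - {i, Suc i}. int (f j))" for f :: "nat \<Rightarrow> nat"
    proof -
      have "(\<Sum>j<l. int (f j)) = (\<Sum>j\<in>{i, Suc i}. int (f j)) + (\<Sum>j\<in>{..<l} - {i, Suc i}. int (f j))"
        using il by (subst sum.subset_diff[of "{i, Suc i}"]) auto
      then show ?thesis by simp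
    qed
    have "(\<Sum>j<l. int (\<phi> \<eta> j)) = (\<Sum>j<l. int (\<eta> j))"
      unfolding split using v by simp
    then have "(\<Sum>j<l. \<phi> \<eta> j) = (\<Sum>j<l. \<eta> j)" by (simp flip: of_nat_sum)
    moreover have "\<phi> \<eta> j = 0" if "l \<le> j" for j using that il v(3)[of j] e by (auto simp: B_def comps_def)
    ultimately have c: "\<phi> \<eta> \<in> comps l (\<alpha> r)" using e by (auto simp: B_def comps_def)
    have b': "bad (\<phi> \<eta>) i" using il v by (simp add: bad_def)
    have mn': "\<not> bad (\<phi> \<eta>) j" if "j < i" for j using mn[OF that] v(3)[of j] that by (simp add: bad_def)
    show f: "first (\<phi> \<eta>) = first \<eta>"
      unfolding first_def i_def[unfolded first_def, symmetric]
    proof (rule Least_equality)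
      show "bad (\<phi> \<eta>) i" by (rule b')
      show "i \<le> j" if "bad (\<phi> \<eta>) j" for j using mn' that not_le by blast
    qed
    show "\<phi> \<eta> \<in> B" using c b' by (auto simp: B_def)
    show "\<phi> (\<phi> \<eta>) = \<eta>"
    proof
      fix j
      have "int (\<phi> (\<phi> \<eta>) j) = int (\<eta> j)"
        unfolding \<phi>_def[of "\<phi> \<eta>"] f i_def[symmetric] using v xi il by auto
      then show "\<phi> (\<phi> \<eta>) j = \<eta> j" by simp
    qed
    have "(\<lambda>j. x j - int (\<phi> \<eta> j)) = (\<lambda>j. (\<lambda>j. x j - int (\<eta> j)) (transpose i (Suc i) j))"
      using v by (auto simp: fun_eq_iff transpose_def)
    then show "D (\<phi> \<eta>) = - D \<eta>"
      unfolding D_def using alt_mats_swap[of i l "Suc i" \<alpha> r "\<lambda>j. x j - int (\<eta> j)"] il by simp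
  qed
  have "(\<Sum>\<eta>\<in>B. D \<eta>) = (\<Sum>\<eta>\<in>B. D (\<phi> \<eta>))"
    by (rule sum.reindex_bij_betw[symmetric], rule bij_betw_byWitness[of _ \<phi>]) (use ph in auto)
  also have "\<dots> = - (\<Sum>\<eta>\<in>B. D \<eta>)" using ph(4) by (simp add: sum_negf)
  finally have B0: "(\<Sum>\<eta>\<in>B. D \<eta>) = 0" by simp
  have "alt_mats l \<alpha> (Suc r) x = (\<Sum>\<eta>\<in>comps l (\<alpha> r). D \<eta>)" by (simp add: alt_mats_Suc D_def)
  also have "\<dots> = (\<Sum>\<eta>\<in>B. D \<eta>)"
  proof (rule sum.mono_neutral_right)
    show "\<forall>\<eta>\<in>comps l (\<alpha> r) - B. D \<eta> = 0"
    proof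
      fix \<eta> assume "\<eta> \<in> comps l (\<alpha> r) - B"
      then have "\<eta> \<in> comps l (\<alpha> r)" "\<forall>i. Suc i < l \<longrightarrow> x (Suc i) < x i - int (\<eta> i)"
        unfolding B_def bad_def by force+
      then show "D \<eta> = 0" using contra unfolding D_def by blast
    qed
  qed (auto simp: B_def)
  finally show False using nz B0 by simp
qed

text \<open>The numbers \<open>x i + int i\<close> are the rows of a shape built from r horizontal
  strips, one for each column of the matrices. Each strip opens at most one new row, so the first s
  strips lie within the first s rows; this is the dominance inequality.\<close>

lemma alt_mats_nonzero:
  assumes "strict_desc l x" "alt_mats l \<alpha> r x \<noteq> 0"
  shows "(\<forall>i<l. 0 \<le> x i + int i) \<and> (\<forall>i<l. r \<le> i \<longrightarrow> x i + int i = 0) \<and>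
    (\<Sum>i<l. x i + int i) = int (\<Sum>j<r. \<alpha> j) \<and>
    (\<forall>s\<le>r. int (\<Sum>j<s. \<alpha> j) \<le> (\<Sum>i<min s l. x i + int i))"
  using assms
proof (induction r arbitrary: x)
  case 0
  obtain \<pi> where p: "\<pi> \<in> Sym l" "\<forall>i<l. x i + int (\<pi> i) = 0"
  proof -
    obtain \<pi> where "\<pi> \<in> Sym l" "card (mats l 0 (\<lambda>i. x i + int (\<pi> i)) \<alpha>) \<noteq> 0"
      using 0(2) unfolding alt_mats_def by (auto elim: sum.not_neutral_contains_not_neutral)
    then show ?thesis using that[of \<pi>] by (simp add: mats_0 split: if_splits)
  qed
  \<comment> \<open>As all prescribed row sums are 0, \<pi> i = - x i increases strictly with i, and
    a strictly increasing permutation is the identity.\<close>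
  have ge: "i \<le> \<pi> i" if "i < l" for i
    using that
  proof (induction i)
    case (Suc i)
    have "x (Suc i) < x i" using 0(1) Suc by (simp add: strict_desc_def)
    then have "\<pi> i < \<pi> (Suc i)" 
    proof -
      have "x i + int (\<pi> i) = 0" "x (Suc i) + int (\<pi> (Suc i)) = 0" using p(2) Suc.prems by simp_all
      then show ?thesis using \<open>x (Suc i) < x i\<close> by linarith
    qed
    then show ?case using Suc by simp
  qed simp
  have "\<pi> = id" using permutes_natset_ge[of \<pi> "{..<l}"] p(1) ge by simp
  then show ?case using p(2) by simp
next
  case (Suc r)
  obtain \<eta> where e: "\<eta> \<in> comps l (\<alpha> r)" "\<And>i. Suc i < l \<Longrightarrow> x (Suc i) < x i - int (\<eta> i)"
    "alt_mats l \<alpha> r (\<lambda>i. x i - int (\<eta> i)) \<noteq> 0"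
    using alt_mats_horizontal_strip[OF Suc.prems] by blast
  define y where "y i = x i - int (\<eta> i)" for i
  have sy: "strict_desc l y"
    unfolding strict_desc_def
  proof (intro allI impI)
    fix i assume "Suc i < l"
    then have "x (Suc i) < y i" using e(2)[of i] by (simp add: y_def)
    then show "y (Suc i) < y i" by (simp add: y_def)
  qed
  have nz: "alt_mats l \<alpha> r y \<noteq> 0" using e(3) by (simp add: y_def[abs_def])
  note IH = Suc.IH[OF sy nz]
  have xy: "x i = y i + int (\<eta> i)" for i by (simp add: y_def)
  have a: "\<forall>i<l. 0 \<le> x i + int i" using IH by (auto simp: xy)
  \<comment> \<open>By the strip condition row i is no longer than row i - 1 of the smaller shape,
    which is empty by induction.\<close>
  have b: "\<forall>i<l. Suc r \<le> i \<longrightarrow> x i + int i = 0"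
  proof (intro allI impI)
    fix i assume i: "i < l" "Suc r \<le> i"
    then obtain i' where i': "i = Suc i'" by (cases i) auto
    have "y i' + int i' = 0" using IH i i' by auto
    moreover have "x i < y i'" using e(2)[of i'] i i' by (simp add: y_def)
    ultimately have "x i + int i \<le> 0" using i' by simp
    then show "x i + int i = 0" using a i by (simp add: antisym)
  qed
  have "(\<Sum>i<l. x i + int i) = (\<Sum>i<l. y i + int i) + int (\<Sum>i<l. \<eta> i)"
    by (simp add: xy sum.distrib)
  also have "\<dots> = int (\<Sum>j<Suc r. \<alpha> j)" using IH e(1) by (simp add: comps_def)
  finally have c: "(\<Sum>i<l. x i + int i) = int (\<Sum>j<Suc r. \<alpha> j)" .
  have d: "int (\<Sum>j<s. \<alpha> j) \<le> (\<Sum>i<min s l. x i + int i)" if s: "s \<le> Suc r" for s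
  proof (cases "s \<le> r")
    case True
    then have "int (\<Sum>j<s. \<alpha> j) \<le> (\<Sum>i<min s l. y i + int i)" using IH by blast
    also have "\<dots> \<le> (\<Sum>i<min s l. x i + int i)" by (rule sum_mono) (simp add: xy)
    finally show ?thesis .
  next
    case False
    then have "s = Suc r" using s by simp
    moreover have "(\<Sum>i<l. x i + int i) = (\<Sum>i<min (Suc r) l. x i + int i)"
      by (rule sum.mono_neutral_right) (use b in auto)
    ultimately show ?thesis using c by simp
  qed
  show ?case using a b c d by blast
qed

abbreviation jt_content :: "nat list \<Rightarrow> (nat \<Rightarrow> nat) \<Rightarrow> nat \<Rightarrow> int" where
  "jt_content \<mu> \<pi> \<equiv> \<lambda>i. int (part \<mu> i) - int i + int (\<pi> i)"

text \<open>The class function of the determinant det (h_(\<mu>_i - i + j)). Beyond the length of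
  \<mu> the content is 0, because \<pi> fixes these indices.\<close>

definition jt_class :: "nat \<Rightarrow> nat list \<Rightarrow> (nat \<Rightarrow> nat) \<Rightarrow> rat" where
  "jt_class n \<mu> \<sigma> = (\<Sum>\<pi>\<in>Sym (length \<mu>). of_int (sign \<pi>) *
     fixw n (jt_content \<mu> \<pi>) \<sigma>)"

lemma jt_class_conj: "h \<in> Sym n \<Longrightarrow> jt_class n \<mu> (h \<circ> \<sigma> \<circ> inv h) = jt_class n \<mu> \<sigma>"
  by (simp add: jt_class_def fixw_conj)

lemma sum_part: "is_partition n \<mu> \<Longrightarrow> (\<Sum>i<length \<mu>. part \<mu> i) = n"
  by (simp add: is_partition_def part_def sum_list_sum_nth atLeast0LessThan)

text \<open>After division by n! the pairing is a Kostka number in the form of an alternating sum of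
  matrix counts; by \<open>alt_mats_nonzero\<close> it can only survive for \<alpha> below
  \<mu>.\<close>

lemma jt_class_fixw_eq_0:
  assumes p: "is_partition n \<mu>" and q: "is_partition n \<alpha>"
    and d: "\<not> dom_le \<alpha> \<mu>"
  shows "fix_pairing n (jt_class n \<mu>) (ipart \<alpha>) = 0"
proof -
  define l where "l = length \<mu>"
  define x where "x i = int (part \<mu> i) - int i" for i
  have part0: "part \<nu> i = 0" if "length \<nu> \<le> i" for \<nu> i using that by (simp add: part_def)
  have "fix_pairing n (jt_class n \<mu>) (ipart \<alpha>) =
    (\<Sum>\<sigma>\<in>Sym n. \<Sum>\<pi>\<in>Sym l. of_int (sign \<pi>) * (fixw n (\<lambda>i. x i + int (\<pi> i)) \<sigma> * fixw n (ipart \<alpha>) \<sigma>))"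
    by (simp add: jt_class_def l_def x_def sum_distrib_right mult.assoc)
  also have "\<dots> = (\<Sum>\<pi>\<in>Sym l. of_int (sign \<pi>) *
      (\<Sum>\<sigma>\<in>Sym n. fixw n (\<lambda>i. x i + int (\<pi> i)) \<sigma> * fixw n (ipart \<alpha>) \<sigma>))"
    by (subst sum.swap) (simp add: sum_distrib_left)
  also have "\<dots> = (\<Sum>\<pi>\<in>Sym l. of_int (sign \<pi>) * (fact n * of_nat (card (mats l (length \<alpha>) (\<lambda>i. x i + int (\<pi> i)) (part \<alpha>)))))"
  proof (rule sum.cong[OF refl])
    fix \<pi> assume pi: "\<pi> \<in> Sym l"
    have "(\<Sum>\<sigma>\<in>Sym n. fixw n (\<lambda>i. x i + int (\<pi> i)) \<sigma> * fixw n (ipart \<alpha>) \<sigma>) =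
      fact n * of_nat (card (mats l (length \<alpha>) (\<lambda>i. x i + int (\<pi> i)) (part \<alpha>)))"
      by (rule sum_fixw_fixw) (use part0 Sym_ge[OF pi] sum_part[OF q] in \<open>auto simp: x_def l_def\<close>)
    then show "of_int (sign \<pi>) * (\<Sum>\<sigma>\<in>Sym n. fixw n (\<lambda>i. x i + int (\<pi> i)) \<sigma> * fixw n (ipart \<alpha>) \<sigma>) =
      of_int (sign \<pi>) * (fact n * of_nat (card (mats l (length \<alpha>) (\<lambda>i. x i + int (\<pi> i)) (part \<alpha>))) :: rat)"
      by simp
  qed
  also have "\<dots> = fact n * of_int (alt_mats l (part \<alpha>) (length \<alpha>) x)"
    by (simp add: alt_mats_def sum_distrib_left algebra_simps)
  finally have eq: "fix_pairing n (jt_class n \<mu>) (ipart \<alpha>) =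
    fact n * of_int (alt_mats l (part \<alpha>) (length \<alpha>) x)" .
  have "alt_mats l (part \<alpha>) (length \<alpha>) x = 0"
  proof (rule ccontr)
    assume nz: "\<not> ?thesis"
    have "strict_desc l x"
      unfolding strict_desc_def x_def
    proof (intro allI impI)
      fix i
      show "int (part \<mu> (Suc i)) - int (Suc i) < int (part \<mu> i) - int i"
        using part_antimono[OF p, of i "Suc i"] by simp
    qed
    from alt_mats_nonzero[OF this nz]
    have *: "int (\<Sum>j<s. part \<alpha> j) \<le> (\<Sum>i<min s l. x i + int i)" if "s \<le> length \<alpha>" for s using that by blast
    have minl: "(\<Sum>i<min s l. x i + int i) = (\<Sum>i<s. int (part \<mu> i))" for s
      unfolding x_def by (simp, rule sum.mono_neutral_left) (auto simp: l_def part0)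
    have "dom_le \<alpha> \<mu>"
      unfolding dominated_def
    proof
      fix t
      have "(\<Sum>i<t. int (part \<alpha> i)) = (\<Sum>i<min t (length \<alpha>). int (part \<alpha> i))"
        by (rule sum.mono_neutral_right) (auto simp: part0)
      also have "\<dots> \<le> (\<Sum>i<min t (length \<alpha>). int (part \<mu> i))"
        using *[of "min t (length \<alpha>)"] minl by simp
      also have "\<dots> \<le> (\<Sum>i<t. int (part \<mu> i))" by (rule sum_mono2) auto
      finally show "(\<Sum>i<t. int (part \<alpha> i)) \<le> (\<Sum>i<t. int (part \<mu> i))" .
    qed
    then show False using d by simp
  qed
  then show ?thesis using eq by simp
qed

section \<open>Cycle types\<close>

lemma image_mset_eq_imp_bij_betw:
  assumes "finite A" "finite B" and eq: "image_mset f (mset_set A) = image_mset g (mset_set B)"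
  shows "\<exists>h. bij_betw h A B \<and> (\<forall>a\<in>A. f a = g (h a))"
proof -
  have "card A = card B" using arg_cong[OF eq, of size] by simp
  then obtain e where e: "bij_betw e A B" using assms finite_same_card_bij by blast
  have "image_mset f (mset_set A) = image_mset (\<lambda>a. g (e a)) (mset_set A)"
    using eq image_mset_mset_set[of e A] e
    by (metis (no_types, lifting) bij_betw_def comp_apply multiset.map_comp multiset.map_cong0)
  then obtain p where p: "p permutes A" "\<forall>x\<in>A. f x = g (e (p x))"
    by (rule image_mset_eq_implies_permutes[OF assms(1)])
  have "bij_betw (e \<circ> p) A B" using bij_betw_trans[OF permutes_imp_bij[OF p(1)] e] .
  then show ?thesis using p by auto
qed

abbreviation orbs :: "nat \<Rightarrow> (nat \<Rightarrow> nat) \<Rightarrow> nat set set" where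
  "orbs n \<sigma> \<equiv> orbit \<sigma> ` {..<n}"

lemma Sym_permutation: "\<sigma> \<in> Sym n \<Longrightarrow> permutation \<sigma>"
  using permutes_imp_permutation[of "{..<n}"] by auto

lemma self_in_orbit: "\<sigma> \<in> Sym n \<Longrightarrow> m \<in> orbit \<sigma> m"
  by (rule permutation_self_in_orbit[OF Sym_permutation])

lemma orbit_eq: "\<sigma> \<in> Sym n \<Longrightarrow> x \<in> orbit \<sigma> m \<Longrightarrow> orbit \<sigma> x = orbit \<sigma> m"
  using orbit_swap[OF self_in_orbit] orbit_trans[of _ \<sigma>] by fast

lemma orbit_less: "\<sigma> \<in> Sym n \<Longrightarrow> m < n \<Longrightarrow> orbit \<sigma> m \<subseteq> {..<n}"
  using permutes_orbit_subset[of \<sigma> "{..<n}" m] by simp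

lemma orbit_apply: "\<sigma> \<in> Sym n \<Longrightarrow> orbit \<sigma> (\<sigma> m) = orbit \<sigma> m"
  by (rule orbit_eq) (auto intro: orbit.base)

lemma orbs_memD: "\<sigma> \<in> Sym n \<Longrightarrow> c \<in> orbs n \<sigma> \<Longrightarrow> x \<in> c \<Longrightarrow> orbit \<sigma> x = c \<and> x < n"
  using orbit_eq[of \<sigma> n x] orbit_less[of \<sigma> n] by blast

lemma invariant_orbit:
  assumes "u \<circ> \<sigma> = u" "x \<in> orbit \<sigma> m" shows "u x = u m"
  using assms(2) fun_cong[OF assms(1)] by induction simp_all

lemma size_cycle_type: "size (cycle_type n \<sigma>) = card (orbs n \<sigma>)"
  by (simp add: cycle_type_def)

lemma sum_cycle_type:
  assumes s: "\<sigma> \<in> Sym n" shows "sum_mset (cycle_type n \<sigma>) = n"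
proof -
  have "sum_mset (cycle_type n \<sigma>) = (\<Sum>c\<in>orbs n \<sigma>. card c)"
    by (simp add: cycle_type_def sum_unfold_sum_mset)
  also have "\<dots> = card (\<Union>(orbs n \<sigma>))"
  proof (rule card_Union_disjoint[symmetric])
    show "pairwise disjnt (orbs n \<sigma>)"
      unfolding pairwise_def disjnt_def using orbs_memD[OF s] by blast
    show "\<And>A. A \<in> orbs n \<sigma> \<Longrightarrow> finite A"
      using orbit_less[OF s] finite_subset by blast
  qed
  also have "\<Union>(orbs n \<sigma>) = {..<n}"
    using orbit_less[OF s] self_in_orbit[OF s] by blast
  finally show ?thesis by simp
qed

lemma cycle_type_pos:
  assumes s: "\<sigma> \<in> Sym n" shows "0 \<notin># cycle_type n \<sigma>"
proof -
  have "card c \<noteq> 0" if c: "c \<in> orbs n \<sigma>" for c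
  proof -
    obtain m where m: "m < n" "c = orbit \<sigma> m" using c by auto
    have "finite c" using finite_subset[OF orbit_less[OF s m(1)]] m(2) by simp
    moreover have "m \<in> c" using self_in_orbit[OF s] m(2) by simp
    ultimately show ?thesis by auto
  qed
  moreover have "card c = 0 \<longrightarrow> c \<notin> orbs n \<sigma>" for c using calculation by blast
  ultimately show ?thesis unfolding cycle_type_def by force
qed

section \<open>Words that are constant on the cycles of a permutation\<close>

definition content_mset :: "(nat \<Rightarrow> int) \<Rightarrow> nat multiset" where
  "content_mset \<beta> = image_mset (\<lambda>i. nat (\<beta> i)) (mset_set {i. \<beta> i \<noteq> 0})"

lemma words_support:
  assumes "u \<in> words n \<beta>"
  shows "\<beta> i \<noteq> 0 \<longleftrightarrow> (\<exists>m<n. u m = i)" "0 \<le> \<beta> i" "finite {i. \<beta> i \<noteq> 0}"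
proof -
  have b: "\<beta> i = int (card {m. m < n \<and> u m = i})" for i using assms by (simp add: words_def)
  show *: "\<beta> i \<noteq> 0 \<longleftrightarrow> (\<exists>m<n. u m = i)" for i unfolding b by auto
  show "0 \<le> \<beta> i" by (simp add: b)
  have "{i. \<beta> i \<noteq> 0} \<subseteq> u ` {..<n}" using * by auto
  then show "finite {i. \<beta> i \<noteq> 0}" by (rule finite_subset) simp
qed

text \<open>An invariant word is constant on cycles, hence a map from the cycles onto the letters
  that occur. If there are as many letters as cycles, the map is bijective and each letter occurs as
  often as its cycle is long.\<close>

lemma invariant_word_orbs:
  assumes s: "\<sigma> \<in> Sym n" and u: "u \<in> words n \<beta>" "u \<circ> \<sigma> = u"
  shows "card {i. \<beta> i \<noteq> 0} \<le> card (orbs n \<sigma>)"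
    and "card {i. \<beta> i \<noteq> 0} = card (orbs n \<sigma>) \<Longrightarrow> content_mset \<beta> = cycle_type n \<sigma>"
proof -
  define f where "f c = u (SOME m. m \<in> c)" for c
  have f: "f c = u m" if "c \<in> orbs n \<sigma>" "m \<in> c" for c m
  proof -
    have "(SOME m. m \<in> c) \<in> c" using that(2) by (rule someI)
    then have "(SOME m. m \<in> c) \<in> orbit \<sigma> m" using orbs_memD[OF s that] by simp
    then show ?thesis unfolding f_def by (rule invariant_orbit[OF u(2)])
  qed
  have img: "f ` orbs n \<sigma> = {i. \<beta> i \<noteq> 0}"
  proof -
    have "f (orbit \<sigma> m) = u m" if "m < n" for m
      using f[of "orbit \<sigma> m" m] self_in_orbit[OF s] that by blast
    then have "f ` orbs n \<sigma> = u ` {..<n}" by (auto simp: image_image)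
    also have "\<dots> = {i. \<beta> i \<noteq> 0}" using words_support(1)[OF u(1)] by auto
    finally show ?thesis .
  qed
  show "card {i. \<beta> i \<noteq> 0} \<le> card (orbs n \<sigma>)"
    unfolding img[symmetric] by (rule card_image_le) simp
  assume "card {i. \<beta> i \<noteq> 0} = card (orbs n \<sigma>)"
  then have inj: "inj_on f (orbs n \<sigma>)"
    using img eq_card_imp_inj_on[of "orbs n \<sigma>" f] by simp
  have "\<beta> (f c) = int (card c)" if c: "c \<in> orbs n \<sigma>" for c
  proof -
    have "{m. m < n \<and> u m = f c} = c"
    proof (intro equalityI subsetI)
      fix m assume m: "m \<in> {m. m < n \<and> u m = f c}"
      then have "f (orbit \<sigma> m) = f c" using f[of "orbit \<sigma> m" m] self_in_orbit[OF s] by auto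
      then have "orbit \<sigma> m = c" using inj c m by (auto dest: inj_onD)
      then show "m \<in> c" using self_in_orbit[OF s] by blast
    qed (use orbs_memD[OF s c] f[OF c] in auto)
    moreover have "int (card {m. m < n \<and> u m = f c}) = \<beta> (f c)"
      using u(1) unfolding words_def by blast
    ultimately show ?thesis by simp
  qed
  then have "cycle_type n \<sigma> = image_mset (\<lambda>c. nat (\<beta> (f c))) (mset_set (orbs n \<sigma>))"
    unfolding cycle_type_def by (intro image_mset_cong) simp
  also have "\<dots> = image_mset (\<lambda>i. nat (\<beta> i)) (image_mset f (mset_set (orbs n \<sigma>)))"
    by (simp add: multiset.map_comp comp_def)
  also have "\<dots> = content_mset \<beta>"
    by (simp add: content_mset_def image_mset_mset_set[OF inj] img)
  finally show "content_mset \<beta> = cycle_type n \<sigma>" ..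
qed

lemma invariant_word_exists:
  assumes s: "\<sigma> \<in> Sym n" and fin: "finite {i. \<beta> i \<noteq> 0}" and pos: "\<And>i. 0 \<le> \<beta> i"
    and eq: "content_mset \<beta> = cycle_type n \<sigma>"
  shows "\<exists>u\<in>words n \<beta>. u \<circ> \<sigma> = u"
proof -
  have "image_mset card (mset_set (orbs n \<sigma>)) = image_mset (\<lambda>i. nat (\<beta> i)) (mset_set {i. \<beta> i \<noteq> 0})"
    using eq by (simp add: content_mset_def cycle_type_def)
  then obtain h where h: "bij_betw h (orbs n \<sigma>) {i. \<beta> i \<noteq> 0}" "\<forall>c\<in>orbs n \<sigma>. card c = nat (\<beta> (h c))"
    using image_mset_eq_imp_bij_betw[OF finite_imageI[OF finite_lessThan] fin] by blast
  define u where "u m = (if m < n then h (orbit \<sigma> m) else 0)" for m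
  have "int (card {m. m < n \<and> u m = i}) = \<beta> i" for i
  proof (cases "\<beta> i = 0")
    case True
    then have "{m. m < n \<and> u m = i} = {}" using h(1) by (auto simp: u_def bij_betw_def)
    then show ?thesis using True by simp
  next
    case False
    then have "i \<in> h ` orbs n \<sigma>" using h(1) unfolding bij_betw_def by blast
    then obtain c where c: "c \<in> orbs n \<sigma>" "h c = i" by blast
    have "{m. m < n \<and> u m = i} = c"
    proof (intro equalityI subsetI)
      fix m assume m: "m \<in> {m. m < n \<and> u m = i}"
      then have "h (orbit \<sigma> m) = h c" by (auto simp: u_def c)
      then have "orbit \<sigma> m = c" using h(1) m c by (auto simp: bij_betw_def dest: inj_onD)
      then show "m \<in> c" using self_in_orbit[OF s] by blast
    qed (use orbs_memD[OF s c(1)] c in \<open>auto simp: u_def\<close>)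
    then show ?thesis using h(2) c pos[of i] by auto
  qed
  then have "u \<in> words n \<beta>" by (simp add: words_def u_def)
  moreover have "u \<circ> \<sigma> = u"
    using Sym_less[OF s] orbit_apply[OF s] by (auto simp: u_def fun_eq_iff)
  ultimately show ?thesis by blast
qed

text \<open>Renaming the letters along a bijection of the supports embeds the invariant words of one
  content into those of the other.\<close>

lemma fixw_content_le:
  assumes s: "\<sigma> \<in> Sym n"
    and fin: "finite {i. \<beta> i \<noteq> 0}" "finite {i. \<gamma> i \<noteq> 0}" and pos: "\<And>i. 0 \<le> \<gamma> i"
    and eq: "content_mset \<beta> = content_mset \<gamma>"
  shows "fixw n \<beta> \<sigma> \<le> fixw n \<gamma> \<sigma>"
proof (cases "words n \<beta> = {}")
  case False
  then have bpos: "0 \<le> \<beta> i" for i using words_support(2) by blast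
  obtain h where h: "bij_betw h {i. \<beta> i \<noteq> 0} {i. \<gamma> i \<noteq> 0}" "\<forall>i\<in>{i. \<beta> i \<noteq> 0}. nat (\<beta> i) = nat (\<gamma> (h i))"
    using image_mset_eq_imp_bij_betw[OF fin eq[unfolded content_mset_def]] by blast
  define t where "t u = (\<lambda>m. if m < n then h (u m) else 0)" for u :: "nat \<Rightarrow> nat"
  have tw: "t u \<in> words n \<gamma>" if u: "u \<in> words n \<beta>" for u
  proof -
    have "int (card {m. m < n \<and> t u m = j}) = \<gamma> j" for j
    proof (cases "\<gamma> j = 0")
      case True
      have "t u m \<noteq> j" if "m < n" for m
        using words_support(1)[OF u] that h(1) True by (auto simp: t_def bij_betw_def)
      then have "{m. m < n \<and> t u m = j} = {}" by auto
      then show ?thesis using True by simp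
    next
      case False
      then have "j \<in> h ` {i. \<beta> i \<noteq> 0}" using h(1) unfolding bij_betw_def by blast
      then obtain i where i: "\<beta> i \<noteq> 0" "h i = j" by blast
      have "t u m = j \<longleftrightarrow> u m = i" if "m < n" for m
        using words_support(1)[OF u, of "u m"] that i h(1) by (auto simp: t_def bij_betw_def dest: inj_onD)
      then have "{m. m < n \<and> t u m = j} = {m. m < n \<and> u m = i}" by auto
      then have "int (card {m. m < n \<and> t u m = j}) = \<beta> i" using u by (simp add: words_def)
      then show ?thesis using i h(2) bpos[of i] pos[of j] by auto
    qed
    then show ?thesis by (simp add: words_def t_def)
  qed
  have "card {u \<in> words n \<beta>. u \<circ> \<sigma> = u} \<le> card {u \<in> words n \<gamma>. u \<circ> \<sigma> = u}"
  proof (rule card_inj_on_le)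
    show "inj_on t {u \<in> words n \<beta>. u \<circ> \<sigma> = u}"
    proof (rule inj_onI)
      fix u v assume u: "u \<in> {u \<in> words n \<beta>. u \<circ> \<sigma> = u}" and v: "v \<in> {u \<in> words n \<beta>. u \<circ> \<sigma> = u}"
        and tuv: "t u = t v"
      show "u = v"
      proof
        fix m show "u m = v m"
        proof (cases "m < n")
          case True
          have "\<beta> (u m) \<noteq> 0" "\<beta> (v m) \<noteq> 0"
            using u v words_support(1)[of u n \<beta> "u m"] words_support(1)[of v n \<beta> "v m"] True by auto
          moreover have "h (u m) = h (v m)" using fun_cong[OF tuv, of m] True by (simp add: t_def)
          ultimately show ?thesis using h(1) by (auto simp: bij_betw_def dest: inj_onD)
        next
          case False
          then show ?thesis using u v by (simp add: words_def)
        qed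
      qed
    qed
    show "t ` {u \<in> words n \<beta>. u \<circ> \<sigma> = u} \<subseteq> {u \<in> words n \<gamma>. u \<circ> \<sigma> = u}"
      using tw Sym_less[OF s] by (auto simp: t_def fun_eq_iff)
  qed simp
  then show ?thesis by (simp add: fixw_def)
qed (simp add: fixw_def)

lemma fixw_content_cong:
  assumes "\<sigma> \<in> Sym n" "finite {i. \<beta> i \<noteq> 0}" "finite {i. \<gamma> i \<noteq> 0}"
    "\<And>i. 0 \<le> \<beta> i" "\<And>i. 0 \<le> \<gamma> i" "content_mset \<beta> = content_mset \<gamma>"
  shows "fixw n \<beta> \<sigma> = fixw n \<gamma> \<sigma>"
  by (intro antisym fixw_content_le) (use assms in auto)

section \<open>Conjugacy of permutations with the same cycle type\<close>

lemma card_orbit_funpow: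
  assumes s: "\<sigma> \<in> Sym n"
  shows "(\<sigma> ^^ card (orbit \<sigma> x)) x = x"
    and "inj_on (\<lambda>i. (\<sigma> ^^ i) x) {..<card (orbit \<sigma> x)}"
    and "orbit \<sigma> x = (\<lambda>i. (\<sigma> ^^ i) x) ` {..<card (orbit \<sigma> x)}"
proof -
  define d where "d = funpow_dist1 \<sigma> x x"
  have x: "x \<in> orbit \<sigma> x" by (rule self_in_orbit[OF s])
  have 1: "(\<sigma> ^^ d) x = x" unfolding d_def using funpow_dist1_prop[OF x] by simp
  have 2: "inj_on (\<lambda>i. (\<sigma> ^^ i) x) {..<d}"
    using inj_on_funpow_dist1[OF x] by (simp add: d_def atLeast0LessThan)
  have 3: "orbit \<sigma> x = (\<lambda>i. (\<sigma> ^^ i) x) ` {..<d}"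
    using orbit_conv_funpow_dist1[OF x] by (simp add: d_def atLeast0LessThan)
  have "card (orbit \<sigma> x) = d" unfolding 3 using card_image[OF 2] by simp
  then show "(\<sigma> ^^ card (orbit \<sigma> x)) x = x"
    "inj_on (\<lambda>i. (\<sigma> ^^ i) x) {..<card (orbit \<sigma> x)}"
    "orbit \<sigma> x = (\<lambda>i. (\<sigma> ^^ i) x) ` {..<card (orbit \<sigma> x)}"
    using 1 2 3 by simp_all
qed

lemma funpow_eq_iff_mod:
  assumes s: "\<sigma> \<in> Sym n"
  shows "(\<sigma> ^^ i) x = (\<sigma> ^^ j) x \<longleftrightarrow> i mod card (orbit \<sigma> x) = j mod card (orbit \<sigma> x)"
proof -
  define d where "d = card (orbit \<sigma> x)"
  have m: "(\<sigma> ^^ (i mod d)) x = (\<sigma> ^^ i) x" for i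
    using card_orbit_funpow(1)[OF s, of x] by (intro funpow_mod_eq) (simp add: d_def)
  have "d \<noteq> 0" using card_orbit_funpow(3)[OF s, of x] self_in_orbit[OF s, of x] by (auto simp: d_def)
  then have "i mod d \<in> {..<d}" "j mod d \<in> {..<d}" by auto
  then have "(\<sigma> ^^ (i mod d)) x = (\<sigma> ^^ (j mod d)) x \<longleftrightarrow> i mod d = j mod d"
    using card_orbit_funpow(2)[OF s, of x] by (fold d_def) (auto dest: inj_onD)
  then show ?thesis unfolding m d_def[symmetric] .
qed

text \<open>F matches cycles of equal length. From a base point in each cycle, h sends the i-th
  iterate of \<sigma> to the i-th iterate of \<tau>; this depends on i only modulo the common
  length, so any exponent \<open>ix m\<close> will do.\<close>

lemma cycle_type_eq_imp_conj:
  assumes s: "\<sigma> \<in> Sym n" and t: "\<tau> \<in> Sym n" and eq: "cycle_type n \<sigma> = cycle_type n \<tau>"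
  shows "\<exists>h\<in>Sym n. \<tau> = h \<circ> \<sigma> \<circ> inv h"
proof -
  obtain F where F: "bij_betw F (orbs n \<sigma>) (orbs n \<tau>)" "\<forall>c\<in>orbs n \<sigma>. card c = card (F c)"
    using image_mset_eq_imp_bij_betw[OF _ _ eq[unfolded cycle_type_def]] by auto
  define r where "r c = (SOME x. x \<in> c)" for c :: "nat set"
  have r: "r c \<in> c" if "c \<in> orbs n \<sigma> \<or> c \<in> orbs n \<tau>" for c
    unfolding r_def by (rule someI_ex) (use that self_in_orbit[OF s] self_in_orbit[OF t] in blast)
  have ro: "orbit \<sigma> (r c) = c" if "c \<in> orbs n \<sigma>" for c
    using orbs_memD[OF s that] r that by blast
  have ro': "orbit \<tau> (r c) = c" if "c \<in> orbs n \<tau>" for c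
    using orbs_memD[OF t that] r that by blast
  have Fin: "F (orbit \<sigma> m) \<in> orbs n \<tau>" if "m < n" for m
    using F(1) that by (auto simp: bij_betw_def)
  define ix where "ix m = (SOME i. (\<sigma> ^^ i) (r (orbit \<sigma> m)) = m)" for m
  have ix: "(\<sigma> ^^ ix m) (r (orbit \<sigma> m)) = m" if "m < n" for m
  proof -
    have "m \<in> orbit \<sigma> (r (orbit \<sigma> m))" using ro[of "orbit \<sigma> m"] that self_in_orbit[OF s, of m] by auto
    then have "m \<in> {(\<sigma> ^^ i) (r (orbit \<sigma> m)) | i. 0 < i}" by (simp only: orbit_altdef[of \<sigma> "r (orbit \<sigma> m)"])
    then obtain i where "m = (\<sigma> ^^ i) (r (orbit \<sigma> m))" by auto
    from sym[OF this] have "\<exists>i. (\<sigma> ^^ i) (r (orbit \<sigma> m)) = m" by (rule exI)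
    then show ?thesis unfolding ix_def by (rule someI_ex)
  qed
  define h where "h m = (if m < n then (\<tau> ^^ ix m) (r (F (orbit \<sigma> m))) else m)" for m
  have modeq: "(\<sigma> ^^ i) (r (orbit \<sigma> m)) = (\<sigma> ^^ j) (r (orbit \<sigma> m)) \<longleftrightarrow>
      (\<tau> ^^ i) (r (F (orbit \<sigma> m))) = (\<tau> ^^ j) (r (F (orbit \<sigma> m)))" if "m < n" for i j m
    using ro[of "orbit \<sigma> m"] ro'[OF Fin[OF that]] F(2) that
    by (auto simp: funpow_eq_iff_mod[OF s] funpow_eq_iff_mod[OF t])
  have horb: "orbit \<tau> (h m) = F (orbit \<sigma> m)" if "m < n" for m
  proof -
    have "(\<tau> ^^ i) x \<in> orbit \<tau> x" for i x
      using funpow_in_orbit[OF self_in_orbit[OF t]] .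
    then have "h m \<in> orbit \<tau> (r (F (orbit \<sigma> m)))" using that by (simp add: h_def)
    then have "orbit \<tau> (h m) = orbit \<tau> (r (F (orbit \<sigma> m)))" by (rule orbit_eq[OF t])
    then show ?thesis using ro'[OF Fin[OF that]] by simp
  qed
  have hn: "h m < n" if "m < n" for m
    using horb[OF that] Fin[OF that] self_in_orbit[OF t, of "h m"] orbs_memD[OF t] by metis
  have "h permutes {..<n}"
  proof (rule inj_imp_permutes)
    show "inj_on h {..<n}"
    proof (rule inj_onI)
      fix x y assume xy: "x \<in> {..<n}" "y \<in> {..<n}" "h x = h y"
      then have "F (orbit \<sigma> x) = F (orbit \<sigma> y)" using horb[of x] horb[of y] by simp
      then have o: "orbit \<sigma> x = orbit \<sigma> y" using F(1) xy by (auto simp: bij_betw_def dest: inj_onD)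
      have "(\<tau> ^^ ix x) (r (F (orbit \<sigma> x))) = (\<tau> ^^ ix y) (r (F (orbit \<sigma> x)))"
        using xy o by (simp add: h_def)
      then have e: "(\<sigma> ^^ ix x) (r (orbit \<sigma> x)) = (\<sigma> ^^ ix y) (r (orbit \<sigma> x))"
        using modeq[of x] xy by blast
      have x: "(\<sigma> ^^ ix x) (r (orbit \<sigma> x)) = x" using ix[of x] xy(1) by blast
      have y: "(\<sigma> ^^ ix y) (r (orbit \<sigma> x)) = y" unfolding o using ix[of y] xy(2) by blast
      show "x = y" by (rule trans[OF trans[OF sym[OF x] e] y])
    qed
  qed (use hn in \<open>auto simp: h_def\<close>)
  then have hS: "h \<in> Sym n" by simp
  have "h (\<sigma> m) = \<tau> (h m)" for m
  proof (cases "m < n")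
    case True
    then have sm: "\<sigma> m < n" using Sym_less[OF s] by simp
    have "(\<sigma> ^^ ix (\<sigma> m)) (r (orbit \<sigma> m)) = (\<sigma> ^^ Suc (ix m)) (r (orbit \<sigma> m))"
      using ix[OF sm] ix[OF True] orbit_apply[OF s, of m] by simp
    then have "(\<tau> ^^ ix (\<sigma> m)) (r (F (orbit \<sigma> m))) = (\<tau> ^^ Suc (ix m)) (r (F (orbit \<sigma> m)))"
      using modeq[OF True] by blast
    then show ?thesis using True sm orbit_apply[OF s, of m] by (simp add: h_def)
  next
    case False
    then show ?thesis using Sym_ge[OF s, of m] Sym_ge[OF t, of m] by (simp add: h_def)
  qed
  then have "h \<circ> \<sigma> = \<tau> \<circ> h" by auto
  then have "\<tau> = h \<circ> \<sigma> \<circ> inv h" using Sym_cancel(3)[OF hS, of \<tau>] by simp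
  then show ?thesis using hS by blast
qed

lemma mset_eq_image_nth: "mset \<nu> = image_mset ((!) \<nu>) (mset_set {..<length \<nu>})"
proof -
  have "mset \<nu> = mset (map ((!) \<nu>) [0..<length \<nu>])" by (simp only: map_nth)
  then show ?thesis unfolding mset_map mset_upt atLeast0LessThan .
qed

lemma content_mset_part:
  assumes "0 \<notin> set \<alpha>"
  shows "{i. int (part \<alpha> i) \<noteq> 0} = {..<length \<alpha>}" "content_mset (ipart \<alpha>) = mset \<alpha>"
proof -
  show 1: "{i. int (part \<alpha> i) \<noteq> 0} = {..<length \<alpha>}"
    using assms by (auto simp: part_def in_set_conv_nth split: if_splits)
  show "content_mset (ipart \<alpha>) = mset \<alpha>"
    unfolding content_mset_def 1 mset_eq_image_nth[of \<alpha>] by (intro image_mset_cong) (simp add: part_def)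
qed

lemma partition_of_cycle_type:
  assumes "\<sigma> \<in> Sym n"
  shows "\<exists>\<alpha>. is_partition n \<alpha> \<and> mset \<alpha> = cycle_type n \<sigma>"
proof -
  define \<alpha> where "\<alpha> = rev (sorted_list_of_multiset (cycle_type n \<sigma>))"
  have 1: "mset \<alpha> = cycle_type n \<sigma>" by (simp add: \<alpha>_def)
  have "sorted_wrt (\<ge>) \<alpha>"
    unfolding \<alpha>_def sorted_wrt_rev by (simp add: sorted_sorted_list_of_multiset)
  moreover have "0 \<notin> set \<alpha>" using cycle_type_pos[OF assms] 1 set_mset_mset[of \<alpha>] by metis
  moreover have "sum_list \<alpha> = n" using sum_cycle_type[OF assms] 1 sum_mset_sum_list[of \<alpha>] by metis
  ultimately show ?thesis using 1 by (auto simp: is_partition_def)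
qed

text \<open>Only permutations with at least as many cycles as \<open>\<alpha>\<close> has parts have fixed words of content
  \<open>\<alpha>\<close>, and in the case of equality the cycle type must be \<open>\<alpha>\<close>; so the matrix of fixed point counts
  is triangular.\<close>

lemma fixw_complete:
  assumes inv: "\<And>h \<sigma>. h \<in> Sym n \<Longrightarrow> \<sigma> \<in> Sym n \<Longrightarrow> F (h \<circ> \<sigma> \<circ> inv h) = F \<sigma>"
    and orth: "\<And>\<alpha>. is_partition n \<alpha> \<Longrightarrow> fix_pairing n F (ipart \<alpha>) = 0"
    and s: "\<sigma> \<in> Sym n"
  shows "F \<sigma> = 0"
proof (rule ccontr)
  assume "F \<sigma> \<noteq> 0"
  \<comment> \<open>Among the permutations where F does not vanish, one with the most cycles is
    paired with the content given by its own cycle type; only its conjugacy class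
    contributes.\<close>
  define A where "A = {\<sigma> \<in> Sym n. F \<sigma> \<noteq> 0}"
  have "finite ((\<lambda>\<sigma>. card (orbs n \<sigma>)) ` A)" "A \<noteq> {}"
    using s \<open>F \<sigma> \<noteq> 0\<close> by (auto simp: A_def)
  then obtain \<sigma>0 where s0: "\<sigma>0 \<in> A" "\<And>\<sigma>. \<sigma> \<in> A \<Longrightarrow> card (orbs n \<sigma>) \<le> card (orbs n \<sigma>0)"
    using Max_in[of "(\<lambda>\<sigma>. card (orbs n \<sigma>)) ` A"] Max_ge[of "(\<lambda>\<sigma>. card (orbs n \<sigma>)) ` A"]
    by (smt (verit) image_iff image_is_empty)
  have S0: "\<sigma>0 \<in> Sym n" using s0(1) by (simp add: A_def)
  obtain \<alpha> where al: "is_partition n \<alpha>" "mset \<alpha> = cycle_type n \<sigma>0" using partition_of_cycle_type[OF S0] by blast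
  let ?b = "ipart \<alpha>"
  have nz: "0 \<notin> set \<alpha>" using al by (simp add: is_partition_def)
  note cm = content_mset_part[OF nz]
  have len: "length \<alpha> = card (orbs n \<sigma>0)" using al(2) size_cycle_type by (metis size_mset)
  define T where "T = {\<sigma> \<in> Sym n. cycle_type n \<sigma> = cycle_type n \<sigma>0}"
  have "0 = fix_pairing n F ?b" using orth[OF al(1)] by simp
  also have "\<dots> = (\<Sum>\<sigma>\<in>T. F \<sigma> * fixw n ?b \<sigma>)"
  proof (rule sum.mono_neutral_right)
    show "\<forall>\<sigma>\<in>Sym n - T. F \<sigma> * fixw n ?b \<sigma> = 0"
    proof (rule ballI, rule ccontr)
      fix \<sigma> assume st: "\<sigma> \<in> Sym n - T" and "F \<sigma> * fixw n ?b \<sigma> \<noteq> 0"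
      then have f: "F \<sigma> \<noteq> 0" "fixw n ?b \<sigma> \<noteq> 0" and t: "\<sigma> \<in> Sym n" by auto
      from f(2) obtain u where u: "u \<in> words n ?b" "u \<circ> \<sigma> = u" by (auto simp: fixw_def)
      have "card {i. ?b i \<noteq> 0} \<le> card (orbs n \<sigma>)" by (rule invariant_word_orbs(1)[OF t u])
      moreover have "card (orbs n \<sigma>) \<le> card (orbs n \<sigma>0)" using s0(2)[of \<sigma>] f t by (simp add: A_def)
      ultimately have "card {i. ?b i \<noteq> 0} = card (orbs n \<sigma>)" using cm(1) len by simp
      then have "content_mset ?b = cycle_type n \<sigma>" by (rule invariant_word_orbs(2)[OF t u])
      then show False using st cm(2) al(2) by (simp add: T_def)
    qed
  qed (auto simp: T_def)
  also have "\<dots> = (\<Sum>\<sigma>\<in>T. F \<sigma>0 * fixw n ?b \<sigma>)"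
  proof (rule sum.cong[OF refl])
    fix \<sigma> assume "\<sigma> \<in> T"
    then obtain h where "h \<in> Sym n" "\<sigma> = h \<circ> \<sigma>0 \<circ> inv h"
      using cycle_type_eq_imp_conj[OF S0, of \<sigma>] by (auto simp: T_def)
    then show "F \<sigma> * fixw n ?b \<sigma> = F \<sigma>0 * fixw n ?b \<sigma>" using inv[of h \<sigma>0] S0 by simp
  qed
  also have "\<dots> = F \<sigma>0 * (\<Sum>\<sigma>\<in>T. fixw n ?b \<sigma>)" by (simp add: sum_distrib_left)
  finally have "(\<Sum>\<sigma>\<in>T. fixw n ?b \<sigma>) = 0" using s0(1) by (simp add: A_def)
  moreover have "fixw n ?b \<sigma>0 \<noteq> 0"
  proof -
    have "\<exists>u\<in>words n ?b. u \<circ> \<sigma>0 = u"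
      by (rule invariant_word_exists[OF S0]) (use cm al in \<open>auto\<close>)
    then show ?thesis by (auto simp: fixw_def)
  qed
  moreover have "\<sigma>0 \<in> T" "finite T" using S0 by (auto simp: T_def)
  ultimately show False using fixw_nonneg by (simp add: sum_nonneg_eq_0_iff)
qed

lemma permutation_of_cycle_type:
  assumes "0 \<notin> set \<nu>" "sum_list \<nu> = n"
  shows "\<exists>\<sigma>\<in>Sym n. cycle_type n \<sigma> = mset \<nu>"
  using assms
proof (induction \<nu> arbitrary: n)
  case Nil
  then show ?case by (auto simp: cycle_type_def)
next
  case (Cons a \<nu>)
  define k where "k = sum_list \<nu>"
  have n: "n = k + a" and a: "0 < a" using Cons.prems by (auto simp: k_def)
  obtain \<sigma> where s: "\<sigma> \<in> Sym k" "cycle_type k \<sigma> = mset \<nu>" using Cons.IH[of k] Cons.prems by (auto simp: k_def)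
  \<comment> \<open>The points k, ..., n - 1 form one new cycle of length a, and below k nothing
    changes.\<close>
  define \<tau> where "\<tau> m = (if m < k then \<sigma> m else if m < n then (if Suc m < n then Suc m else k) else m)" for m
  have "\<tau> permutes {..<n}"
  proof (rule inj_imp_permutes)
    show "inj_on \<tau> {..<n}"
    proof (rule inj_onI)
      fix x y assume "x \<in> {..<n}" "y \<in> {..<n}" "\<tau> x = \<tau> y"
      moreover have "\<sigma> x = \<sigma> y \<Longrightarrow> x = y" using s(1) permutes_inj[of \<sigma>] by (auto dest: injD)
      moreover have "x < k \<Longrightarrow> \<sigma> x < k" "y < k \<Longrightarrow> \<sigma> y < k" using Sym_less[OF s(1)] by auto
      ultimately show "x = y" by (auto simp: \<tau>_def split: if_splits)
    qed
    show "\<tau> x \<in> {..<n}" if "x \<in> {..<n}" for x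
      using that Sym_less[OF s(1), of x] n a by (auto simp: \<tau>_def)
  qed (auto simp: \<tau>_def n)
  then have tS: "\<tau> \<in> Sym n" by simp
  have o1: "orbit \<tau> m = orbit \<sigma> m" if "m < k" for m
  proof (rule orbit_cong)
    show "m \<in> orbit \<sigma> m" by (rule self_in_orbit[OF s(1)])
    show "\<And>y. y \<in> orbit \<sigma> m \<Longrightarrow> \<tau> y = \<sigma> y"
      using orbit_less[OF s(1) that] by (auto simp: \<tau>_def)
  qed
  have pw: "(\<tau> ^^ i) k = k + i" if "i < a" for i
    using that by (induction i) (auto simp: \<tau>_def n)
  have o2: "orbit \<tau> k = {k..<n}"
  proof
    have "x \<in> {k..<n}" if "x \<in> orbit \<tau> k" for x
      using that by induction (use a n in \<open>auto simp: \<tau>_def split: if_splits\<close>)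
    then show "orbit \<tau> k \<subseteq> {k..<n}" by blast
    show "{k..<n} \<subseteq> orbit \<tau> k"
    proof
      fix x assume "x \<in> {k..<n}"
      then have "(\<tau> ^^ (x - k)) k = x" using pw[of "x - k"] n by auto
      then show "x \<in> orbit \<tau> k" using funpow_in_orbit[OF self_in_orbit[OF tS]] by metis
    qed
  qed
  have "orbs n \<tau> = insert {k..<n} (orbs k \<sigma>)"
  proof -
    have "{..<n} = {..<k} \<union> {k..<n}" using n by auto
    moreover have "orbit \<tau> ` {k..<n} = {{k..<n}}"
    proof -
      have "orbit \<tau> m = {k..<n}" if "m \<in> {k..<n}" for m
        using orbit_eq[OF tS, of m k] that o2 by simp
      moreover have "{k..<n} \<noteq> {}" using n a by auto
      ultimately show ?thesis by (auto simp: image_constant_conv)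
    qed
    moreover have "orbit \<tau> ` {..<k} = orbs k \<sigma>" using o1 by auto
    ultimately show ?thesis by (simp add: image_Un)
  qed
  moreover have "{k..<n} \<notin> orbs k \<sigma>"
  proof
    assume "{k..<n} \<in> orbs k \<sigma>"
    then have "{k..<n} \<subseteq> {..<k}" using orbit_less[OF s(1)] by auto
    from subsetD[OF this, of k] show False using n a by simp
  qed
  ultimately have "cycle_type n \<tau> = add_mset (card {k..<n}) (cycle_type k \<sigma>)"
    by (simp add: cycle_type_def)
  then have "cycle_type n \<tau> = mset (a # \<nu>)" using s(2) n by simp
  then show ?case using tS by blast
qed

section \<open>Comparison of the two class functions\<close>

lemma finite_partitions: "finite {\<mu>. is_partition n \<mu>}"
proof (rule finite_subset)
  show "{\<mu>. is_partition n \<mu>} \<subseteq> {xs. set xs \<subseteq> {..n} \<and> length xs \<le> n}"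
  proof clarify
    fix \<mu> assume p: "is_partition n \<mu>"
    have len: "length \<mu> \<le> sum_list \<mu>" if "0 \<notin> set \<mu>" for \<mu> :: "nat list"
      using that by (induction \<mu>) auto
    have "length \<mu> \<le> n" using p len[of \<mu>] by (simp add: is_partition_def)
    moreover have "set \<mu> \<subseteq> {..n}" using p member_le_sum_list[of _ \<mu>] by (auto simp: is_partition_def)
    ultimately show "set \<mu> \<subseteq> {..n} \<and> length \<mu> \<le> n" by simp
  qed
qed (simp add: finite_lists_length_le)

lemma dominated_trans: "dominated \<beta> \<nu> \<Longrightarrow> dom_le \<nu> \<mu> \<Longrightarrow> dominated \<beta> \<mu>"
  unfolding dominated_def by (meson order_trans)

text \<open>Triangular elimination: for a dominance-maximal \<mu> in T, subtract the multiple of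
  \<open>young_class \<mu>\<close> that kills the pairing with content \<mu>. Since T is closed
  downwards, this multiple pairs to zero with the contents outside T, so the hypotheses pass to
  \<open>T - {\<mu>}\<close>.\<close>

lemma young_class_span:
  assumes "finite T" and T: "\<And>\<mu>. \<mu> \<in> T \<Longrightarrow> is_partition n \<mu>"
    and down: "\<And>\<mu> \<nu>. \<mu> \<in> T \<Longrightarrow> is_partition n \<nu> \<Longrightarrow> dom_le \<nu> \<mu> \<Longrightarrow> \<nu> \<in> T"
    and F: "\<And>h \<sigma>. h \<in> Sym n \<Longrightarrow> \<sigma> \<in> Sym n \<Longrightarrow> F (h \<circ> \<sigma> \<circ> inv h) = F \<sigma>"
    and 0: "\<And>\<alpha>. is_partition n \<alpha> \<Longrightarrow> \<alpha> \<notin> T \<Longrightarrow> fix_pairing n F (ipart \<alpha>) = 0"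
  shows "\<exists>d. \<forall>\<sigma>\<in>Sym n. F \<sigma> = (\<Sum>\<mu>\<in>T. d \<mu> * young_class \<mu> \<sigma>)"
  using assms
proof (induction "card T" arbitrary: T F)
  case 0
  then have "T = {}" by simp
  then have "F \<sigma> = 0" if "\<sigma> \<in> Sym n" for \<sigma>
    using fixw_complete[of n F \<sigma>] 0 that by simp
  then show ?case using \<open>T = {}\<close> by simp
next
  case (Suc c T F)
  note fin = \<open>finite T\<close> and T = Suc.prems(2) and down = Suc.prems(3) and F = Suc.prems(4) and zero = Suc.prems(5)
  have "T \<noteq> {}" using Suc by auto
  have "asymp_on T (\<lambda>\<mu> \<nu>. dom_le \<mu> \<nu> \<and> \<mu> \<noteq> \<nu>)"
    by (rule asymp_onI) (use dom_le_antisym T in blast)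
  moreover have "transp_on T (\<lambda>\<mu> \<nu>. dom_le \<mu> \<nu> \<and> \<mu> \<noteq> \<nu>)"
    by (rule transp_onI) (use dom_le_antisym dominated_trans T in blast)
  ultimately obtain \<mu> where mu: "\<mu> \<in> T" "\<And>\<nu>. \<nu> \<in> T \<Longrightarrow> \<nu> \<noteq> \<mu> \<Longrightarrow> \<not> dom_le \<mu> \<nu>"
    using Finite_Set.bex_max_element[OF fin _ _ \<open>T \<noteq> {}\<close>, of "\<lambda>\<mu> \<nu>. dom_le \<mu> \<nu> \<and> \<mu> \<noteq> \<nu>"] by auto
  have p: "is_partition n \<mu>" using T mu(1) by blast
  define cf where "cf F \<alpha> = fix_pairing n F (ipart \<alpha>)" for F \<alpha>
  define x where "x = cf F \<mu> / cf (young_class \<mu>) \<mu>"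
  define F' where "F' \<sigma> = F \<sigma> - x * young_class \<mu> \<sigma>" for \<sigma>
  have cfF': "cf F' \<alpha> = cf F \<alpha> - x * cf (young_class \<mu>) \<alpha>" for \<alpha>
    by (simp add: cf_def F'_def left_diff_distrib sum_subtractf sum_distrib_left mult.assoc)
  have "\<exists>d. \<forall>\<sigma>\<in>Sym n. F' \<sigma> = (\<Sum>\<nu>\<in>T - {\<mu>}. d \<nu> * young_class \<nu> \<sigma>)"
  proof (rule Suc.hyps(1))
    show "c = card (T - {\<mu>})" using Suc.hyps(2) mu(1) fin by simp
    show "\<nu> \<in> T - {\<mu>}" if "\<kappa> \<in> T - {\<mu>}" "is_partition n \<nu>" "dom_le \<nu> \<kappa>" for \<kappa> \<nu>
      using that down[of \<kappa> \<nu>] mu(2)[of \<kappa>] by auto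
    show "F' (h \<circ> \<sigma> \<circ> inv h) = F' \<sigma>" if "h \<in> Sym n" "\<sigma> \<in> Sym n" for h \<sigma>
      unfolding F'_def using F[OF that] young_class_conj[OF p that] by simp
    show "fix_pairing n F' (ipart \<alpha>) = 0"
      if a: "is_partition n \<alpha>" "\<alpha> \<notin> T - {\<mu>}" for \<alpha>
    proof (cases "\<alpha> = \<mu>")
      case True
      have "cf (young_class \<mu>) \<mu> \<noteq> 0" unfolding cf_def by (rule young_class_fixw_self[OF p])
      then have "cf F' \<mu> = 0" by (simp add: cfF' x_def)
      then show ?thesis using True by (simp add: cf_def)
    next
      case False
      then have "\<alpha> \<notin> T" using a by blast
      then have "cf F \<alpha> = 0" "cf (young_class \<mu>) \<alpha> = 0"
        using zero[OF a(1)] young_class_fixw_eq_0[OF p] down[OF mu(1) a(1)] by (auto simp: cf_def)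
      then have "cf F' \<alpha> = 0" by (simp add: cfF')
      then show ?thesis by (simp add: cf_def)
    qed
  qed (use fin T in auto)
  then obtain d where d: "\<And>\<sigma>. \<sigma> \<in> Sym n \<Longrightarrow> F' \<sigma> = (\<Sum>\<nu>\<in>T - {\<mu>}. d \<nu> * young_class \<nu> \<sigma>)" by blast
  have "F \<sigma> = (\<Sum>\<nu>\<in>T. (d(\<mu> := x)) \<nu> * young_class \<nu> \<sigma>)" if "\<sigma> \<in> Sym n" for \<sigma>
  proof -
    have "(\<Sum>\<nu>\<in>T. (d(\<mu> := x)) \<nu> * young_class \<nu> \<sigma>) =
      x * young_class \<mu> \<sigma> + (\<Sum>\<nu>\<in>T - {\<mu>}. (d(\<mu> := x)) \<nu> * young_class \<nu> \<sigma>)"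
      by (subst sum.remove[OF fin mu(1)]) simp
    also have "(\<Sum>\<nu>\<in>T - {\<mu>}. (d(\<mu> := x)) \<nu> * young_class \<nu> \<sigma>) = F' \<sigma>"
      unfolding d[OF that] by (rule sum.cong) auto
    finally show ?thesis by (simp add: F'_def)
  qed
  then show ?case by blast
qed

lemma sum_lessThan_card_le:
  fixes S :: "nat set"
  assumes "finite S" shows "\<Sum>{..<card S} \<le> \<Sum>S"
  using assms
proof (induction S rule: finite_linorder_max_induct)
  case (insert b A)
  have "A \<subseteq> {..<b}" using insert by auto
  then have "card A \<le> b" using card_mono[of "{..<b}" A] by simp
  then show ?case using insert by (auto simp: card_insert_if lessThan_Suc)
qed simp

text \<open>The t values are distinct natural numbers, so their sum is at least 0 + ... + (t -
  1).\<close>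

lemma sum_perm_prefix_ge:
  assumes "\<pi> \<in> Sym l" shows "(\<Sum>i<t. int i) \<le> (\<Sum>i<t. int (\<pi> i))"
proof -
  have inj: "inj_on \<pi> {..<t}" using assms permutes_inj_on[of \<pi>] by auto
  have "\<Sum>{..<t} \<le> \<Sum>(\<pi> ` {..<t})"
    using sum_lessThan_card_le[of "\<pi> ` {..<t}"] by (simp add: card_image[OF inj])
  also have "\<dots> = (\<Sum>i<t. \<pi> i)" by (simp add: sum.reindex[OF inj])
  finally show ?thesis by (simp flip: of_nat_sum)
qed

lemma perm_eq_id:
  assumes "\<pi> \<in> Sym l" "\<And>t. t \<le> l \<Longrightarrow> (\<Sum>i<t. int (\<pi> i)) \<le> (\<Sum>i<t. int i)"
  shows "\<pi> = id"
proof
  fix i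
  show "\<pi> i = id i"
  proof (cases "i < l")
    case True
    have "(\<Sum>i<t. int (\<pi> i)) = (\<Sum>i<t. int i)" if "t \<le> l" for t
      using sum_perm_prefix_ge[OF assms(1), of t] assms(2)[OF that] by simp
    from this[of i] this[of "Suc i"] show ?thesis using True by simp
  qed (use Sym_ge[OF assms(1)] in simp)
qed

lemma sum_jt_class_mult:
  "(\<Sum>\<sigma>\<in>Sym n. jt_class n \<mu> \<sigma> * F \<sigma>) = (\<Sum>\<pi>\<in>Sym (length \<mu>). of_int (sign \<pi>) *
     fix_pairing n F (jt_content \<mu> \<pi>))"
proof -
  have "(\<Sum>\<sigma>\<in>Sym n. jt_class n \<mu> \<sigma> * F \<sigma>) = (\<Sum>\<sigma>\<in>Sym n. \<Sum>\<pi>\<in>Sym (length \<mu>).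
      of_int (sign \<pi>) * (F \<sigma> * fixw n (jt_content \<mu> \<pi>) \<sigma>))"
    by (simp add: jt_class_def sum_distrib_left sum_distrib_right algebra_simps)
  then show ?thesis by (subst (asm) sum.swap) (simp add: sum_distrib_left)
qed

text \<open>Replacing i by \<pi> i can only increase prefix sums, so every Jacobi-Trudi content lies
  above \<mu>.\<close>

lemma dominated_jt_content:
  assumes pi: "\<pi> \<in> Sym l" and d: "dominated (jt_content \<mu> \<pi>) \<nu>"
  shows "dom_le \<mu> \<nu>"
  unfolding dominated_def
proof
  fix t
  have "(\<Sum>i<t. int (part \<mu> i)) \<le> (\<Sum>i<t. int (part \<mu> i) - int i + int (\<pi> i))"
    using sum_perm_prefix_ge[OF pi, of t] by (simp add: sum.distrib sum_subtractf)
  also have "\<dots> \<le> (\<Sum>i<t. int (part \<nu> i))" using d by (simp add: dominated_def)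
  finally show "(\<Sum>i<t. int (part \<mu> i)) \<le> (\<Sum>i<t. int (part \<nu> i))" .
qed

text \<open>Frobenius' formula up to a scalar: both class functions are triangular for the dominance order,
  and the \<open>young_class\<close> are orthogonal.\<close>

lemma young_class_eq_jt_class:
  assumes p: "is_partition n \<mu>"
  shows "\<exists>d. d \<noteq> 0 \<and> (\<forall>\<sigma>\<in>Sym n. young_class \<mu> \<sigma> = d * jt_class n \<mu> \<sigma>)"
proof -
  define T where "T = {\<nu>. is_partition n \<nu> \<and> dom_le \<nu> \<mu>}"
  have fT: "finite T" using finite_subset[OF _ finite_partitions[of n]] by (simp add: T_def subset_iff)
  have muT: "\<mu> \<in> T" using p by (simp add: T_def dominated_def)
  have "\<exists>d. \<forall>\<sigma>\<in>Sym n. jt_class n \<mu> \<sigma> = (\<Sum>\<nu>\<in>T. d \<nu> * young_class \<nu> \<sigma>)"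
  proof (rule young_class_span[OF fT])
    show "\<nu> \<in> T" if "\<kappa> \<in> T" "is_partition n \<nu>" "dom_le \<nu> \<kappa>" for \<kappa> \<nu>
      using that dominated_trans by (auto simp: T_def)
    show "fix_pairing n (jt_class n \<mu>) (ipart \<alpha>) = 0"
      if "is_partition n \<alpha>" "\<alpha> \<notin> T" for \<alpha>
      using jt_class_fixw_eq_0[OF p that(1)] that by (simp add: T_def)
  qed (auto simp: T_def jt_class_conj)
  then obtain d where d: "\<And>\<sigma>. \<sigma> \<in> Sym n \<Longrightarrow> jt_class n \<mu> \<sigma> = (\<Sum>\<nu>\<in>T. d \<nu> * young_class \<nu> \<sigma>)" by blast
  \<comment> \<open>By orthogonality, d \<nu> is up to a nonzero factor the pairing of the
    Jacobi-Trudi sum with \<open>young_class \<nu>\<close>. Every Jacobi-Trudi content lies above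
    \<mu>, hence not below \<nu>, and each term is zero.\<close>
  have d0: "d \<nu> = 0" if nu: "\<nu> \<in> T" "\<nu> \<noteq> \<mu>" for \<nu>
  proof -
    have q: "is_partition n \<nu>" "dom_le \<nu> \<mu>" using nu by (auto simp: T_def)
    have nd: "\<not> dom_le \<mu> \<nu>" using dom_le_antisym[OF p q(1)] q(2) nu(2) by blast
    have "(\<Sum>\<sigma>\<in>Sym n. jt_class n \<mu> \<sigma> * young_class \<nu> \<sigma>) = 0"
      unfolding sum_jt_class_mult
    proof (rule sum.neutral, rule ballI)
      fix \<pi> assume pi: "\<pi> \<in> Sym (length \<mu>)"
      have "\<not> dominated (jt_content \<mu> \<pi>) \<nu>"
        using dominated_jt_content[OF pi] nd by blast
      then show "of_int (sign \<pi>) * (\<Sum>\<sigma>\<in>Sym n. young_class \<nu> \<sigma> *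
          fixw n (jt_content \<mu> \<pi>) \<sigma>) = 0"
        using young_class_fixw_eq_0[OF q(1)] by simp
    qed
    moreover have "(\<Sum>\<sigma>\<in>Sym n. jt_class n \<mu> \<sigma> * young_class \<nu> \<sigma>) = d \<nu> * (\<Sum>\<sigma>\<in>Sym n. (young_class \<nu> \<sigma>)\<^sup>2)"
    proof -
      have "(\<Sum>\<sigma>\<in>Sym n. jt_class n \<mu> \<sigma> * young_class \<nu> \<sigma>) =
          (\<Sum>\<sigma>\<in>Sym n. \<Sum>\<kappa>\<in>T. d \<kappa> * (young_class \<kappa> \<sigma> * young_class \<nu> \<sigma>))"
        by (intro sum.cong refl) (simp add: d sum_distrib_right mult.assoc del: mem_Collect_eq)
      also have "\<dots> = (\<Sum>\<kappa>\<in>T. d \<kappa> * (\<Sum>\<sigma>\<in>Sym n. young_class \<kappa> \<sigma> * young_class \<nu> \<sigma>))"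
        by (subst sum.swap) (simp add: sum_distrib_left)
      also have "\<dots> = (\<Sum>\<kappa>\<in>T. if \<kappa> = \<nu> then d \<nu> * (\<Sum>\<sigma>\<in>Sym n. (young_class \<nu> \<sigma>)\<^sup>2) else 0)"
        using young_class_orth[OF _ q(1)] by (intro sum.cong refl) (auto simp: T_def power2_eq_square)
      finally show ?thesis using fT nu(1) by simp
    qed
    moreover have "(\<Sum>\<sigma>\<in>Sym n. (young_class \<nu> \<sigma>)\<^sup>2) \<noteq> 0"
    proof
      assume "(\<Sum>\<sigma>\<in>Sym n. (young_class \<nu> \<sigma>)\<^sup>2) = 0"
      then have "(young_class \<nu> id)\<^sup>2 = 0"
        using sum_nonneg_eq_0_iff[OF finite_Sym, of n "\<lambda>\<sigma>. (young_class \<nu> \<sigma>)\<^sup>2"] by simp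
      then show False using young_class_id[OF q(1)] by simp
    qed
    ultimately show ?thesis by simp
  qed
  have jt: "jt_class n \<mu> \<sigma> = d \<mu> * young_class \<mu> \<sigma>" if "\<sigma> \<in> Sym n" for \<sigma>
  proof -
    have "jt_class n \<mu> \<sigma> = (\<Sum>\<nu>\<in>T. if \<nu> = \<mu> then d \<mu> * young_class \<mu> \<sigma> else 0)"
      unfolding d[OF that] using d0 by (intro sum.cong) auto
    then show ?thesis using fT muT by simp
  qed
  have "d \<mu> \<noteq> 0"
  proof
    assume "d \<mu> = 0"
    then have "(\<Sum>\<sigma>\<in>Sym n. jt_class n \<mu> \<sigma> * young_class \<mu> \<sigma>) = 0"
      by (intro sum.neutral) (simp add: jt del: mem_Collect_eq)
    moreover have "(\<Sum>\<sigma>\<in>Sym n. jt_class n \<mu> \<sigma> * young_class \<mu> \<sigma>) =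
        (\<Sum>\<pi>\<in>Sym (length \<mu>). if \<pi> = id then
          fix_pairing n (young_class \<mu>) (ipart \<mu>) else 0)"
      unfolding sum_jt_class_mult
    proof (rule sum.cong[OF refl])
      fix \<pi> assume pi: "\<pi> \<in> Sym (length \<mu>)"
      \<comment> \<open>The only Jacobi-Trudi content dominated by \<mu> is \<mu> itself, so a
        single term remains, and it is nonzero by \<open>young_class_fixw_self\<close>.\<close>
      have "\<pi> = id" if "dominated (jt_content \<mu> \<pi>) \<mu>"
      proof (rule perm_eq_id[OF pi])
        fix t
        have "(\<Sum>i<t. int (part \<mu> i) - int i + int (\<pi> i)) \<le> (\<Sum>i<t. int (part \<mu> i))"
          using that by (simp add: dominated_def)
        then show "(\<Sum>i<t. int (\<pi> i)) \<le> (\<Sum>i<t. int i)" by (simp add: sum.distrib sum_subtractf)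
      qed
      then show "of_int (sign \<pi>) * fix_pairing n (young_class \<mu>) (jt_content \<mu> \<pi>) =
        (if \<pi> = id then fix_pairing n (young_class \<mu>) (ipart \<mu>) else 0)"
        using young_class_fixw_eq_0[OF p] by auto
    qed
    ultimately show False using young_class_fixw_self[OF p] by (simp add: sum.delta')
  qed
  then show ?thesis using jt by (intro exI[of _ "1 / d \<mu>"]) simp
qed

section \<open>Determinantal brackets\<close>

text \<open>The determinant det (p_(a_i + c_j)) of size k, kept formal: the value at M is the
  coefficient of the product of the p_m over m in M.\<close>

definition bracket :: "nat \<Rightarrow> (nat \<Rightarrow> nat) \<Rightarrow> (nat \<Rightarrow> nat) \<Rightarrow> nat multiset \<Rightarrow> rat" where
  "bracket k a c = (\<lambda>M. \<Sum>\<rho>\<in>Sym k. if image_mset (\<lambda>i. a i + c (\<rho> i)) (mset_set {..<k}) = M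
     then of_int (sign \<rho>) else 0)"

lemma image_mset_Sym:
  assumes "\<tau> \<in> Sym k"
  shows "image_mset (\<lambda>i. f (\<tau> i)) (mset_set {..<k}) = image_mset f (mset_set {..<k})"
proof -
  have p: "\<tau> permutes {..<k}" using assms by simp
  have "image_mset \<tau> (mset_set {..<k}) = mset_set {..<k}" 
    by (simp add: image_mset_mset_set[OF permutes_inj_on[OF p]] permutes_image[OF p])
  then have "image_mset f (image_mset \<tau> (mset_set {..<k})) = image_mset f (mset_set {..<k})" by simp
  then show ?thesis by (simp add: multiset.map_comp comp_def)
qed

lemma image_mset_lessThan_cong:
  fixes k :: nat
  shows "(\<And>i. i < k \<Longrightarrow> f i = g i) \<Longrightarrow> image_mset f (mset_set {..<k}) = image_mset g (mset_set {..<k})"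
  by (intro image_mset_cong) auto

lemma bracket_cong:
  assumes "\<And>i. i < k \<Longrightarrow> a i = a' i" "\<And>i. i < k \<Longrightarrow> c i = c' i"
  shows "bracket k a c = bracket k a' c'"
proof -
  have "image_mset (\<lambda>i. a i + c (\<rho> i)) (mset_set {..<k}) = image_mset (\<lambda>i. a' i + c' (\<rho> i)) (mset_set {..<k})"
    if "\<rho> \<in> Sym k" for \<rho>
    by (rule image_mset_lessThan_cong) (simp add: assms Sym_less[OF that])
  then show ?thesis unfolding bracket_def by (intro ext sum.cong refl) (simp del: mem_Collect_eq)
qed

lemma sign_comp_transpose:
  assumes "\<rho> \<in> Sym k" "i \<noteq> j"
  shows "sign (\<rho> \<circ> transpose i j) = - sign \<rho>" "sign (transpose i j \<circ> \<rho>) = - sign \<rho>"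
proof -
  have "permutation \<rho>" using assms(1) permutes_imp_permutation[of "{..<k}"] by auto
  then show "sign (\<rho> \<circ> transpose i j) = - sign \<rho>" "sign (transpose i j \<circ> \<rho>) = - sign \<rho>"
    using sign_compose[OF _ permutation_swap_id[of i j], of \<rho>]
      sign_compose[OF permutation_swap_id[of i j], of \<rho>] assms(2) by (simp_all add: sign_swap_id)
qed

lemma bracket_eq_0_left:
  assumes ij: "i < k" "j < k" "i \<noteq> j" and eq: "a i = a j"
  shows "bracket k a c = 0"
proof
  fix M
  let ?t = "transpose i j"
  have t: "?t \<in> Sym k" using ij by (simp add: permutes_swap_id)
  have at: "a (?t m) = a m" for m using eq by (auto simp: transpose_def)
  have "bracket k a c M = (\<Sum>\<rho>\<in>Sym k. if image_mset (\<lambda>m. a m + c ((\<rho> \<circ> ?t) m)) (mset_set {..<k}) = M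
     then of_int (sign (\<rho> \<circ> ?t)) else 0)"
    unfolding bracket_def by (rule sum_Sym_right[OF t, symmetric])
  also have "\<dots> = (\<Sum>\<rho>\<in>Sym k. - (if image_mset (\<lambda>m. a m + c (\<rho> m)) (mset_set {..<k}) = M
     then of_int (sign \<rho>) else 0))"
  proof (rule sum.cong[OF refl])
    fix \<rho> assume r: "\<rho> \<in> Sym k"
    have "image_mset (\<lambda>m. a m + c ((\<rho> \<circ> ?t) m)) (mset_set {..<k}) = image_mset (\<lambda>m. a m + c (\<rho> m)) (mset_set {..<k})"
      using image_mset_Sym[OF t, of "\<lambda>m. a m + c (\<rho> m)"] by (simp add: at)
    then show "(if image_mset (\<lambda>m. a m + c ((\<rho> \<circ> ?t) m)) (mset_set {..<k}) = M
       then of_int (sign (\<rho> \<circ> ?t)) else 0) = - (if image_mset (\<lambda>m. a m + c (\<rho> m)) (mset_set {..<k}) = M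
       then of_int (sign \<rho>) else (0::rat))"
      using sign_comp_transpose(1)[OF r ij(3)] by simp
  qed
  also have "\<dots> = - bracket k a c M" by (simp add: bracket_def sum_negf)
  finally show "bracket k a c M = 0 M" by simp
qed

lemma bracket_eq_0_right:
  assumes ij: "i < k" "j < k" "i \<noteq> j" and eq: "c i = c j"
  shows "bracket k a c = 0"
proof
  fix M
  let ?t = "transpose i j"
  have t: "?t \<in> Sym k" using ij by (simp add: permutes_swap_id)
  have ct: "c (?t m) = c m" for m using eq by (auto simp: transpose_def)
  have "bracket k a c M = (\<Sum>\<rho>\<in>Sym k. if image_mset (\<lambda>m. a m + c ((?t \<circ> \<rho>) m)) (mset_set {..<k}) = M
     then of_int (sign (?t \<circ> \<rho>)) else 0)"
    unfolding bracket_def by (rule sum_Sym_left[OF t, symmetric])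
  also have "\<dots> = (\<Sum>\<rho>\<in>Sym k. - (if image_mset (\<lambda>m. a m + c (\<rho> m)) (mset_set {..<k}) = M
     then of_int (sign \<rho>) else 0))"
    using sign_comp_transpose(2)[OF _ ij(3)] by (intro sum.cong refl) (simp add: ct del: mem_Collect_eq)
  also have "\<dots> = - bracket k a c M" by (simp add: bracket_def sum_negf)
  finally show "bracket k a c M = 0 M" by simp
qed

definition shift :: "(nat \<Rightarrow> nat) \<Rightarrow> nat set \<Rightarrow> nat \<Rightarrow> nat" where
  "shift a S i = a i + (if i \<in> S then 1 else 0)"

text \<open>The monomials of both sides agree under \<open>S \<mapsto> \<rho> ` S\<close>. In the language of alternants, this says that
  multiplying by the \<open>r\<close>-th elementary symmetric function may be moved from one factor to the other.\<close>

lemma bracket_shift: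
  "(\<Sum>S | S \<subseteq> {..<k} \<and> card S = r. bracket k (shift a S) c) =
   (\<Sum>S | S \<subseteq> {..<k} \<and> card S = r. bracket k a (shift c S))"
proof
  fix M
  let ?P = "{S. S \<subseteq> {..<k} \<and> card S = r}"
  let ?g = "\<lambda>\<rho> S. if image_mset (\<lambda>i. a i + c (\<rho> i) + (if i \<in> S then 1 else 0)) (mset_set {..<k}) = M
     then of_int (sign \<rho>) else (0::rat)"
  have "(\<Sum>S\<in>?P. bracket k (shift a S) c) M = (\<Sum>S\<in>?P. \<Sum>\<rho>\<in>Sym k. ?g \<rho> S)"
    by (simp add: sum_fun_apply bracket_def shift_def add_ac)
  also have "\<dots> = (\<Sum>\<rho>\<in>Sym k. \<Sum>S\<in>?P. ?g \<rho> S)" by (rule sum.swap)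
  also have "\<dots> = (\<Sum>\<rho>\<in>Sym k. \<Sum>S\<in>?P. if image_mset (\<lambda>i. a i + shift c S (\<rho> i)) (mset_set {..<k}) = M
     then of_int (sign \<rho>) else 0)"
  proof (rule sum.cong[OF refl])
    fix \<rho> assume r: "\<rho> \<in> Sym k"
    have inj: "inj_on \<rho> A" for A using r permutes_inj_on by auto
    have bij: "bij_betw (\<lambda>S. \<rho> -` S) ?P ?P"
    proof (rule bij_betw_byWitness[of _ "\<lambda>S. \<rho> ` S"])
      have sur: "surj \<rho>" and inj': "inj \<rho>" using r permutes_surj permutes_inj by auto
      show "\<forall>S\<in>?P. \<rho> ` (\<rho> -` S) = S" using surj_image_vimage_eq[OF sur] by blast
      show "\<forall>S\<in>?P. \<rho> -` (\<rho> ` S) = S" using inj_vimage_image_eq[OF inj'] by blast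
      show "(\<lambda>S. \<rho> -` S) ` ?P \<subseteq> ?P"
      proof clarify
        fix S assume S: "S \<subseteq> {..<k}" "r = card S"
        have "card (\<rho> -` S) = card (\<rho> ` (\<rho> -` S))" by (rule card_image[OF inj, symmetric])
        also have "\<dots> = card S" by (simp only: surj_image_vimage_eq[OF sur])
        finally show "\<rho> -` S \<subseteq> {..<k} \<and> card (\<rho> -` S) = card S"
          using S Sym_less[OF r] by auto
      qed
      show "(\<lambda>S. \<rho> ` S) ` ?P \<subseteq> ?P"
        using Sym_less[OF r] card_image[OF inj] by auto
    qed
    have "(\<Sum>S\<in>?P. ?g \<rho> S) = (\<Sum>S\<in>?P. ?g \<rho> (\<rho> -` S))"
      by (rule sum.reindex_bij_betw[OF bij, symmetric])
    then show "(\<Sum>S\<in>?P. ?g \<rho> S) = (\<Sum>S\<in>?P. if image_mset (\<lambda>i. a i + shift c S (\<rho> i)) (mset_set {..<k}) = M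
       then of_int (sign \<rho>) else 0)"
      by (simp add: shift_def add_ac)
  qed
  also have "\<dots> = (\<Sum>S\<in>?P. bracket k a (shift c S)) M"
    by (subst sum.swap) (simp add: sum_fun_apply bracket_def)
  finally show "(\<Sum>S\<in>?P. bracket k (shift a S) c) M = (\<Sum>S\<in>?P. bracket k a (shift c S)) M" .
qed

section \<open>Spanning by brackets of partitions whose length equals their rank\<close>

lemma rank_iff:
  assumes p: "is_partition n \<mu>"
  shows "i < rank \<mu> \<longleftrightarrow> i < part \<mu> i"
proof -
  define A where "A = {i. 1 \<le> i \<and> i \<le> length \<mu> \<and> i \<le> \<mu> ! (i - 1)}"
  have fA: "finite (insert 0 A)" by (simp add: A_def)
  have r: "rank \<mu> = Max (insert 0 A)" by (simp add: rank_def A_def)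
  show ?thesis
  proof
    assume i: "i < rank \<mu>"
    have "rank \<mu> \<in> insert 0 A" unfolding r by (rule Max_in[OF fA]) simp
    then have "rank \<mu> \<le> part \<mu> (rank \<mu> - 1)" using i by (auto simp: A_def part_def)
    also have "\<dots> \<le> part \<mu> i" using i by (intro part_antimono[OF p]) simp
    finally show "i < part \<mu> i" using i by simp
  next
    assume i: "i < part \<mu> i"
    then have "i < length \<mu>" by (simp add: part_def split: if_splits)
    then have "Suc i \<in> insert 0 A" using i by (simp add: A_def part_def)
    then have "Suc i \<le> rank \<mu>" unfolding r by (rule Max_ge[OF fA])
    then show "i < rank \<mu>" by simp
  qed
qed

definition square_partitions :: "nat \<Rightarrow> nat \<Rightarrow> nat list set" where
  "square_partitions n k = {\<nu>. is_partition n \<nu> \<and> rank \<nu> = k \<and> length \<nu> = k}"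

text \<open>For \<open>i < rank \<nu>\<close> this is the Frobenius arm length plus one, and there
  the truncated subtraction is exact (\<open>rank_iff\<close>).\<close>

abbreviation reduced :: "nat list \<Rightarrow> nat \<Rightarrow> nat" where
  "reduced \<nu> i \<equiv> part \<nu> i - i"

definition sdec :: "nat \<Rightarrow> (nat \<Rightarrow> nat) \<Rightarrow> bool" where
  "sdec k a \<longleftrightarrow> (\<forall>i j. i < j \<longrightarrow> j < k \<longrightarrow> a j < a i)"

definition sinc :: "nat \<Rightarrow> (nat \<Rightarrow> nat) \<Rightarrow> bool" where
  "sinc k c \<longleftrightarrow> (\<forall>i j. i < j \<longrightarrow> j < k \<longrightarrow> c i < c j)"

lemma sinc_ge:
  assumes "sinc k c" "i < k" shows "i \<le> c i"
  using assms(2)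
proof (induction i)
  case (Suc i)
  then have "c i < c (Suc i)" using assms(1) by (simp add: sinc_def)
  then show ?case using Suc by simp
qed simp

text \<open>Exchange argument: an element of S outside the top segment has weight at most j, a
  missing element of the segment at least \<open>Suc j\<close>.\<close>

lemma sum_subset_less:
  assumes S: "S \<subseteq> {..<k}" "card S = card {j..<k}" "S \<noteq> {j..<k}"
  shows "(\<Sum>i\<in>S. Suc i) < (\<Sum>i\<in>{j..<k}. Suc i)"
proof -
  let ?R = "{j..<k}"
  have fin: "finite S" using S(1) finite_subset by blast
  have "card (S - ?R) = card (?R - S)"
    using card_Diff_subset_Int[of S ?R] card_Diff_subset_Int[of ?R S] fin S(2) by (simp add: Int_commute)
  moreover have ne: "S - ?R \<noteq> {}"
  proof
    assume "S - ?R = {}"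
    then have "S = ?R" using S(2) by (intro card_subset_eq) auto
    then show False using S(3) by simp
  qed
  moreover have "(\<Sum>i\<in>S - ?R. Suc i) \<le> card (S - ?R) * j"
  proof -
    have "Suc i \<le> j" if "i \<in> S - ?R" for i using that S(1) by auto
    then show ?thesis using sum_bounded_above[of "S - ?R" Suc j] by simp
  qed
  moreover have "card (?R - S) * Suc j \<le> (\<Sum>i\<in>?R - S. Suc i)"
    using sum_bounded_below[of "?R - S" "Suc j" Suc] by simp
  moreover have "0 < card (S - ?R)" using ne fin by (simp add: card_gt_0_iff)
  ultimately have "(\<Sum>i\<in>S - ?R. Suc i) < (\<Sum>i\<in>?R - S. Suc i)" by simp
  moreover have "(\<Sum>i\<in>S. Suc i) = (\<Sum>i\<in>S \<inter> ?R. Suc i) + (\<Sum>i\<in>S - ?R. Suc i)"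
    by (rule sum.Int_Diff[OF fin])
  moreover have "(\<Sum>i\<in>?R. Suc i) = (\<Sum>i\<in>S \<inter> ?R. Suc i) + (\<Sum>i\<in>?R - S. Suc i)"
    using sum.Int_Diff[of ?R Suc S] by (simp add: Int_commute)
  ultimately show ?thesis by simp
qed

lemma sum_shift_weighted:
  assumes "S \<subseteq> {..<k}"
  shows "(\<Sum>i<k. f i * shift c S i) = (\<Sum>i<k. f i * c i) + (\<Sum>i\<in>S. f i)"
proof -
  have "(\<Sum>i<k. f i * shift c S i) = (\<Sum>i<k. f i * c i + (if i \<in> S then f i else 0))"
    by (intro sum.cong) (auto simp: shift_def algebra_simps)
  then show ?thesis using assms by (simp add: sum.distrib sum.If_cases Int_absorb1)
qed

text \<open>Adding the staircase back to a gives the parts of \<nu>; positivity of all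
  \<open>a i\<close> says that the diagonal of \<nu> has full length k.\<close>

lemma bracket_base:
  assumes a: "sdec k a" "\<And>i. i < k \<Longrightarrow> 0 < a i" and c: "\<And>i. i < k \<Longrightarrow> c i = i"
  shows "\<exists>\<nu>\<in>square_partitions (\<Sum>i<k. a i + c i) k. bracket k a c = bracket k (reduced \<nu>) id"
proof -
  define \<nu> where "\<nu> = map (\<lambda>i. a i + i) [0..<k]"
  have part: "part \<nu> i = (if i < k then a i + i else 0)" for i by (simp add: \<nu>_def part_def)
  have dec: "a j + j \<le> a i + i" if "i < j" "j < k" for i j
    using that
  proof (induction j)
    case (Suc j)
    have "a (Suc j) < a j" using a(1) Suc.prems by (simp add: sdec_def)
    then show ?case using Suc by (cases "i = j") auto
  qed simp
  have p: "is_partition (\<Sum>i<k. a i + c i) \<nu>"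
    unfolding is_partition_def
  proof (intro conjI)
    show "sorted_wrt (\<ge>) \<nu>" unfolding sorted_wrt_iff_nth_less \<nu>_def using dec by simp
    show "0 \<notin> set \<nu>"
    proof
      assume "0 \<in> set \<nu>"
      then obtain i where "i < k" "a i + i = 0" by (auto simp: \<nu>_def)
      then show False using a(2)[of i] by auto
    qed
    have "(\<Sum>i<k. a i + c i) = (\<Sum>i<k. a i + i)" using c by simp
    then show "sum_list \<nu> = (\<Sum>i<k. a i + c i)"
      by (simp add: \<nu>_def sum_list_sum_nth atLeast0LessThan)
  qed
  have "i < rank \<nu> \<longleftrightarrow> i < k" for i
    unfolding rank_iff[OF p] using a(2)[of i] by (simp add: part)
  then have "rank \<nu> = k" by (metis linorder_neqE_nat less_irrefl)
  then have "\<nu> \<in> square_partitions (\<Sum>i<k. a i + c i) k"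
    using p by (simp add: square_partitions_def) (simp add: \<nu>_def)
  moreover have "bracket k a c = bracket k (reduced \<nu>) id"
    by (rule bracket_cong) (simp_all add: part c)
  ultimately show ?thesis by blast
qed

text \<open>Lower c by one on a top segment R and apply \<open>bracket_shift\<close> to the result
  c'. The bracket of c is then a combination of brackets with c' and of brackets with c' raised
  along sets S other than R, of the same size. All of them have smaller weight or vanish because of
  a repeated entry.\<close>

lemma bracket_in_span:
  assumes "sdec k a" "\<And>i. i < k \<Longrightarrow> 0 < a i" "sinc k c"
  shows "bracket k a c \<in> qvec.span ((\<lambda>\<nu>. bracket k (reduced \<nu>) id) ` square_partitions (\<Sum>i<k. a i + c i) k)"
  using assms
\<comment> \<open>The weights are \<open>Suc i\<close> rather than \<open>i\<close>, so that the
  measure also drops if index 0 is the only one that is lowered.\<close>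
proof (induction "\<Sum>i<k. Suc i * c i" arbitrary: a c rule: less_induct)
  case less
  note a = less.prems(1,2) and c = less.prems(3)
  define N where "N = (\<Sum>i<k. a i + c i)"
  define V where "V = qvec.span ((\<lambda>\<nu>. bracket k (reduced \<nu>) id) ` square_partitions N k)"
  have "bracket k a c \<in> V"
  proof (cases "\<forall>i<k. c i = i")
    case True
    then obtain \<nu> where "\<nu> \<in> square_partitions N k" "bracket k a c = bracket k (reduced \<nu>) id"
      using bracket_base[OF a, of c] unfolding N_def by blast
    then show ?thesis unfolding V_def by (simp add: qvec.span_base)
  next
    case False
    define j where "j = (LEAST j. j < k \<and> c j \<noteq> j)"
    have j: "j < k" "c j \<noteq> j" using LeastI_ex[of "\<lambda>j. j < k \<and> c j \<noteq> j"] False by (auto simp: j_def)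
    have low: "c i = i" if "i < j" for i
      using not_less_Least[of i "\<lambda>j. j < k \<and> c j \<noteq> j"] that j(1) unfolding j_def[symmetric] by auto
    have cj: "j < c i" if "j \<le> i" "i < k" for i
    proof -
      have "j < c j" using sinc_ge[OF c j(1)] j(2) by simp
      moreover have "c j \<le> c i" using c that by (cases "i = j") (auto simp: sinc_def intro: less_imp_le)
      ultimately show ?thesis by simp
    qed
    \<comment> \<open>From j on every \<open>c i\<close> exceeds j, so all these entries can be
      lowered and c' remains strictly increasing. As a top segment, R has the strictly largest
      weight among the sets of its size.\<close>
    define R where "R = {j..<k}"
    define c' where "c' i = (if i \<in> R then c i - 1 else c i)" for i
    have R: "R \<subseteq> {..<k}" "R \<noteq> {}" using j by (auto simp: R_def)
    have cR: "shift c' R i = c i" if "i < k" for i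
      using cj[of i] that by (auto simp: shift_def c'_def R_def)
    have c': "sinc k c'"
      unfolding sinc_def
    proof (intro allI impI)
      fix i i' assume i: "i < i'" "i' < k"
      then have "c i < c i'" using c by (simp add: sinc_def)
      then show "c' i < c' i'"
        using cj[of i] cj[of i'] low[of i] i by (auto simp: c'_def R_def)
    qed
    let ?P = "{S. S \<subseteq> {..<k} \<and> card S = card R}"
    have fP: "finite ?P" by simp
    have RP: "R \<in> ?P" using R by simp
    have w: "(\<Sum>i<k. Suc i * c i) = (\<Sum>i<k. Suc i * c' i) + (\<Sum>i\<in>R. Suc i)"
      using sum_shift_weighted[OF R(1), of Suc c'] cR by simp
    have N': "(\<Sum>i<k. c i) = (\<Sum>i<k. c' i) + card R"
      using sum_shift_weighted[OF R(1), of "\<lambda>_. 1" c'] cR by simp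
    have N: "N = (\<Sum>i<k. a i) + (\<Sum>i<k. c' i) + card R" by (simp add: N_def sum.distrib N')
    have 1: "bracket k (shift a S) c' \<in> V" if S: "S \<in> ?P" for S
    proof (cases "sdec k (shift a S)")
      case True
      have "(\<Sum>i<k. Suc i * c' i) < (\<Sum>i<k. Suc i * c i)"
        unfolding w using R(2) by (simp add: sum_pos2 R_def sum_pos)
      moreover have "(\<Sum>i<k. shift a S i + c' i) = N"
        using sum_shift_weighted[of S k "\<lambda>_. 1" a] S by (simp add: N sum.distrib)
      ultimately show ?thesis
        using less.hyps[OF _ True _ c'] a(2) unfolding V_def by (simp add: shift_def)
    next
      case False
      then obtain i i' where i: "i < i'" "i' < k" "shift a S i \<le> shift a S i'" by (auto simp: sdec_def not_less)
      then have "shift a S i = shift a S i'" using a(1) by (auto simp: sdec_def shift_def split: if_splits) (meson i leD le_antisym less_or_eq_imp_le not_less_eq_eq)+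
      then have "bracket k (shift a S) c' = 0" using i by (intro bracket_eq_0_left[of i k i']) auto
      then show ?thesis by (simp add: V_def qvec.span_zero)
    qed
    have 2: "bracket k a (shift c' S) \<in> V" if S: "S \<in> ?P - {R}" for S
    proof (cases "sinc k (shift c' S)")
      case True
      have "(\<Sum>i\<in>S. Suc i) < (\<Sum>i\<in>R. Suc i)"
        unfolding R_def by (rule sum_subset_less) (use S in \<open>auto simp: R_def\<close>)
      then have "(\<Sum>i<k. Suc i * shift c' S i) < (\<Sum>i<k. Suc i * c i)"
        unfolding w using sum_shift_weighted[of S k Suc c'] S by simp
      moreover have "(\<Sum>i<k. a i + shift c' S i) = N"
        using sum_shift_weighted[of S k "\<lambda>_. 1" c'] S by (simp add: N sum.distrib)
      ultimately show ?thesis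
        using less.hyps[OF _ a(1) a(2) True] unfolding V_def by simp
    next
      case False
      \<comment> \<open>Raising entries by at most one can break a strict inequality between natural
        numbers only by turning it into an equality.\<close>
      then obtain i i' where i: "i < i'" "i' < k" "shift c' S i' \<le> shift c' S i" by (auto simp: sinc_def not_less)
      have "c' i < c' i'" using c' i by (simp add: sinc_def)
      then have "shift c' S i = shift c' S i'" using i(3) by (simp add: shift_def split: if_splits)
      then have "bracket k a (shift c' S) = 0" using i by (intro bracket_eq_0_right[of i k i']) auto
      then show ?thesis by (simp add: V_def qvec.span_zero)
    qed
    have "bracket k a c = bracket k a (shift c' R)" by (rule bracket_cong) (simp_all add: cR)
    also have "\<dots> = (\<Sum>S\<in>?P. bracket k a (shift c' S)) - (\<Sum>S\<in>?P - {R}. bracket k a (shift c' S))"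
      by (simp add: sum.remove[OF fP RP])
    also have "\<dots> = (\<Sum>S\<in>?P. bracket k (shift a S) c') - (\<Sum>S\<in>?P - {R}. bracket k a (shift c' S))"
      by (simp add: bracket_shift)
    also have "\<dots> \<in> V"
      using 1 2 unfolding V_def by (intro qvec.span_diff qvec.span_sum) auto
    finally show ?thesis .
  qed
  then show ?case by (simp add: V_def N_def)
qed

section \<open>Independence of the brackets through sums of squares\<close>

lemma abel_sum:
  fixes b e :: "nat \<Rightarrow> int"
  shows "(\<Sum>i<Suc m. b i * e i) = b m * (\<Sum>i<Suc m. e i) + (\<Sum>t<m. (b t - b (Suc t)) * (\<Sum>i<Suc t. e i))"
  by (induction m) (simp_all add: algebra_simps)

text \<open>Rearrangement inequality: the difference of the two sums is twice the sum of
  \<open>b i\<close> times \<rho> i - i. Summation by parts expresses it through the positive gaps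
  of b and the prefix sums of \<rho> i - i, which are nonnegative and all vanish only for the
  identity.\<close>

lemma sum_squares_perm:
  fixes b :: "nat \<Rightarrow> nat"
  assumes b: "sdec k b" and r: "\<rho> \<in> Sym k"
  shows "(\<Sum>i<k. (b i + i)\<^sup>2) \<le> (\<Sum>i<k. (b i + \<rho> i)\<^sup>2)"
    and "(\<Sum>i<k. (b i + i)\<^sup>2) = (\<Sum>i<k. (b i + \<rho> i)\<^sup>2) \<Longrightarrow> \<rho> = id"
proof -
  define e where "e i = int (\<rho> i) - int i" for i
  define E where "E t = (\<Sum>i<t. e i)" for t
  have E0: "0 \<le> E t" for t using sum_perm_prefix_ge[OF r, of t] by (simp add: E_def e_def sum_subtractf)
  have perm: "(\<Sum>i<k. f (\<rho> i)) = (\<Sum>i<k. f i)" for f :: "nat \<Rightarrow> int"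
    by (rule sum.permute[symmetric, unfolded comp_def]) (use r in simp)
  have Ek: "E k = 0" by (simp add: E_def e_def sum_subtractf perm)
  have diff: "int (\<Sum>i<k. (b i + \<rho> i)\<^sup>2) - int (\<Sum>i<k. (b i + i)\<^sup>2) = 2 * (\<Sum>i<k. int (b i) * e i)"
  proof -
    have "int (\<Sum>i<k. (b i + \<rho> i)\<^sup>2) - int (\<Sum>i<k. (b i + i)\<^sup>2) =
        (\<Sum>i<k. 2 * (int (b i) * e i)) + ((\<Sum>i<k. (int (\<rho> i))\<^sup>2) - (\<Sum>i<k. (int i)\<^sup>2))"
      unfolding of_nat_sum sum_subtractf[symmetric] sum.distrib[symmetric]
      by (intro sum.cong refl) (simp add: e_def power2_eq_square algebra_simps)
    then show ?thesis using perm[of "\<lambda>i. (int i)\<^sup>2"] by (simp add: sum_distrib_left)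
  qed
  show le: "(\<Sum>i<k. (b i + i)\<^sup>2) \<le> (\<Sum>i<k. (b i + \<rho> i)\<^sup>2)"
    and "(\<Sum>i<k. (b i + i)\<^sup>2) = (\<Sum>i<k. (b i + \<rho> i)\<^sup>2) \<Longrightarrow> \<rho> = id"
  proof -
    consider "k = 0" | m where "k = Suc m" by (cases k) auto
    then have "(\<Sum>i<k. (b i + i)\<^sup>2) \<le> (\<Sum>i<k. (b i + \<rho> i)\<^sup>2) \<and>
      ((\<Sum>i<k. (b i + i)\<^sup>2) = (\<Sum>i<k. (b i + \<rho> i)\<^sup>2) \<longrightarrow> \<rho> = id)"
    proof cases
      case 1
      then show ?thesis using r by auto
    next
      case 2
      have s: "(\<Sum>i<k. int (b i) * e i) = (\<Sum>t<m. (int (b t) - int (b (Suc t))) * E (Suc t))"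
        using abel_sum[of "\<lambda>i. int (b i)" e m] Ek by (simp add: 2 E_def)
      have pos: "0 < int (b t) - int (b (Suc t))" if "t < m" for t
        using b that 2 by (simp add: sdec_def)
      have nn: "0 \<le> (int (b t) - int (b (Suc t))) * E (Suc t)" if "t < m" for t
        using pos[OF that] E0 by simp
      then have "0 \<le> (\<Sum>i<k. int (b i) * e i)" unfolding s by (intro sum_nonneg) auto
      moreover have "\<rho> = id" if sum0: "(\<Sum>i<k. int (b i) * e i) = 0"
      proof (rule perm_eq_id[OF r])
        fix t assume t: "t \<le> k"
        have z: "(int (b t) - int (b (Suc t))) * E (Suc t) = 0" if "t < m" for t
          using sum_nonneg_eq_0_iff[of "{..<m}" "\<lambda>t. (int (b t) - int (b (Suc t))) * E (Suc t)"] nn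
            that sum0 unfolding s by auto
        have "E t = 0"
        proof (cases t)
          case (Suc t')
          then show ?thesis using z[of t'] pos[of t'] Ek t 2 by (cases "t' < m") (auto simp: less_Suc_eq)
        qed (simp add: E_def)
        then show "(\<Sum>i<t. int (\<rho> i)) \<le> (\<Sum>i<t. int i)" by (simp add: E_def e_def sum_subtractf)
      qed
      moreover have "X \<le> Y \<and> (X = Y \<longrightarrow> P)" if "int Y - int X = 2 * z" "0 \<le> z" "z = 0 \<Longrightarrow> P" for X Y :: nat and z P
        using that by auto
      ultimately show ?thesis using diff by blast
    qed
    then show "(\<Sum>i<k. (b i + i)\<^sup>2) \<le> (\<Sum>i<k. (b i + \<rho> i)\<^sup>2)"
      "(\<Sum>i<k. (b i + i)\<^sup>2) = (\<Sum>i<k. (b i + \<rho> i)\<^sup>2) \<Longrightarrow> \<rho> = id" by blast+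
  qed
qed

lemma square_partition_reduced:
  assumes "\<nu> \<in> square_partitions n k"
  shows "sdec k (reduced \<nu>)" "\<And>i. i < k \<Longrightarrow> 0 < reduced \<nu> i" "\<And>i. i < k \<Longrightarrow> reduced \<nu> i + i = part \<nu> i"
    "image_mset (part \<nu>) (mset_set {..<k}) = mset \<nu>"
proof -
  have p: "is_partition n \<nu>" "rank \<nu> = k" "length \<nu> = k" using assms by (auto simp: square_partitions_def)
  have g: "i < part \<nu> i" if "i < k" for i using rank_iff[OF p(1)] p(2) that by blast
  show "0 < reduced \<nu> i" "reduced \<nu> i + i = part \<nu> i" if "i < k" for i using g[OF that] by auto
  show "sdec k (reduced \<nu>)"
    unfolding sdec_def
  proof (intro allI impI)
    fix i j assume "i < j" "j < k"
    then show "reduced \<nu> j < reduced \<nu> i" using g[of j] part_antimono[OF p(1), of i j] by simp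
  qed
  show "image_mset (part \<nu>) (mset_set {..<k}) = mset \<nu>"
    unfolding mset_eq_image_nth[of \<nu>] p(3) by (rule image_mset_lessThan_cong) (simp add: part_def p(3))
qed

lemma finite_square_partitions: "finite (square_partitions n k)"
  by (rule finite_subset[OF _ finite_partitions[of n]]) (auto simp: square_partitions_def)

lemma partition_mset_inject:
  assumes "is_partition n \<mu>" "is_partition n' \<nu>" "mset \<mu> = mset \<nu>"
  shows "\<mu> = \<nu>"
proof -
  have "sorted (rev \<mu>)" "sorted (rev \<nu>)" using assms by (simp_all add: is_partition_def sorted_wrt_rev)
  moreover have "mset (rev \<mu>) = mset (rev \<nu>)" using assms by simp
  ultimately have "rev \<mu> = rev \<nu>" by (metis properties_for_sort)
  then show ?thesis by simp
qed

text \<open>Among the partitions with nonzero coefficient take \<nu> with the least sum of squares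
  of its parts. By the rearrangement inequality its multiset of parts occurs in no other bracket
  with nonzero coefficient, and in its own bracket only as the diagonal term.\<close>

lemma bracket_independent:
  assumes 0: "\<And>\<nu>. \<nu> \<in> square_partitions n k \<Longrightarrow>
      (\<Sum>\<mu>\<in>square_partitions n k. x \<mu> * bracket k (reduced \<mu>) id (mset \<nu>)) = 0"
    and mu: "\<mu> \<in> square_partitions n k"
  shows "x \<mu> = 0"
proof (rule ccontr)
  assume "x \<mu> \<noteq> 0"
  let ?I = "square_partitions n k"
  define Q where "Q \<nu> = (\<Sum>i<k. (part \<nu> i)\<^sup>2)" for \<nu>
  have "\<exists>\<nu>. (\<nu> \<in> ?I \<and> x \<nu> \<noteq> 0) \<and> (\<forall>\<nu>'. \<nu>' \<in> ?I \<and> x \<nu>' \<noteq> 0 \<longrightarrow> Q \<nu> \<le> Q \<nu>')"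
    using ex_has_least_nat[of "\<lambda>\<nu>. \<nu> \<in> ?I \<and> x \<nu> \<noteq> 0" \<mu> Q] mu \<open>x \<mu> \<noteq> 0\<close> by blast
  then obtain \<nu> where nu: "\<nu> \<in> ?I" "x \<nu> \<noteq> 0" and min: "\<And>\<nu>'. \<nu>' \<in> ?I \<Longrightarrow> x \<nu>' \<noteq> 0 \<Longrightarrow> Q \<nu> \<le> Q \<nu>'" by blast
  have Qm: "(\<Sum>i<k. (f i)\<^sup>2) = Q \<nu>" if "image_mset f (mset_set {..<k}) = mset \<nu>" for f
  proof -
    have "(\<Sum>i<k. (f i)\<^sup>2) = sum_mset (image_mset (\<lambda>x. x\<^sup>2) (image_mset f (mset_set {..<k})))"
      by (simp add: sum_unfold_sum_mset multiset.map_comp comp_def)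
    also have "\<dots> = sum_mset (image_mset (\<lambda>x. x\<^sup>2) (image_mset (part \<nu>) (mset_set {..<k})))"
      by (simp only: that square_partition_reduced(4)[OF nu(1)])
    also have "\<dots> = Q \<nu>" by (simp add: Q_def sum_unfold_sum_mset multiset.map_comp comp_def)
    finally show ?thesis .
  qed
  have *: "\<rho> = id \<and> \<kappa> = \<nu>" if k: "\<kappa> \<in> ?I" "x \<kappa> \<noteq> 0" and r: "\<rho> \<in> Sym k"
    and eq: "image_mset (\<lambda>i. reduced \<kappa> i + id (\<rho> i)) (mset_set {..<k}) = mset \<nu>" for \<kappa> \<rho>
  proof -
    have "(\<Sum>i<k. (reduced \<kappa> i + \<rho> i)\<^sup>2) = Q \<nu>" using Qm[OF eq] by simp
    moreover have "(\<Sum>i<k. (reduced \<kappa> i + i)\<^sup>2) = Q \<kappa>"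
      unfolding Q_def using square_partition_reduced(3)[OF k(1)] by (intro sum.cong) auto
    ultimately have "\<rho> = id"
      using sum_squares_perm[OF square_partition_reduced(1)[OF k(1)] r] min[OF k] by simp
    moreover have "mset \<kappa> = mset \<nu>"
    proof -
      have "image_mset (\<lambda>i. reduced \<kappa> i + id (\<rho> i)) (mset_set {..<k}) = image_mset (part \<kappa>) (mset_set {..<k})"
        using \<open>\<rho> = id\<close> square_partition_reduced(3)[OF k(1)] by (intro image_mset_lessThan_cong) simp
      then show ?thesis using eq square_partition_reduced(4)[OF k(1)] by simp
    qed
    then have "\<kappa> = \<nu>" using k(1) nu(1) partition_mset_inject by (auto simp: square_partitions_def)
    ultimately show ?thesis by blast
  qed
  have "x \<kappa> * bracket k (reduced \<kappa>) id (mset \<nu>) = (if \<kappa> = \<nu> then x \<nu> else 0)" if k: "\<kappa> \<in> ?I" for \<kappa>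
  proof (cases "x \<kappa> = 0")
    case False
    have "image_mset (\<lambda>i. reduced \<nu> i + id (id i)) (mset_set {..<k}) = mset \<nu>"
      using square_partition_reduced(3)[OF nu(1)] square_partition_reduced(4)[OF nu(1)]
        image_mset_lessThan_cong[of k "\<lambda>i. reduced \<nu> i + i" "part \<nu>"] by simp
    then have "bracket k (reduced \<kappa>) id (mset \<nu>) = (\<Sum>\<rho>\<in>Sym k. if \<rho> = id then (if \<kappa> = \<nu> then 1 else 0) else 0)"
      unfolding bracket_def
    proof (intro sum.cong refl)
      fix \<rho> assume r: "\<rho> \<in> Sym k"
      show "(if image_mset (\<lambda>i. reduced \<kappa> i + id (\<rho> i)) (mset_set {..<k}) = mset \<nu> then of_int (sign \<rho>) else 0) =
          (if \<rho> = id then if \<kappa> = \<nu> then 1 else 0 else (0::rat))"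
      proof (cases "image_mset (\<lambda>i. reduced \<kappa> i + id (\<rho> i)) (mset_set {..<k}) = mset \<nu>")
        case True
        then have "\<rho> = id \<and> \<kappa> = \<nu>" by (rule *[OF k False r])
        then show ?thesis using True by simp
      next
        case ne: False
        then have "\<not> (\<rho> = id \<and> \<kappa> = \<nu>)" using \<open>image_mset (\<lambda>i. reduced \<nu> i + id (id i)) _ = _\<close> by auto
        then show ?thesis using ne by auto
      qed
    qed
    then show ?thesis by simp
  qed (use nu in auto)
  then have "(\<Sum>\<kappa>\<in>?I. x \<kappa> * bracket k (reduced \<kappa>) id (mset \<nu>)) = (\<Sum>\<kappa>\<in>?I. if \<kappa> = \<nu> then x \<nu> else 0)"
    by (rule sum.cong[OF refl])
  then show False using 0[OF nu(1)] nu finite_square_partitions by simp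
qed

section \<open>The bottom part of the Jacobi-Trudi sum\<close>

lemma enumerate_complement:
  assumes "finite A" "card A = k"
  shows "\<exists>c. sinc k c \<and> c ` {..<k} = A"
proof -
  define xs where "xs = sorted_list_of_set A"
  have xs: "sorted_wrt (<) xs" "set xs = A" "length xs = k"
    using assms by (simp_all add: xs_def)
  have "sinc k (\<lambda>i. xs ! i)"
    using xs(1,3) by (simp add: sinc_def sorted_wrt_iff_nth_less)
  moreover have "(\<lambda>i. xs ! i) ` {..<k} = A"
    using xs(2,3) by (auto simp: set_conv_nth)
  ultimately show ?thesis by blast
qed

lemma sinc_inj_on: "sinc k c \<Longrightarrow> inj_on c {..<k}"
  unfolding sinc_def by (rule linorder_inj_onI) fastforce+

lemma content_jt:
  fixes \<pi> :: "nat \<Rightarrow> nat"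
  assumes p: "is_partition n \<mu>" and z: "\<And>i. rank \<mu> \<le> i \<Longrightarrow> part \<mu> i + \<pi> i = i"
  defines "\<beta> \<equiv> \<lambda>i. int (part \<mu> i) - int i + int (\<pi> i)"
  shows "{i. \<beta> i \<noteq> 0} = {..<rank \<mu>}" "\<And>i. 0 \<le> \<beta> i"
    "content_mset \<beta> = image_mset (\<lambda>i. reduced \<mu> i + \<pi> i) (mset_set {..<rank \<mu>})"
proof -
  have hi: "\<beta> i = 0" if "rank \<mu> \<le> i" for i using z[OF that] by (simp add: \<beta>_def)
  have lo: "\<beta> i = int (reduced \<mu> i + \<pi> i)" "0 < \<beta> i" if "i < rank \<mu>" for i
    using rank_iff[OF p, of i] that by (auto simp: \<beta>_def)
  show 1: "{i. \<beta> i \<noteq> 0} = {..<rank \<mu>}" using hi lo(2) by (auto simp: not_le[symmetric]) (metis less_irrefl not_le)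
  show "0 \<le> \<beta> i" for i using hi[of i] lo(2)[of i] by (cases "i < rank \<mu>") auto
  show "content_mset \<beta> = image_mset (\<lambda>i. reduced \<mu> i + \<pi> i) (mset_set {..<rank \<mu>})"
    unfolding content_mset_def 1 by (rule image_mset_lessThan_cong) (simp only: lo(1) nat_int)
qed

text \<open>On permutations with \<open>rank \<mu>\<close> cycles only those terms of the Jacobi-Trudi sum survive in which
  every row below the Durfee square contributes a factor \<open>h\<^sub>0\<close>.\<close>

lemma jt_class_bottom:
  assumes p: "is_partition n \<mu>" and s: "\<sigma> \<in> Sym n" and q: "is_partition n \<nu>"
    and len: "length \<nu> = rank \<mu>" and ct: "cycle_type n \<sigma> = mset \<nu>"
  shows "jt_class n \<mu> \<sigma> = fixw n (ipart \<nu>) \<sigma> *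
    (\<Sum>\<pi> | \<pi> \<in> Sym (length \<mu>) \<and> (\<forall>i\<ge>rank \<mu>. part \<mu> i + \<pi> i = i).
      if image_mset (\<lambda>i. reduced \<mu> i + \<pi> i) (mset_set {..<rank \<mu>}) = mset \<nu> then of_int (sign \<pi>) else 0)"
proof -
  let ?k = "rank \<mu>"
  have orbs: "card (orbs n \<sigma>) = ?k" using size_cycle_type[of n \<sigma>] ct len by simp
  have nz: "0 \<notin> set \<nu>" using q by (simp add: is_partition_def)
  have key: "fixw n (jt_content \<mu> \<pi>) \<sigma> =
      (if (\<forall>i\<ge>?k. part \<mu> i + \<pi> i = i) \<and> image_mset (\<lambda>i. reduced \<mu> i + \<pi> i) (mset_set {..<?k}) = mset \<nu>
       then fixw n (ipart \<nu>) \<sigma> else 0)" for \<pi> :: "nat \<Rightarrow> nat"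
  proof -
    let ?b = "\<lambda>i. int (part \<mu> i) - int i + int (\<pi> i)"
    show ?thesis
    proof (cases "fixw n ?b \<sigma> = 0")
      case False
      then obtain u where u: "u \<in> words n ?b" "u \<circ> \<sigma> = u" by (auto simp: fixw_def)
      have fin: "finite {i. ?b i \<noteq> 0}" by (rule words_support(3)[OF u(1)])
      \<comment> \<open>The first k entries of the content are positive whatever \<pi> is. They
        already use up all k cycles, so the remaining entries must be 0.\<close>
      have sub: "{..<?k} \<subseteq> {i. ?b i \<noteq> 0}"
      proof
        fix i assume "i \<in> {..<?k}"
        then have "i < part \<mu> i" using rank_iff[OF p, of i] by simp
        then show "i \<in> {i. ?b i \<noteq> 0}" by simp
      qed
      moreover have "card {i. ?b i \<noteq> 0} \<le> ?k" using invariant_word_orbs(1)[OF s u] orbs by simp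
      ultimately have supp: "{..<?k} = {i. ?b i \<noteq> 0}"
        using card_seteq[OF fin, of "{..<?k}"] by simp
      have z: "part \<mu> i + \<pi> i = i" if "?k \<le> i" for i
      proof -
        have "i \<notin> {i. ?b i \<noteq> 0}" unfolding supp[symmetric] using that by simp
        then show ?thesis by simp
      qed
      have "card {i. ?b i \<noteq> 0} = card (orbs n \<sigma>)" by (simp add: supp[symmetric] orbs)
      then have "content_mset ?b = mset \<nu>" using invariant_word_orbs(2)[OF s u] ct by simp
      note cm = content_jt[OF p z]
      have "fixw n ?b \<sigma> = fixw n (ipart \<nu>) \<sigma>"
        by (rule fixw_content_cong[OF s]) (use fin cm(2) content_mset_part[OF nz] \<open>content_mset ?b = mset \<nu>\<close> in auto)
      then show ?thesis using z cm(3) \<open>content_mset ?b = mset \<nu>\<close> by simp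
    next
      case True
      have "fixw n ?b \<sigma> = fixw n (ipart \<nu>) \<sigma>"
        if z: "\<forall>i\<ge>?k. part \<mu> i + \<pi> i = i"
          and m: "image_mset (\<lambda>i. reduced \<mu> i + \<pi> i) (mset_set {..<?k}) = mset \<nu>"
      proof -
        note cm = content_jt[OF p z[rule_format]]
        show ?thesis
          by (rule fixw_content_cong[OF s]) (use cm content_mset_part[OF nz] m in auto)
      qed
      then show ?thesis using True by auto
    qed
  qed
  have "jt_class n \<mu> \<sigma> = (\<Sum>\<pi>\<in>Sym (length \<mu>).
      if (\<forall>i\<ge>?k. part \<mu> i + \<pi> i = i) then fixw n (ipart \<nu>) \<sigma> *
        (if image_mset (\<lambda>i. reduced \<mu> i + \<pi> i) (mset_set {..<?k}) = mset \<nu> then of_int (sign \<pi>) else 0) else 0)"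
    unfolding jt_class_def key by (intro sum.cong refl) auto
  also have "\<dots> = (\<Sum>\<pi>\<in>{\<pi>\<in>Sym (length \<mu>). \<forall>i\<ge>?k. part \<mu> i + \<pi> i = i}. fixw n (ipart \<nu>) \<sigma> *
        (if image_mset (\<lambda>i. reduced \<mu> i + \<pi> i) (mset_set {..<?k}) = mset \<nu> then of_int (sign \<pi>) else 0))"
    by (rule sum.inter_filter[symmetric]) simp
  finally show ?thesis by (simp add: sum_distrib_left)
qed

lemma rank_le_length: "is_partition n \<mu> \<Longrightarrow> rank \<mu> \<le> length \<mu>"
  using rank_iff[of n \<mu> "length \<mu>"] by (simp add: part_def not_less)

text \<open>From row k on, \<pi> i = i - \<mu>_i is forced, and these values are distinct. The first
  k rows are mapped onto the complementary values, listed increasingly by c; the factor e is the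
  sign of the permutation \<pi>0 that uses this list.\<close>

lemma bottom_sum_eq_bracket:
  assumes p: "is_partition n \<mu>"
  shows "\<exists>e c. e \<noteq> 0 \<and> sinc (rank \<mu>) c \<and> (length \<mu> = rank \<mu> \<longrightarrow> (\<forall>i<rank \<mu>. c i = i)) \<and>
    (\<Sum>i<rank \<mu>. reduced \<mu> i + c i) = n \<and>
    (\<forall>M. (\<Sum>\<pi> | \<pi> \<in> Sym (length \<mu>) \<and> (\<forall>i\<ge>rank \<mu>. part \<mu> i + \<pi> i = i).
      if image_mset (\<lambda>i. reduced \<mu> i + \<pi> i) (mset_set {..<rank \<mu>}) = M then of_int (sign \<pi>) else 0) =
      e * bracket (rank \<mu>) (reduced \<mu>) c M)"
proof -
  define k where "k = rank \<mu>"
  define l where "l = length \<mu>"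
  have kl: "k \<le> l" using rank_le_length[OF p] by (simp add: k_def l_def)
  have lo: "i < part \<mu> i" if "i < k" for i using rank_iff[OF p] that by (simp add: k_def)
  have hi: "part \<mu> i \<le> i" if "k \<le> i" for i using rank_iff[OF p, of i] that by (simp add: k_def not_less)
  have part0: "part \<mu> i = 0" if "l \<le> i" for i using that by (simp add: part_def l_def)
  have pos: "0 < part \<mu> i" if "i < l" for i using part_pos_iff[OF p] that by (simp add: l_def)
  define d where "d i = i - part \<mu> i" for i
  have dinj: "inj_on d {k..<l}"
  proof (rule linorder_inj_onI)
    fix i j assume "i < j" "i \<in> {k..<l}" "j \<in> {k..<l}"
    then show "d i \<noteq> d j" using part_antimono[OF p, of i j] hi[of i] hi[of j] by (auto simp: d_def)
  qed auto
  have dl: "d ` {k..<l} \<subseteq> {..<l}" by (auto simp: d_def)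
  define A where "A = {..<l} - d ` {k..<l}"
  have "card A = k"
    unfolding A_def using dl kl by (simp add: card_Diff_subset card_image[OF dinj])
  then obtain c where c: "sinc k c" "c ` {..<k} = A"
    using enumerate_complement[of A k] by (auto simp: A_def)
  have cinj: "inj_on c {..<k}" by (rule sinc_inj_on[OF c(1)])
  define \<pi>0 where "\<pi>0 i = (if i < k then c i else d i)" for i
  have pl: "\<pi>0 i < l" if "i < l" for i
    using that c(2) by (auto simp: \<pi>0_def d_def A_def)
  have p0: "\<pi>0 \<in> Sym l"
  proof -
    have "\<pi>0 permutes {..<l}"
    proof (rule inj_imp_permutes)
      show "inj_on \<pi>0 {..<l}"
      proof (rule inj_onI)
        fix x y assume xy: "x \<in> {..<l}" "y \<in> {..<l}" "\<pi>0 x = \<pi>0 y"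
        have "c i \<noteq> d j" if "i < k" "k \<le> j" "j < l" for i j
        proof -
          have "c i \<in> A" using c(2) that(1) by blast
          moreover have "d j \<notin> A" using that by (auto simp: A_def)
          ultimately show ?thesis by auto
        qed
        then show "x = y"
          using xy dinj cinj by (auto simp: \<pi>0_def inj_on_def split: if_splits) (metis not_less)+
      qed
      show "\<And>i. i \<notin> {..<l} \<Longrightarrow> \<pi>0 i = i" using part0 kl by (simp add: \<pi>0_def d_def)
    qed (use pl in auto)
    then show ?thesis by simp
  qed
  have z0: "part \<mu> i + \<pi>0 i = i" if "k \<le> i" for i using that hi[OF that] by (simp add: \<pi>0_def d_def)
  define G where "G = {\<pi> \<in> Sym l. \<forall>i\<ge>k. part \<mu> i + \<pi> i = i}"
  \<comment> \<open>The admissible permutations are exactly \<pi>0 preceded by a permutation of the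
    first k rows.\<close>
  have bij: "bij_betw (\<lambda>\<rho>. \<pi>0 \<circ> \<rho>) (Sym k) G"
  proof (rule bij_betw_byWitness[of _ "\<lambda>\<pi>. inv \<pi>0 \<circ> \<pi>"])
    show "\<forall>\<rho>\<in>Sym k. inv \<pi>0 \<circ> (\<pi>0 \<circ> \<rho>) = \<rho>" "\<forall>\<pi>\<in>G. \<pi>0 \<circ> (inv \<pi>0 \<circ> \<pi>) = \<pi>"
      using Sym_cancel(1,2)[OF p0] by blast+
    show "(\<lambda>\<rho>. \<pi>0 \<circ> \<rho>) ` Sym k \<subseteq> G"
    proof
      fix \<pi> assume "\<pi> \<in> (\<lambda>\<rho>. \<pi>0 \<circ> \<rho>) ` Sym k"
      then obtain \<rho> where r: "\<rho> \<in> Sym k" "\<pi> = \<pi>0 \<circ> \<rho>" by blast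
      have "\<rho> \<in> Sym l" using permutes_subset[of \<rho> "{..<k}" "{..<l}"] r kl by auto
      then have "\<pi> \<in> Sym l" unfolding r(2) by (rule Sym_comp[OF p0])
      then show "\<pi> \<in> G" using z0 Sym_ge[OF r(1)] by (simp add: G_def r(2))
    qed
    show "(\<lambda>\<pi>. inv \<pi>0 \<circ> \<pi>) ` G \<subseteq> Sym k"
    proof
      fix \<rho> assume "\<rho> \<in> (\<lambda>\<pi>. inv \<pi>0 \<circ> \<pi>) ` G"
      then obtain \<pi> where pi: "\<pi> \<in> Sym l" "\<And>i. k \<le> i \<Longrightarrow> part \<mu> i + \<pi> i = i" "\<rho> = inv \<pi>0 \<circ> \<pi>"
        by (auto simp: G_def)
      have r: "\<rho> \<in> Sym l" unfolding pi(3) by (rule Sym_comp[OF Sym_inv[OF p0] pi(1)])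
      have "\<rho> i = i" if "k \<le> i" for i
      proof -
        have "\<pi> i = \<pi>0 i" using pi(2)[OF that] z0[OF that] by simp
        then show ?thesis using p0 by (simp add: pi(3) permutes_inverses)
      qed
      then show "\<rho> \<in> Sym k" using r permutes_superset[of \<rho> "{..<l}" "{..<k}"] by auto
    qed
  qed
  have perm: "permutation \<rho>" if "\<rho> permutes {..<m}" for \<rho> and m :: nat
    using that permutes_imp_permutation[of "{..<m}"] by auto
  have sum_eq: "(\<Sum>\<pi>\<in>G. if image_mset (\<lambda>i. reduced \<mu> i + \<pi> i) (mset_set {..<k}) = M then of_int (sign \<pi>) else 0) =
      of_int (sign \<pi>0) * bracket k (reduced \<mu>) c M" for M
  proof -
    have "(\<Sum>\<pi>\<in>G. if image_mset (\<lambda>i. reduced \<mu> i + \<pi> i) (mset_set {..<k}) = M then of_int (sign \<pi>) else 0) =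
      (\<Sum>\<rho>\<in>Sym k. if image_mset (\<lambda>i. reduced \<mu> i + (\<pi>0 \<circ> \<rho>) i) (mset_set {..<k}) = M then of_int (sign (\<pi>0 \<circ> \<rho>)) else (0::rat))"
      by (rule sum.reindex_bij_betw[OF bij, symmetric])
    also have "\<dots> = (\<Sum>\<rho>\<in>Sym k. of_int (sign \<pi>0) *
        (if image_mset (\<lambda>i. reduced \<mu> i + c (\<rho> i)) (mset_set {..<k}) = M then of_int (sign \<rho>) else 0))"
    proof (rule sum.cong[OF refl])
      fix \<rho> assume r: "\<rho> \<in> Sym k"
      have "sign (\<pi>0 \<circ> \<rho>) = sign \<pi>0 * sign \<rho>"
        using sign_compose perm p0 r by blast
      moreover have "image_mset (\<lambda>i. reduced \<mu> i + (\<pi>0 \<circ> \<rho>) i) (mset_set {..<k}) =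
          image_mset (\<lambda>i. reduced \<mu> i + c (\<rho> i)) (mset_set {..<k})"
        by (rule image_mset_lessThan_cong) (simp add: \<pi>0_def Sym_less[OF r])
      ultimately show "(if image_mset (\<lambda>i. reduced \<mu> i + (\<pi>0 \<circ> \<rho>) i) (mset_set {..<k}) = M then of_int (sign (\<pi>0 \<circ> \<rho>)) else 0) =
        of_int (sign \<pi>0) * (if image_mset (\<lambda>i. reduced \<mu> i + c (\<rho> i)) (mset_set {..<k}) = M then of_int (sign \<rho>) else (0::rat))"
        by simp
    qed
    finally show ?thesis by (simp add: bracket_def sum_distrib_left)
  qed
  \<comment> \<open>The sum is the total content over all rows, in which the added values of \<pi>0
    cancel the subtracted indices.\<close>
  have total: "(\<Sum>i<k. reduced \<mu> i + c i) = n"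
  proof -
    have "int (\<Sum>i<k. reduced \<mu> i + c i) = (\<Sum>i<k. int (part \<mu> i) - int i + int (\<pi>0 i))"
      unfolding of_nat_sum
    proof (rule sum.cong[OF refl])
      fix i assume "i \<in> {..<k}"
      then show "int (reduced \<mu> i + c i) = int (part \<mu> i) - int i + int (\<pi>0 i)"
        using lo[of i] by (simp add: \<pi>0_def)
    qed
    also have "\<dots> = (\<Sum>i<l. int (part \<mu> i) - int i + int (\<pi>0 i))"
    proof (rule sum.mono_neutral_left)
      show "\<forall>i\<in>{..<l} - {..<k}. int (part \<mu> i) - int i + int (\<pi>0 i) = 0"
      proof
        fix i assume "i \<in> {..<l} - {..<k}"
        then show "int (part \<mu> i) - int i + int (\<pi>0 i) = 0" using z0[of i] by simp
      qed
    qed (use kl in auto)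
    also have "\<dots> = int (\<Sum>i<l. part \<mu> i)"
    proof -
      have "(\<Sum>i<l. int (\<pi>0 i)) = (\<Sum>i<l. int i)"
        by (rule sum.permute[symmetric, unfolded comp_def]) (use p0 in simp)
      then show ?thesis by (simp add: sum.distrib sum_subtractf)
    qed
    also have "(\<Sum>i<l. part \<mu> i) = n" using sum_part[OF p] by (simp add: l_def)
    finally show ?thesis by (simp only: of_nat_eq_iff)
  qed
  \<comment> \<open>Without forced rows the complement is \<open>{..<k}\<close>, and a strictly
    increasing map of this set into itself is the identity.\<close>
  have "c i = i" if "l = k" "i < k" for i
  proof -
    have "A = {..<k}" using that by (simp add: A_def)
    then have ck: "c x < k" if "x < k" for x using c(2) that by auto
    have "j \<le> c j \<and> c j \<le> j" if "j < k" for j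
    proof
      show "j \<le> c j" by (rule sinc_ge[OF c(1) that])
      have "c j + m < k" if "j + m < k" for m
      proof -
        have "c j + m \<le> c (j + m)" using that
        proof (induction m)
          case (Suc m)
          have "c (j + m) < c (j + Suc m)" using c(1) Suc.prems by (simp add: sinc_def)
          then show ?case using Suc by simp
        qed simp
        then show ?thesis using ck[OF that] by simp
      qed
      from this[of "k - 1 - j"] show "c j \<le> j" using that by simp
    qed
    then show ?thesis using that(2) by (simp add: antisym)
  qed
  moreover have "of_int (sign \<pi>0) \<noteq> (0 :: rat)" by simp
  ultimately show ?thesis
    using c(1) total sum_eq unfolding G_def k_def[symmetric] l_def[symmetric]
    by (intro exI[of _ "of_int (sign \<pi>0)"] exI[of _ c]) (simp del: mem_Collect_eq)
qed

section \<open>Power sums and the theorem\<close>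

lemma finite_lookup_le: "finite {a :: nat \<Rightarrow>\<^sub>0 nat. \<forall>i. Poly_Mapping.lookup a i \<le> Poly_Mapping.lookup m i}"
proof (rule finite_imageD[of Poly_Mapping.lookup])
  let ?B = "\<Sum>i\<in>Poly_Mapping.keys m. Poly_Mapping.lookup m i"
  have "Poly_Mapping.lookup m i \<le> ?B" for i
  proof (cases "i \<in> Poly_Mapping.keys m")
    case True
    then show ?thesis by (intro member_le_sum) auto
  qed (simp add: in_keys_iff)
  then have "Poly_Mapping.lookup ` {a. \<forall>i. Poly_Mapping.lookup a i \<le> Poly_Mapping.lookup m i} \<subseteq>
      {f. \<forall>i. (i \<in> Poly_Mapping.keys m \<longrightarrow> f i \<in> {..?B}) \<and> (i \<notin> Poly_Mapping.keys m \<longrightarrow> f i = 0)}"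
    by (auto simp: in_keys_iff intro: order_trans) (metis le_zero_eq)
  then show "finite (Poly_Mapping.lookup ` {a. \<forall>i. Poly_Mapping.lookup a i \<le> Poly_Mapping.lookup m i})"
    by (rule finite_subset) (intro finite_set_of_finite_funs, auto)
  show "inj_on Poly_Mapping.lookup {a. \<forall>i. Poly_Mapping.lookup a i \<le> Poly_Mapping.lookup m i}"
    by (rule inj_onI) (simp add: lookup_inject)
qed

text \<open>The Cauchy product sums over this set, and a sum over an infinite set would be 0 by
  convention.\<close>

lemma finite_decompositions: "finite {(a, b). a + b = (m :: nat \<Rightarrow>\<^sub>0 nat)}"
proof (rule finite_subset)
  let ?A = "{a :: nat \<Rightarrow>\<^sub>0 nat. \<forall>i. Poly_Mapping.lookup a i \<le> Poly_Mapping.lookup m i}"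
  show "{(a, b). a + b = m} \<subseteq> ?A \<times> ?A"
    by (auto simp: lookup_add)
qed (intro finite_cartesian_product finite_lookup_le)

text \<open>The monomial obtained by picking the variable with index \<open>fs ! j\<close> from the
  j-th factor of a product of power sums; variables may repeat.\<close>

definition monom_of :: "nat list \<Rightarrow> nat list \<Rightarrow> (nat \<Rightarrow>\<^sub>0 nat)" where
  "monom_of fs \<nu> = (\<Sum>j<length \<nu>. Poly_Mapping.single (fs ! j) (\<nu> ! j))"

lemma monom_of_Cons: "monom_of (j # fs) (i # \<nu>) = Poly_Mapping.single j i + monom_of fs \<nu>"
  by (simp add: monom_of_def sum.lessThan_Suc_shift del: sum.lessThan_Suc)

lemma lookup_monom_of: "Poly_Mapping.lookup (monom_of fs \<nu>) i = (\<Sum>j<length \<nu>. if fs ! j = i then \<nu> ! j else 0)"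
  unfolding monom_of_def lookup_sum by (intro sum.cong) (auto simp: lookup_single when_def)

lemma power_sum_part_Cons: "power_sum_part (i # \<nu>) = mseries_mult (power_sum i) (power_sum_part \<nu>)"
  by (simp add: power_sum_part_def)

lemma power_sum_part_support:
  "power_sum_part \<nu> m \<noteq> 0 \<Longrightarrow> \<exists>fs. length fs = length \<nu> \<and> m = monom_of fs \<nu>"
proof (induction \<nu> arbitrary: m)
  case Nil
  then show ?case by (simp add: power_sum_part_def mseries_one_def monom_of_def split: if_splits)
next
  case (Cons i \<nu>)
  then obtain a b where ab: "a + b = m" "power_sum i a * power_sum_part \<nu> b \<noteq> 0"
    unfolding power_sum_part_Cons mseries_mult_def by (auto elim: sum.not_neutral_contains_not_neutral)
  then obtain j where j: "a = Poly_Mapping.single j i" by (auto simp: power_sum_def split: if_splits)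
  obtain fs where "length fs = length \<nu>" "b = monom_of fs \<nu>" using Cons.IH[of b] ab by auto
  then show ?case using ab j by (intro exI[of _ "j # fs"]) (simp add: monom_of_Cons)
qed

lemma power_sum_part_nonneg: "0 \<le> power_sum_part \<nu> m"
proof (induction \<nu> arbitrary: m)
  case Nil
  then show ?case by (simp add: power_sum_part_def mseries_one_def)
next
  case (Cons i \<nu>)
  then show ?case unfolding power_sum_part_Cons mseries_mult_def
    by (intro sum_nonneg) (auto simp: power_sum_def)
qed

text \<open>All coefficients are nonnegative, so a single choice of variables that yields the
  monomial is enough.\<close>

lemma power_sum_part_pos: "length fs = length \<nu> \<Longrightarrow> 0 < power_sum_part \<nu> (monom_of fs \<nu>)"
proof (induction fs \<nu> rule: list_induct2)
  case Nil
  then show ?case by (simp add: power_sum_part_def mseries_one_def monom_of_def)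
next
  case (Cons j fs i \<nu>)
  let ?m = "monom_of (j # fs) (i # \<nu>)"
  have "0 < (\<Sum>x\<in>{(a, b). a + b = ?m}. case x of (a, b) \<Rightarrow> power_sum i a * power_sum_part \<nu> b)"
  proof (rule sum_pos2[OF finite_decompositions, of "(Poly_Mapping.single j i, monom_of fs \<nu>)"])
    show "(Poly_Mapping.single j i, monom_of fs \<nu>) \<in> {(a, b). a + b = ?m}" by (simp add: monom_of_Cons)
    show "0 < (case (Poly_Mapping.single j i, monom_of fs \<nu>) of (a, b) \<Rightarrow> power_sum i a * power_sum_part \<nu> b)"
      using Cons.IH by (auto simp: power_sum_def)
  qed (auto simp: power_sum_def power_sum_part_nonneg)
  then show ?case unfolding power_sum_part_Cons mseries_mult_def by simp
qed

text \<open>The left monomial involves k different variables. A product of k power sums reaches it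
  only by picking each of them once, and then the exponents are its parts in some order.\<close>

lemma monom_of_eq_imp_mset_eq:
  assumes len: "length \<nu> = k" "length \<nu>' = k" and pos: "0 \<notin> set \<nu>" "0 \<notin> set \<nu>'"
    and eq: "monom_of [0..<k] \<nu> = monom_of fs \<nu>'"
  shows "mset \<nu> = mset \<nu>'"
proof -
  have L: "Poly_Mapping.lookup (monom_of [0..<k] \<nu>) i = (if i < k then \<nu> ! i else 0)" for i
  proof -
    have "Poly_Mapping.lookup (monom_of [0..<k] \<nu>) i = (\<Sum>j<k. if j = i then \<nu> ! j else 0)"
      unfolding lookup_monom_of len by (intro sum.cong) auto
    then show ?thesis by simp
  qed
  have eq': "(if i < k then \<nu> ! i else 0) = (\<Sum>j<k. if fs ! j = i then \<nu>' ! j else 0)" for i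
    using L[of i] lookup_monom_of[of fs \<nu>' i] eq len by simp
  have p: "0 < \<nu> ! i" "0 < \<nu>' ! i" if "i < k" for i
    using pos len that by (metis gr0I nth_mem)+
  have less: "fs ! j < k" if "j < k" for j
  proof (rule ccontr)
    assume "\<not> fs ! j < k"
    then have "(\<Sum>j'<k. if fs ! j' = fs ! j then \<nu>' ! j' else 0) = 0" using eq'[of "fs ! j"] by simp
    then have "\<forall>j'\<in>{..<k}. (if fs ! j' = fs ! j then \<nu>' ! j' else 0) = 0"
      by (simp add: sum_nonneg_eq_0_iff)
    from bspec[OF this, of j] show False using that p(2)[OF that] by simp
  qed
  have "\<exists>j<k. fs ! j = i" if "i < k" for i
  proof (rule ccontr)
    assume "\<not> ?thesis"
    then have "(\<Sum>j<k. if fs ! j = i then \<nu>' ! j else 0) = 0" by (intro sum.neutral) auto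
    then show False using eq'[of i] p(1)[OF that] that by simp
  qed
  then have img: "(!) fs ` {..<k} = {..<k}" using less by auto
  then have inj: "inj_on ((!) fs) {..<k}" by (intro eq_card_imp_inj_on) auto
  have nth: "\<nu>' ! j = \<nu> ! (fs ! j)" if "j < k" for j
  proof -
    have "\<nu> ! (fs ! j) = (\<Sum>j'<k. if fs ! j' = fs ! j then \<nu>' ! j' else 0)" using eq'[of "fs ! j"] less[OF that] by simp
    also have "\<dots> = (\<Sum>j'<k. if j' = j then \<nu>' ! j' else 0)"
      using inj that by (intro sum.cong refl) (auto dest: inj_onD)
    finally show ?thesis using that by simp
  qed
  have "mset \<nu>' = image_mset (\<lambda>j. \<nu> ! (fs ! j)) (mset_set {..<k})"
    unfolding mset_eq_image_nth[of \<nu>'] len by (rule image_mset_lessThan_cong) (rule nth)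
  also have "\<dots> = image_mset ((!) \<nu>) (image_mset ((!) fs) (mset_set {..<k}))"
    by (simp add: multiset.map_comp comp_def)
  also have "\<dots> = mset \<nu>" unfolding mset_eq_image_nth[of \<nu>] len by (simp add: image_mset_mset_set[OF inj] img)
  finally show ?thesis by simp
qed

definition parts :: "nat \<Rightarrow> nat \<Rightarrow> nat list set" where
  "parts n k = {\<nu>. is_partition n \<nu> \<and> length \<nu> = k}"

lemma finite_parts [simp]: "finite (parts n k)"
  by (rule finite_subset[OF _ finite_partitions[of n]]) (auto simp: parts_def)

text \<open>All products have the same number k of factors, so the monomial with exponents \<nu> on
  the first k variables occurs in the product for \<nu> only.\<close>

lemma power_sums_independent:
  assumes 0: "(\<Sum>\<nu>\<in>parts n k. qscale (y \<nu>) (power_sum_part \<nu>)) = 0" and nu: "\<nu> \<in> parts n k"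
  shows "y \<nu> = 0"
proof -
  let ?m = "monom_of [0..<k] \<nu>"
  have z: "power_sum_part \<nu>' ?m = 0" if "\<nu>' \<in> parts n k" "\<nu>' \<noteq> \<nu>" for \<nu>'
  proof (rule ccontr)
    assume "\<not> ?thesis"
    then obtain fs where "?m = monom_of fs \<nu>'" using power_sum_part_support by blast
    then have "mset \<nu> = mset \<nu>'"
      using that nu by (intro monom_of_eq_imp_mset_eq) (auto simp: parts_def is_partition_def)
    then show False using that nu partition_mset_inject by (auto simp: parts_def)
  qed
  have "0 = (\<Sum>\<nu>'\<in>parts n k. qscale (y \<nu>') (power_sum_part \<nu>')) ?m" by (simp add: 0)
  also have "\<dots> = (\<Sum>\<nu>'\<in>parts n k. if \<nu>' = \<nu> then y \<nu> * power_sum_part \<nu> ?m else 0)"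
    unfolding sum_fun_apply qscale_def using z by (intro sum.cong refl) auto
  also have "\<dots> = y \<nu> * power_sum_part \<nu> ?m" using nu by simp
  finally show ?thesis using power_sum_part_pos[of "[0..<k]" \<nu>] nu by (auto simp: parts_def)
qed

text \<open>The same choice as in \<open>chi\<close>, which thereby unfolds to a value at this
  permutation.\<close>

definition perm_of_type :: "nat \<Rightarrow> nat list \<Rightarrow> nat \<Rightarrow> nat" where
  "perm_of_type n \<nu> = (SOME \<sigma>. \<sigma> permutes {..<n} \<and> cycle_type n \<sigma> = mset \<nu>)"

lemma perm_of_type:
  assumes "is_partition n \<nu>"
  shows "perm_of_type n \<nu> \<in> Sym n" "cycle_type n (perm_of_type n \<nu>) = mset \<nu>"
proof -
  have "\<exists>\<sigma>. \<sigma> permutes {..<n} \<and> cycle_type n \<sigma> = mset \<nu>"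
    using permutation_of_cycle_type[of \<nu> n] assms by (auto simp: is_partition_def)
  from someI_ex[OF this] show "perm_of_type n \<nu> \<in> Sym n" "cycle_type n (perm_of_type n \<nu>) = mset \<nu>"
    by (simp_all add: perm_of_type_def)
qed

text \<open>For a partition of n the numerator counts the bijections between parts and cycles that
  preserve size. It cancels the factorials in \<open>zee\<close>, so the weight is the reciprocal of
  the product of the parts.\<close>

definition weight :: "nat \<Rightarrow> nat list \<Rightarrow> rat" where
  "weight n \<nu> = fixw n (ipart \<nu>) (perm_of_type n \<nu>) / of_nat (zee \<nu>)"

lemma weight_nonzero:
  assumes p: "is_partition n \<nu>" shows "weight n \<nu> \<noteq> 0"
proof -
  have nz: "0 \<notin> set \<nu>" using p by (simp add: is_partition_def)
  have "\<exists>u\<in>words n (ipart \<nu>). u \<circ> perm_of_type n \<nu> = u"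
    by (rule invariant_word_exists) (use perm_of_type[OF p] content_mset_part[OF nz] in auto)
  then have "fixw n (ipart \<nu>) (perm_of_type n \<nu>) \<noteq> 0" by (auto simp: fixw_def)
  moreover have "zee \<nu> \<noteq> 0" using nz by (auto simp: zee_def)
  ultimately show ?thesis by (simp add: weight_def)
qed

text \<open>The linear substitution of weighted power sum products for formal monomials; linearity
  carries spans of brackets over to spans of series.\<close>

definition power_sum_comb :: "nat \<Rightarrow> nat \<Rightarrow> (nat multiset \<Rightarrow> rat) \<Rightarrow> mseries" where
  "power_sum_comb n k g = (\<Sum>\<nu>\<in>parts n k. qscale (g (mset \<nu>) * weight n \<nu>) (power_sum_part \<nu>))"

lemma power_sum_comb_hom: "module_hom qscale qscale (power_sum_comb n k)"
proof unfold_locales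
  show "power_sum_comb n k (f + g) = power_sum_comb n k f + power_sum_comb n k g" for f g
    by (simp add: power_sum_comb_def distrib_right qvec.scale_left_distrib sum.distrib)
  show "power_sum_comb n k (qscale c f) = qscale c (power_sum_comb n k f)" for c f
    by (simp add: power_sum_comb_def qvec.scale_sum_right qscale_apply mult.assoc)
qed

text \<open>This chains the proportionalities between Specht character, class sum, Jacobi-Trudi sum
  and bracket. The total scalar s does not depend on the cycle type.\<close>

lemma bottom_schur_eq:
  assumes p: "is_partition n \<mu>" and r: "rank \<mu> = k"
  shows "\<exists>s c. s \<noteq> 0 \<and> sinc k c \<and> (length \<mu> = k \<longrightarrow> (\<forall>i<k. c i = i)) \<and>
    (\<Sum>i<k. reduced \<mu> i + c i) = n \<and>
    bottom_schur \<mu> = qscale s (power_sum_comb n k (bracket k (reduced \<mu>) c))"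
proof -
  have n: "sum_list \<mu> = n" using p by (simp add: is_partition_def)
  obtain d1 where d1: "d1 \<noteq> 0" "\<And>\<sigma>. \<sigma> \<in> Sym n \<Longrightarrow> specht_character \<mu> \<sigma> = d1 * young_class \<mu> \<sigma>"
    using specht_character_eq[OF p] by blast
  obtain d2 where d2: "d2 \<noteq> 0" "\<And>\<sigma>. \<sigma> \<in> Sym n \<Longrightarrow> young_class \<mu> \<sigma> = d2 * jt_class n \<mu> \<sigma>"
    using young_class_eq_jt_class[OF p] by blast
  obtain e c where ec: "e \<noteq> 0" "sinc k c" "length \<mu> = k \<longrightarrow> (\<forall>i<k. c i = i)" "(\<Sum>i<k. reduced \<mu> i + c i) = n"
    and br: "\<And>M. (\<Sum>\<pi> | \<pi> \<in> Sym (length \<mu>) \<and> (\<forall>i\<ge>k. part \<mu> i + \<pi> i = i).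
      if image_mset (\<lambda>i. reduced \<mu> i + \<pi> i) (mset_set {..<k}) = M then of_int (sign \<pi>) else 0) =
      e * bracket k (reduced \<mu>) c M"
    using bottom_sum_eq_bracket[OF p] unfolding r by blast
  have "chi \<mu> \<nu> / of_nat (zee \<nu>) = (d1 * d2 * e) * (bracket k (reduced \<mu>) c (mset \<nu>) * weight n \<nu>)"
    if "\<nu> \<in> parts n k" for \<nu>
  proof -
    have q: "is_partition n \<nu>" "length \<nu> = rank \<mu>" using that r by (auto simp: parts_def)
    have "chi \<mu> \<nu> = specht_character \<mu> (perm_of_type n \<nu>)" by (simp add: chi_def perm_of_type_def n)
    also have "\<dots> = d1 * d2 * jt_class n \<mu> (perm_of_type n \<nu>)"
      using d1(2) d2(2) perm_of_type(1)[OF q(1)] by simp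
    finally show ?thesis
      using jt_class_bottom[OF p perm_of_type(1)[OF q(1)] q perm_of_type(2)[OF q(1)]] br
      by (simp add: r weight_def)
  qed
  then have "bottom_schur \<mu> = (\<Sum>\<nu>\<in>parts n k.
      qscale ((d1 * d2 * e) * (bracket k (reduced \<mu>) c (mset \<nu>) * weight n \<nu>)) (power_sum_part \<nu>))"
    unfolding bottom_schur_def n r by (intro sum.cong) (auto simp: parts_def)
  also have "\<dots> = qscale (d1 * d2 * e) (power_sum_comb n k (bracket k (reduced \<mu>) c))"
    by (simp add: power_sum_comb_def qvec.scale_sum_right)
  finally show ?thesis using d1(1) d2(1) ec by (intro exI[of _ "d1 * d2 * e"] exI[of _ c]) simp
qed

text \<open>Working with families also yields injectivity: two indices with the same vector would
  give a relation with coefficients 1 and -1.\<close>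

lemma independent_family:
  fixes f :: "'i \<Rightarrow> 'a \<Rightarrow> rat"
  assumes fin: "finite I" and ind: "\<And>x i. (\<Sum>i\<in>I. qscale (x i) (f i)) = 0 \<Longrightarrow> i \<in> I \<Longrightarrow> x i = 0"
  shows "inj_on f I" "qvec.independent (f ` I)"
proof -
  show inj: "inj_on f I"
  proof (rule inj_onI, rule ccontr)
    fix i j assume ij: "i \<in> I" "j \<in> I" "f i = f j" "i \<noteq> j"
    define x :: "'i \<Rightarrow> rat" where "x l = (if l = i then 1 else if l = j then -1 else 0)" for l
    have "(\<Sum>l\<in>I. qscale (x l) (f l)) = (\<Sum>l\<in>{i, j}. qscale (x l) (f l))"
      using fin ij by (intro sum.mono_neutral_right) (auto simp: x_def)
    also have "\<dots> = 0" using ij by (simp add: x_def)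
    finally have "x i = 0" using ind ij by blast
    then show False by (simp add: x_def)
  qed
  show "qvec.independent (f ` I)"
    unfolding qvec.dependent_finite[OF finite_imageI[OF fin]]
    using ind[of "\<lambda>i. _ (f i)"] by (auto simp: sum.reindex[OF inj])
qed

theorem theorem4p3:
  fixes n k :: nat
  assumes "n \<ge> 1" and "k \<ge> 1"
  shows "let I = {\<nu>. is_partition n \<nu> \<and> rank \<nu> = k \<and> length \<nu> = k};
             J = {\<mu>. is_partition n \<mu> \<and> rank \<mu> = k}
         in inj_on bottom_schur I
          \<and> qvec.independent (bottom_schur ` I)
          \<and> qvec.span (bottom_schur ` I) = qvec.span (bottom_schur ` J)"
proof -
  let ?I = "square_partitions n k" and ?J = "{\<mu>. is_partition n \<mu> \<and> rank \<mu> = k}"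
  define B where "B \<nu> = bracket k (reduced \<nu>) id" for \<nu>
  let ?L = "power_sum_comb n k"
  have "\<exists>s. s \<noteq> 0 \<and> bottom_schur \<nu> = qscale s (?L (B \<nu>))" if "\<nu> \<in> ?I" for \<nu>
  proof -
    have q: "is_partition n \<nu>" "rank \<nu> = k" "length \<nu> = k" using that by (auto simp: square_partitions_def)
    obtain s c where "s \<noteq> 0" "\<forall>i<k. c i = i" "bottom_schur \<nu> = qscale s (?L (bracket k (reduced \<nu>) c))"
      using bottom_schur_eq[OF q(1,2)] q(3) by blast
    moreover from this have "bracket k (reduced \<nu>) c = B \<nu>" unfolding B_def by (intro bracket_cong) auto
    ultimately show ?thesis by auto
  qed
  then obtain s where s: "\<And>\<nu>. \<nu> \<in> ?I \<Longrightarrow> s \<nu> \<noteq> 0 \<and> bottom_schur \<nu> = qscale (s \<nu>) (?L (B \<nu>))" by metis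
  \<comment> \<open>Comparing coefficients of power sum products and dividing by the nonzero weights
    turns a relation among bottom Schur functions into one among brackets.\<close>
  have ind: "x \<mu> = 0" if 0: "(\<Sum>\<nu>\<in>?I. qscale (x \<nu>) (bottom_schur \<nu>)) = 0" and mu: "\<mu> \<in> ?I" for x \<mu>
  proof -
    have "(\<Sum>\<nu>\<in>?I. qscale (x \<nu>) (bottom_schur \<nu>)) = ?L (\<Sum>\<nu>\<in>?I. qscale (x \<nu> * s \<nu>) (B \<nu>))"
      unfolding module_hom.sum[OF power_sum_comb_hom] module_hom.scale[OF power_sum_comb_hom]
      by (intro sum.cong refl) (simp add: s)
    also have "\<dots> = (\<Sum>\<nu>\<in>parts n k. qscale ((\<Sum>\<kappa>\<in>?I. x \<kappa> * s \<kappa> * B \<kappa> (mset \<nu>)) * weight n \<nu>) (power_sum_part \<nu>))"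
      by (simp add: power_sum_comb_def sum_fun_apply qscale_apply)
    finally have "(\<Sum>\<kappa>\<in>?I. x \<kappa> * s \<kappa> * B \<kappa> (mset \<nu>)) * weight n \<nu> = 0" if "\<nu> \<in> parts n k" for \<nu>
      using 0
      by (intro power_sums_independent[where y = "\<lambda>\<nu>. (\<Sum>\<kappa>\<in>?I. x \<kappa> * s \<kappa> * B \<kappa> (mset \<nu>)) * weight n \<nu>", OF _ that]) simp
    then have "(\<Sum>\<kappa>\<in>?I. x \<kappa> * s \<kappa> * B \<kappa> (mset \<nu>)) = 0" if "\<nu> \<in> ?I" for \<nu>
      using that weight_nonzero[of n \<nu>] by (auto simp: square_partitions_def parts_def)
    then have "x \<mu> * s \<mu> = 0" using bracket_independent[of n k "\<lambda>\<kappa>. x \<kappa> * s \<kappa>"] mu unfolding B_def by blast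
    then show ?thesis using s[OF mu] by simp
  qed
  have "bottom_schur ` ?J \<subseteq> qvec.span (bottom_schur ` ?I)"
  proof (rule image_subsetI)
    fix \<mu> assume "\<mu> \<in> ?J"
    then have p: "is_partition n \<mu>" and r: "rank \<mu> = k" by simp_all
    obtain e c where ec: "sinc k c" "(\<Sum>i<k. reduced \<mu> i + c i) = n"
      "bottom_schur \<mu> = qscale e (?L (bracket k (reduced \<mu>) c))"
      using bottom_schur_eq[OF p r] by blast
    have lo: "i < part \<mu> i" if "i < k" for i using rank_iff[OF p] that r by simp
    have dec: "sdec k (reduced \<mu>)"
      unfolding sdec_def
    proof (intro allI impI)
      fix i j assume "i < j" "j < k"
      then show "reduced \<mu> j < reduced \<mu> i" using lo[of j] part_antimono[OF p, of i j] by simp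
    qed
    \<comment> \<open>Here c may differ from \<open>id\<close>. The total in \<open>ec(2)\<close>
      ensures that the spanning brackets come from partitions of the same n.\<close>
    have "bracket k (reduced \<mu>) c \<in> qvec.span (B ` ?I)"
      using bracket_in_span[OF dec _ ec(1)] lo unfolding ec(2) B_def by simp
    then have "?L (bracket k (reduced \<mu>) c) \<in> qvec.span (?L ` B ` ?I)"
      unfolding module_hom.span_image[OF power_sum_comb_hom] by (rule imageI)
    moreover have "?L ` B ` ?I \<subseteq> qvec.span (bottom_schur ` ?I)"
    proof clarify
      fix \<nu> assume nu: "\<nu> \<in> ?I"
      have "?L (B \<nu>) = qscale (1 / s \<nu>) (bottom_schur \<nu>)" using s[OF nu] by simp
      then show "?L (B \<nu>) \<in> qvec.span (bottom_schur ` ?I)"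
        using nu by (simp add: qvec.span_scale qvec.span_base)
    qed
    ultimately have "?L (bracket k (reduced \<mu>) c) \<in> qvec.span (bottom_schur ` ?I)"
      using qvec.span_minimal[OF _ qvec.subspace_span] by blast
    then show "bottom_schur \<mu> \<in> qvec.span (bottom_schur ` ?I)" unfolding ec(3) by (rule qvec.span_scale)
  qed
  then have "qvec.span (bottom_schur ` ?J) \<subseteq> qvec.span (bottom_schur ` ?I)"
    by (rule qvec.span_minimal) (rule qvec.subspace_span)
  moreover have "qvec.span (bottom_schur ` ?I) \<subseteq> qvec.span (bottom_schur ` ?J)"
    by (rule qvec.span_mono) (auto simp: square_partitions_def)
  ultimately have "qvec.span (bottom_schur ` ?I) = qvec.span (bottom_schur ` ?J)" by blast
  moreover have "inj_on bottom_schur ?I" "qvec.independent (bottom_schur ` ?I)"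
    by (rule independent_family[OF finite_square_partitions]; rule ind; assumption)+
  ultimately show ?thesis unfolding square_partitions_def Let_def by blast
qed

end
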